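(* Let $R=C+A$ be a real linear trace-class operator on a separable complex Hilbert space $\mathcal{H}$, with complex linear part $C$ and antilinear part $A$. Then its characteristic function $\varphi$ is continuous on $\mathbb{C}\setminus\{0\}$, and its zeros are the nonzero eigenvalues of $R$, i.e. for $\lambda\in\mathbb{C}\setminus\{0\}$ one has $\varphi(\lambda)=0$ if and only if $\lambda$ is an eigenvalue of $R$. Furthermore, for all $\lambda\neq0$, $$\varphi(\lambda)=\lim_{n\to\infty}\frac{p_n(\lambda,\overline\lambda)}{|\lambda|^{2n}},$$ where $R_n=C_n+A_n$ ($n=1,2,\dots$) are real linear operators on $\mathcal{H}$ of finite rank $n$, with characteristic polynomials $p_n(\lambda,\overline\lambda)$, such that $\|R_n-R\|_1\to0$ as $n\to\infty$.
   Context: A map $R$ on $\mathcal{H}$ is real linear if it is additive and $R(rx)=rRx$ for $r\in\mathbb{R}$; it splits uniquely as $R=C+A$ with complex linear part $C=\frac12(R-iRi)$ and antilinear part $A=\frac12(R+iRi)$. $R$ is trace-class if $C$ and $A$ are compact and the singular numbers $s_j(C)$ and $s_j(A)$ are summable, where the singular numbers of an antilinear compact $A$ are the square roots of the eigenvalues of the positive complex linear operator $A^*A$ (with $(Ax,y)=(A^*y,x)$); then $\|R\|_1=\|C\|_1+\|A\|_1=\sum_j s_j(C)+\sum_j s_j(A)$. A number $\lambda\in\mathbb{C}$ is an eigenvalue of $R$ if $Rx=\lambda x$ for some $x\ne0$. Fix a unitary conjugation $\kappa$ on $\mathcal{H}$ (an antilinear bijective isometry with $\kappa^2=I$). The complexification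 of a real linear operator $S=C_S+A_S$ is the complex linear operator on $\mathcal{H}\oplus\mathcal{H}$ $$S^{\mathbb{C}}=\begin{bmatrix} C_S & A_S\kappa\\ \kappa A_S & \kappa C_S\kappa\end{bmatrix}.$$ For a complex linear trace-class operator $K$, $\det(I+K)$ denotes the (Fredholm) determinant, $\det(I+K)=\lim_m\det(I+K_m)$ for finite rank $K_m$ with $\|K_m-K\|_1\to0$. The characteristic function of the trace-class operator $R=C+A$ is defined for $\lambda=re^{i\theta}\ne0$ ($r>0$, $\theta\in\mathbb{R}$) by $$\varphi(re^{i\theta})=\det\left[I-r^{-1}(e^{-i\theta}C+A)\right]^{\mathbb{C}}.$$ A real linear operator $S$ on $\mathcal{H}$ is of finite rank $n$ if the smallest complex linear subspace $\mathcal{M}$ of $\mathcal{H}$ containing the range of $S$ has dimension $n$. Its characteristic polynomial is formed by choosing an orthonormal basis $e_1,\dots,e_n$ of $\mathcal{M}$ and representing $S$ (restricted to $\mathcal{M}$) on $\mathbb{C}^n$ as $C_0+B_0\tau$, with $C_0,B_0\in\mathbb{C}^{n\times n}$ and $\tau z=\overline z$ componentwise conjugation; it is $$p(\lambda,\overline\lambda)=\det\begin{bmatrix} C_0-\lambda & B_0\\ \overline{B_0} & \overline{C_0-\lambda}\end{bmatrix},$$ where the bar on matrices denotes entrywise conjugation. *)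

theory Defs
  imports "HOL-Analysis.Analysis" "Jordan_Normal_Form.Determinant"
begin

(* The inner product is linear in the first argument.  Norm, metric and topology are inherited
   from the underlying real inner product, which is the real part of the complex one. *)
class complex_inner = real_inner +
  fixes scaleC :: "complex \<Rightarrow> 'a \<Rightarrow> 'a" (infixr "*\<^sub>C" 75)
    and cinner :: "'a \<Rightarrow> 'a \<Rightarrow> complex"
  assumes scaleC_add_right: "c *\<^sub>C (x + y) = c *\<^sub>C x + c *\<^sub>C y"
    and scaleC_add_left: "(c + d) *\<^sub>C x = c *\<^sub>C x + d *\<^sub>C x"
    and scaleC_scaleC: "c *\<^sub>C (d *\<^sub>C x) = (c * d) *\<^sub>C x"
    and scaleC_complex_of_real: "complex_of_real r *\<^sub>C x = r *\<^sub>R x"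
    and cinner_add_left: "cinner (x + y) z = cinner x z + cinner y z"
    and cinner_scaleC_left: "cinner (c *\<^sub>C x) y = c * cinner x y"
    and cinner_commute: "cinner x y = cnj (cinner y x)"
    and Re_cinner: "Re (cinner x y) = inner x y"

class complex_hilbert = complex_inner + complete_space

lemma scaleC_one: "1 *\<^sub>C (x :: 'a::complex_inner) = x"
  using scaleC_complex_of_real[of 1 x] by simp

global_interpretation complex_vector:
  vector_space "scaleC :: complex \<Rightarrow> 'a \<Rightarrow> 'a::complex_inner"
  by unfold_locales
     (simp_all add: scaleC_add_right scaleC_add_left scaleC_scaleC scaleC_one)

instantiation prod :: (complex_inner, complex_inner) complex_inner
begin

definition scaleC_prod_def: "c *\<^sub>C z = (c *\<^sub>C fst z, c *\<^sub>C snd z)"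

definition cinner_prod_def: "cinner z w = cinner (fst z) (fst w) + cinner (snd z) (snd w)"

instance
proof
  fix z w :: "'a \<times> 'b"
  show "cinner z w = cnj (cinner w z)"
    by (metis cinner_prod_def cinner_commute complex_cnj_add)
qed (auto simp: scaleC_prod_def cinner_prod_def inner_prod_def scaleR_prod_def plus_prod_def
       scaleC_add_right scaleC_add_left scaleC_scaleC scaleC_complex_of_real
       cinner_add_left cinner_scaleC_left Re_cinner algebra_simps)

end

instance prod :: (complex_hilbert, complex_hilbert) complex_hilbert ..

definition real_linear :: "('a::complex_inner \<Rightarrow> 'a) \<Rightarrow> bool" where
  "real_linear R \<longleftrightarrow> (\<forall>x y. R (x + y) = R x + R y) \<and> (\<forall>r x. R (r *\<^sub>R x) = r *\<^sub>R R x)"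

definition complex_linear :: "('a::complex_inner \<Rightarrow> 'a) \<Rightarrow> bool" where
  "complex_linear T \<longleftrightarrow> (\<forall>x y. T (x + y) = T x + T y) \<and> (\<forall>c x. T (c *\<^sub>C x) = c *\<^sub>C T x)"

definition antilinear :: "('a::complex_inner \<Rightarrow> 'a) \<Rightarrow> bool" where
  "antilinear T \<longleftrightarrow> (\<forall>x y. T (x + y) = T x + T y) \<and> (\<forall>c x. T (c *\<^sub>C x) = cnj c *\<^sub>C T x)"

definition linear_part :: "('a::complex_inner \<Rightarrow> 'a) \<Rightarrow> 'a \<Rightarrow> 'a" where
  "linear_part R x = (1/2) *\<^sub>C (R x - \<i> *\<^sub>C R (\<i> *\<^sub>C x))"

definition antilinear_part :: "('a::complex_inner \<Rightarrow> 'a) \<Rightarrow> 'a \<Rightarrow> 'a" where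
  "antilinear_part R x = (1/2) *\<^sub>C (R x + \<i> *\<^sub>C R (\<i> *\<^sub>C x))"

definition is_eigenvalue :: "('a::complex_inner \<Rightarrow> 'a) \<Rightarrow> complex \<Rightarrow> bool" where
  "is_eigenvalue R l \<longleftrightarrow> (\<exists>x. x \<noteq> 0 \<and> R x = l *\<^sub>C x)"

definition linear_adjoint :: "('a::complex_inner \<Rightarrow> 'a) \<Rightarrow> 'a \<Rightarrow> 'a" where
  "linear_adjoint C = (THE D. \<forall>x y. cinner (C x) y = cinner x (D y))"

definition antilinear_adjoint :: "('a::complex_inner \<Rightarrow> 'a) \<Rightarrow> 'a \<Rightarrow> 'a" where
  "antilinear_adjoint A = (THE B. \<forall>x y. cinner (A x) y = cinner (B y) x)"

definition compact_operator :: "('a::complex_inner \<Rightarrow> 'a) \<Rightarrow> bool" where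
  "compact_operator T \<longleftrightarrow> compact (closure (T ` cball 0 1))"

(* For a positive compact operator P and t > 0: the number of eigenvalues of P in [t, \<infinity>),
   counted with (complex) multiplicity. *)
definition eigenvalue_count :: "('a::complex_inner \<Rightarrow> 'a) \<Rightarrow> real \<Rightarrow> nat" where
  "eigenvalue_count P t =
     (\<Sum>u \<in> {u. t \<le> u \<and> is_eigenvalue P (complex_of_real u)}.
        complex_vector.dim {x. P x = complex_of_real u *\<^sub>C x})"

(* The eigenvalues of a positive compact operator in non-increasing order, repeated according to
   multiplicity, indexed from j = 0 and continued by 0 once the positive eigenvalues are
   exhausted: the j-th one is the largest positive eigenvalue u with more than j eigenvalues
   in [u, \<infinity>).  The supremum is attained. *)
definition ordered_eigenvalue :: "('a::complex_inner \<Rightarrow> 'a) \<Rightarrow> nat \<Rightarrow> real" where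
  "ordered_eigenvalue P j =
     Sup (insert 0 {u. 0 < u \<and> is_eigenvalue P (complex_of_real u) \<and> j < eigenvalue_count P u})"

definition linear_singular_number :: "('a::complex_inner \<Rightarrow> 'a) \<Rightarrow> nat \<Rightarrow> real" where
  "linear_singular_number C j = sqrt (ordered_eigenvalue (linear_adjoint C \<circ> C) j)"

definition antilinear_singular_number :: "('a::complex_inner \<Rightarrow> 'a) \<Rightarrow> nat \<Rightarrow> real" where
  "antilinear_singular_number A j = sqrt (ordered_eigenvalue (antilinear_adjoint A \<circ> A) j)"

definition trace_class :: "('a::complex_inner \<Rightarrow> 'a) \<Rightarrow> bool" where
  "trace_class R \<longleftrightarrow> real_linear R \<and>
     compact_operator (linear_part R) \<and> compact_operator (antilinear_part R) \<and>
     summable (linear_singular_number (linear_part R)) \<and>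
     summable (antilinear_singular_number (antilinear_part R))"

(* Meaningful only under trace_class R. *)
definition trace_norm :: "('a::complex_inner \<Rightarrow> 'a) \<Rightarrow> real" where
  "trace_norm R = (\<Sum>j. linear_singular_number (linear_part R) j) +
                  (\<Sum>j. antilinear_singular_number (antilinear_part R) j)"

(* The sequence is indexed by n = 1, 2, ...; the term with index 0 is ignored. *)
definition trace_norm_convergent :: "(nat \<Rightarrow> 'a::complex_inner \<Rightarrow> 'a) \<Rightarrow> ('a \<Rightarrow> 'a) \<Rightarrow> bool" where
  "trace_norm_convergent Rs R \<longleftrightarrow>
     (\<forall>n\<ge>1. trace_class (\<lambda>x. Rs n x - R x)) \<and>
     (\<lambda>n. trace_norm (\<lambda>x. Rs n x - R x)) \<longlonglongrightarrow> 0"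

definition range_span :: "('a::complex_inner \<Rightarrow> 'a) \<Rightarrow> 'a set" where
  "range_span S = complex_vector.span (range S)"

definition finite_rank :: "('a::complex_inner \<Rightarrow> 'a) \<Rightarrow> bool" where
  "finite_rank S \<longleftrightarrow> real_linear S \<and> (\<exists>B. finite B \<and> range_span S = complex_vector.span B)"

definition operator_rank :: "('a::complex_inner \<Rightarrow> 'a) \<Rightarrow> nat" where
  "operator_rank S = complex_vector.dim (range_span S)"

definition orthonormal_basis :: "'a::complex_inner list \<Rightarrow> 'a set \<Rightarrow> bool" where
  "orthonormal_basis es M \<longleftrightarrow>
     (\<forall>i<length es. \<forall>j<length es. cinner (es ! i) (es ! j) = (if i = j then 1 else 0)) \<and>
     complex_vector.span (set es) = M"

definition range_basis :: "('a::complex_inner \<Rightarrow> 'a) \<Rightarrow> 'a list" where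
  "range_basis S = (SOME es. orthonormal_basis es (range_span S))"

(* Entry (i, j) is the i-th coordinate of S e_j. *)
definition compression_matrix :: "'a::complex_inner list \<Rightarrow> ('a \<Rightarrow> 'a) \<Rightarrow> complex mat" where
  "compression_matrix es S = mat (length es) (length es) (\<lambda>(i, j). cinner (S (es ! j)) (es ! i))"

(* For finite rank S = C + A, in coordinates on the span of the range of S, the operator S is
   C0 + B0 \<tau>, where C0 and B0 are the matrices of C and A on the basis vectors. *)
definition characteristic_polynomial :: "('a::complex_inner \<Rightarrow> 'a) \<Rightarrow> complex \<Rightarrow> complex" where
  "characteristic_polynomial S l =
     (let es = range_basis S;
          C0 = compression_matrix es (linear_part S);
          B0 = compression_matrix es (antilinear_part S);
          D = C0 - l \<cdot>\<^sub>m 1\<^sub>m (length es)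
      in det (four_block_mat D B0 (map_mat cnj B0) (map_mat cnj D)))"

(* det (I + K) for complex linear K of finite rank: I + K acts as the identity modulo the range
   of K, so this is the determinant of its restriction to that range. *)
definition finite_rank_det :: "('a::complex_inner \<Rightarrow> 'a) \<Rightarrow> complex" where
  "finite_rank_det K =
     (let es = range_basis K in det (1\<^sub>m (length es) + compression_matrix es K))"

(* fredholm_det T is the determinant of T = I + K with K = T - I trace-class. *)
definition fredholm_det :: "('a::complex_inner \<Rightarrow> 'a) \<Rightarrow> complex" where
  "fredholm_det T =
     (THE d. \<forall>Ks. (\<forall>m. complex_linear (Ks m) \<and> finite_rank (Ks m)) \<longrightarrow>
        trace_norm_convergent Ks (\<lambda>x. T x - x) \<longrightarrow> (\<lambda>m. finite_rank_det (Ks m)) \<longlonglongrightarrow> d)"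

definition unitary_conjugation :: "('a::complex_inner \<Rightarrow> 'a) \<Rightarrow> bool" where
  "unitary_conjugation k \<longleftrightarrow>
     antilinear k \<and> bij k \<and> (\<forall>x. norm (k x) = norm x) \<and> k \<circ> k = id"

definition complexification ::
    "('a::complex_inner \<Rightarrow> 'a) \<Rightarrow> ('a \<Rightarrow> 'a) \<Rightarrow> 'a \<times> 'a \<Rightarrow> 'a \<times> 'a" where
  "complexification k S = (\<lambda>(x, y).
     (linear_part S x + antilinear_part S (k y),
      k (antilinear_part S x) + k (linear_part S (k y))))"

(* At l = r exp(i \<theta>) with r > 0; only exp(-i \<theta>) enters, so the choice of the argument \<theta> is
   immaterial. *)
definition characteristic_function ::
    "('a::complex_inner \<Rightarrow> 'a) \<Rightarrow> ('a \<Rightarrow> 'a) \<Rightarrow> complex \<Rightarrow> complex" where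
  "characteristic_function k R l =
     fredholm_det (complexification k
       (\<lambda>x. x - (1 / cmod l) *\<^sub>R (cis (- Arg l) *\<^sub>C linear_part R x + antilinear_part R x)))"

end

theory Submission
  imports Defs
begin

text \<open>
  Write \<open>C\<close> and \<open>A\<close> for the linear and antilinear parts of \<open>R\<close> and \<open>\<kappa>\<close> for the conjugation.  At
  \<open>l = r e^(i\<theta>)\<close> the characteristic function is \<open>det (I + K\<^sub>l)\<close>, where \<open>K\<^sub>l\<close> acts on pairs and is built
  linearly from the two complex linear operators \<open>- C / l\<close> and \<open>- \<kappa> A / \<bar>l\<bar>\<close> (\<open>char_block\<close>).  Since
  \<open>A\<^sup>* A = (\<kappa> A)\<^sup>* (\<kappa> A)\<close>, the singular numbers of \<open>A\<close> are those of \<open>\<kappa> A\<close>, so everything reduces to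
  complex linear trace class operators, and all three claims follow from four facts about them.

  \<^item> The determinant exists: \<open>det (I + K\<^sub>m)\<close> has the same limit for all finite rank
    \<open>K\<^sub>m \<longlonglongrightarrow> K\<close> in trace norm (\<open>finite_rank_det_limit_exists\<close>, \<open>fredholm_det\<close>).
  \<^item> It depends continuously on \<open>K\<close> in trace norm (\<open>fredholm_det_tendsto\<close>); as \<open>K\<^sub>l\<close> is continuous
    in \<open>l \<noteq> 0\<close>, so is the characteristic function.
  \<^item> It vanishes exactly when \<open>I + K\<close> has a kernel.  A kernel vector of the complexification
    gives one of \<open>I - (e^(-i\<theta>) C + A) / r\<close> (\<open>conj_block_kernel_iff\<close>), and multiplication by
    \<open>e^(i\<theta>/2)\<close> turns the latter into an eigenvector of \<open>R\<close> for \<open>l\<close>.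
  \<^item> On finite rank operators it is an ordinary determinant, which for \<open>R\<^sub>n\<close> equals
    \<open>p\<^sub>n(l) / \<bar>l\<bar>^(2n)\<close> by a diagonal rescaling (\<open>characteristic_polynomial_eq\<close>).

  The trace norm is handled through its dual description: \<open>nuclear_bound K c\<close> bounds
  \<open>\<Sum>i. \<bar>\<langle>K e\<^sub>i, f\<^sub>i\<rangle>\<bar>\<close> by \<open>c\<close> over all finite families obeying Bessel's inequality.  This is visibly
  subadditive and passes to block operators.  Its agreement with the sum of the singular numbers
  rests on the spectral theorem for \<open>K\<^sup>* K\<close>, used in a finite form: for each \<open>\<tau> > 0\<close> there is
  a finite orthonormal set of eigenvectors outside of which \<open>K\<close> has norm at most \<open>\<tau>\<close>.

  For existence and zeros of the determinant, fix a finite rank \<open>F\<close> with \<open>K - F\<close> small in trace norm.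
  With \<open>E\<^sub>m = K\<^sub>m - F\<close> one has \<open>I + K\<^sub>m = (I + F (I + E\<^sub>m)\<^sup>-\<^sup>1) (I + E\<^sub>m)\<close>.  The first factor
  perturbs the identity inside the fixed finite-dimensional range of \<open>F\<close>, so its determinant converges
  entrywise.  The determinants of the second factors form a Cauchy sequence close to \<open>1\<close>,
  because \<open>\<bar>det (I + E) - 1\<bar> \<le> exp (2 \<nu>) - 1\<close> whenever \<open>E\<close> has trace norm at most
  \<open>\<nu> \<le> 1/2\<close>: add the rank one terms of \<open>E\<close> one by one and use \<open>det (I + \<langle>\<cdot>, a\<rangle> b) = 1 + \<langle>b, a\<rangle>\<close>.
  Hence the limit is the determinant of \<open>I + F (I + K - F)\<^sup>-\<^sup>1\<close> times a nonzero number.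
\<close>

section \<open>Complex inner products\<close>

lemma complex_linearD:
  assumes "complex_linear T"
  shows "T (x + y) = T x + T y" "T (c *\<^sub>C x) = c *\<^sub>C T x" "T 0 = 0" "T (- x) = - T x"
    "T (x - y) = T x - T y" "T (r *\<^sub>R x) = r *\<^sub>R T x" "T (sum f I) = (\<Sum>i\<in>I. T (f i))"
proof -
  show add: "T (x + y) = T x + T y" for x y using assms by (simp add: complex_linear_def)
  show sc: "T (c *\<^sub>C x) = c *\<^sub>C T x" for c x using assms by (simp add: complex_linear_def)
  interpret additive T by unfold_locales (rule add)
  show "T 0 = 0" "T (- x) = - T x" "T (x - y) = T x - T y" "T (sum f I) = (\<Sum>i\<in>I. T (f i))"
    by (rule zero minus diff sum)+
  show "T (r *\<^sub>R x) = r *\<^sub>R T x"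
    by (metis sc scaleC_complex_of_real)
qed

lemma cinner_add_right: "cinner x (y + z) = cinner x y + cinner x (z::'a::complex_inner)"
  by (metis cinner_commute cinner_add_left complex_cnj_add)

lemma cinner_scaleC_right: "cinner x (c *\<^sub>C y) = cnj c * cinner x (y::'a::complex_inner)"
  by (metis cinner_commute cinner_scaleC_left complex_cnj_mult)

lemma cinner_scaleR_left: "cinner (r *\<^sub>R x) y = of_real r * cinner x (y::'a::complex_inner)"
  by (metis cinner_scaleC_left scaleC_complex_of_real)

lemma cinner_scaleR_right: "cinner x (r *\<^sub>R y) = of_real r * cinner x (y::'a::complex_inner)"
  by (metis cinner_scaleC_right scaleC_complex_of_real complex_cnj_complex_of_real)

lemma cinner_self: "cinner x x = complex_of_real ((norm (x::'a::complex_inner))\<^sup>2)"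
proof -
  have "Im (cinner x x) = 0"
    using cinner_commute[of x x] by (metis complex_cnj_cancel_iff Reals_cnj_iff complex_is_Real_iff)
  then show ?thesis
    using Re_cinner[of x x] by (simp add: complex_eq_iff power2_norm_eq_inner)
qed

lemma norm_scaleC: "norm (c *\<^sub>C (x::'a::complex_inner)) = cmod c * norm x"
proof -
  have "complex_of_real ((norm (c *\<^sub>C x))\<^sup>2) = (c * cnj c) * cinner x x"
    unfolding cinner_self[symmetric] by (simp add: cinner_scaleC_left cinner_scaleC_right)
  also have "\<dots> = complex_of_real ((cmod c * norm x)\<^sup>2)"
    by (simp add: cinner_self complex_norm_square[symmetric] power_mult_distrib)
  finally have "(norm (c *\<^sub>C x))\<^sup>2 = (cmod c * norm x)\<^sup>2"
    using of_real_eq_iff by blast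
  then show ?thesis by simp
qed

lemma cinner_cauchy_schwarz: "cmod (cinner x y) \<le> norm x * norm (y::'a::complex_inner)"
proof (cases "cinner x y = 0")
  case False
  \<comment> \<open>Rotating \<open>x\<close> by \<open>c\<close> makes the inner product real, so that the real Cauchy--Schwarz inequality applies.\<close>
  define c where "c = cnj (sgn (cinner x y))"
  have c1: "cmod c = 1" using False by (simp add: c_def norm_sgn)
  have "c * cinner x y = of_real (cmod (cinner x y))"
    using False complex_norm_square[of "cinner x y"]
    by (simp add: c_def sgn_eq field_simps power2_eq_square)
  then have "cmod (cinner x y) = Re (cinner (c *\<^sub>C x) y)"
    by (simp add: cinner_scaleC_left)
  also have "\<dots> \<le> norm (c *\<^sub>C x) * norm y"
    unfolding Re_cinner by (rule norm_cauchy_schwarz)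
  finally show ?thesis by (simp add: norm_scaleC c1)
qed simp

lemma bounded_bilinear_cinner: "bounded_bilinear (cinner :: 'a::complex_inner \<Rightarrow> 'a \<Rightarrow> complex)"
  by (rule bounded_bilinear.intro)
     (auto simp: cinner_add_left cinner_add_right cinner_scaleR_left cinner_scaleR_right
        scaleR_conv_of_real intro!: exI[of _ 1] cinner_cauchy_schwarz)

lemma bounded_bilinear_scaleC: "bounded_bilinear (scaleC :: complex \<Rightarrow> 'a::complex_inner \<Rightarrow> 'a)"
  by (rule bounded_bilinear.intro)
     (auto simp: scaleC_add_left scaleC_add_right scaleC_scaleC norm_scaleC scaleR_conv_of_real
        mult.commute simp flip: scaleC_complex_of_real intro!: exI[of _ 1])

lemmas cinner_zero = bounded_bilinear.zero_left[OF bounded_bilinear_cinner]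
  bounded_bilinear.zero_right[OF bounded_bilinear_cinner]
lemmas cinner_diff_left = bounded_bilinear.diff_left[OF bounded_bilinear_cinner]
lemmas cinner_diff_right = bounded_bilinear.diff_right[OF bounded_bilinear_cinner]
lemmas cinner_sum_left = bounded_bilinear.sum_left[OF bounded_bilinear_cinner]
lemmas cinner_sum_right = bounded_bilinear.sum_right[OF bounded_bilinear_cinner]
lemmas tendsto_cinner = bounded_bilinear.tendsto[OF bounded_bilinear_cinner]

lemma cinner_eq_zero_imp_zero: "cinner x (x::'a::complex_inner) = 0 \<Longrightarrow> x = 0"
  by (simp add: cinner_self)

lemma cinner_ext_left: "(\<And>z. cinner x z = cinner y z) \<Longrightarrow> x = (y::'a::complex_inner)"
  using cinner_eq_zero_imp_zero[of "x - y"] by (simp add: cinner_diff_left)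

lemma cinner_ext_right: "(\<And>z. cinner z x = cinner z y) \<Longrightarrow> x = (y::'a::complex_inner)"
  using cinner_eq_zero_imp_zero[of "x - y"] by (simp add: cinner_diff_right)

section \<open>Adjoints\<close>

text \<open>The functional \<open>f\<close> is represented by the minimiser of \<open>(norm x)\<^sup>2 - 2 * f x\<close>.  By the parallelogram
  law every minimising sequence is Cauchy, so completeness provides the minimiser.\<close>

lemma riesz_representation_real:
  fixes f :: "'a::{real_inner, complete_space} \<Rightarrow> real"
  assumes "bounded_linear f"
  shows "\<exists>y. \<forall>x. f x = inner x y"
proof -
  interpret f: bounded_linear f by fact
  obtain b where b: "b \<ge> 0" "\<And>x. \<bar>f x\<bar> \<le> norm x * b"
    using f.nonneg_bounded by auto
  define q where "q x = (norm x)\<^sup>2 - 2 * f x" for x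
  have q_lower: "- b\<^sup>2 \<le> q x" for x
    using b(2)[of x] zero_le_power2[of "norm x - b"]
    by (simp add: q_def power2_eq_square algebra_simps abs_le_iff)
  define m where "m = Inf (range q)"
  have bdd: "bdd_below (range q)" using q_lower by (auto intro!: bdd_belowI[of _ "- b\<^sup>2"])
  have m_le: "m \<le> q x" for x unfolding m_def using bdd by (auto intro: cInf_lower)
  have "\<exists>x. q x < m + 1 / real (Suc n)" for n
    using cInf_lessD[of "range q" "m + 1 / real (Suc n)"] by (auto simp: m_def)
  then obtain X where X: "\<And>n. q (X n) < m + 1 / real (Suc n)" by metis
  have par: "(norm (x - y))\<^sup>2 \<le> 2 * (q x - m) + 2 * (q y - m)" for x y
  proof -
    have sum: "(norm (x + y))\<^sup>2 = (norm x)\<^sup>2 + 2 * inner x y + (norm y)\<^sup>2"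
      and diff: "(norm (x - y))\<^sup>2 = (norm x)\<^sup>2 - 2 * inner x y + (norm y)\<^sup>2"
      unfolding power2_norm_eq_inner
      by (simp_all add: inner_diff_left inner_diff_right inner_add_left inner_add_right inner_commute)
    have "q ((1/2) *\<^sub>R (x + y)) = (norm (x + y))\<^sup>2 / 4 - (f x + f y)"
      by (simp add: q_def f.scaleR f.add power_divide add_divide_distrib flip: scaleR_add_right)
    then have "(norm (x - y))\<^sup>2 = 2 * q x + 2 * q y - 4 * q ((1/2) *\<^sub>R (x + y))"
      using sum diff q_def[of x] q_def[of y] by linarith
    then show ?thesis using m_le[of "(1/2) *\<^sub>R (x + y)"] by simp
  qed
  have dist_X: "(norm (X i - X j))\<^sup>2 \<le> 4 / real (Suc N)" if "i \<ge> N" "j \<ge> N" for i j N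
  proof -
    have "1 / real (Suc k) \<le> 1 / real (Suc N)" if "k \<ge> N" for k
      using that by (simp add: frac_le)
    then have "q (X i) - m \<le> 1 / real (Suc N)" "q (X j) - m \<le> 1 / real (Suc N)"
      using X[of i] X[of j] that by (smt (verit, best))+
    then show ?thesis using par[of "X i" "X j"] by simp
  qed
  have "Cauchy X"
  proof (rule metric_CauchyI)
    fix e :: real assume e: "e > 0"
    obtain N where N: "4 / e\<^sup>2 < real N" using reals_Archimedean2 by blast
    then have "4 / real (Suc N) < e\<^sup>2"
      using e by (simp add: field_simps) (smt (verit) zero_less_power)
    then have "dist (X i) (X j) < e" if "i \<ge> N" "j \<ge> N" for i j
      using dist_X[OF that] e by (simp add: dist_norm power2_less_imp_less)
    then show "\<exists>M. \<forall>m\<ge>M. \<forall>n\<ge>M. dist (X m) (X n) < e" by blast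
  qed
  then obtain y where y: "X \<longlonglongrightarrow> y" using Cauchy_convergent convergent_def by blast
  have "(\<lambda>n. q (X n)) \<longlonglongrightarrow> q y"
    unfolding q_def by (intro tendsto_intros f.tendsto y)
  moreover have "(\<lambda>n. m + 1 / real (Suc n)) \<longlonglongrightarrow> m + 0"
    by (intro tendsto_intros LIMSEQ_Suc[OF lim_1_over_n])
  ultimately have "q y \<le> m"
    using LIMSEQ_le[of "\<lambda>n. q (X n)" "q y" "\<lambda>n. m + 1 / real (Suc n)" m] X
    by (auto intro: less_imp_le)
  then have q_min: "q y \<le> q x" for x using m_le[of x] by simp
  have "f x = inner x y" for x
  proof (cases "x = 0")
    case False
    define d where "d = inner x y - f x"
    \<comment> \<open>This \<open>t\<close> minimises the quadratic polynomial \<open>t \<mapsto> q (y + t *\<^sub>R x)\<close>.\<close>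
    define t where "t = - d / (norm x)\<^sup>2"
    have "(norm (y + t *\<^sub>R x))\<^sup>2 = (norm y)\<^sup>2 + 2 * t * inner x y + t\<^sup>2 * (norm x)\<^sup>2"
      unfolding power2_norm_eq_inner
      by (simp add: inner_add_left inner_add_right inner_commute power2_eq_square)
    then have "q (y + t *\<^sub>R x) = q y + 2 * t * d + t\<^sup>2 * (norm x)\<^sup>2"
      by (simp add: q_def d_def f.scaleR f.add algebra_simps)
    then have "0 \<le> 2 * t * d + t\<^sup>2 * (norm x)\<^sup>2" using q_min[of "y + t *\<^sub>R x"] by simp
    also have "\<dots> = - d\<^sup>2 / (norm x)\<^sup>2"
      using False by (simp add: t_def field_simps power2_eq_square)
    finally have "d\<^sup>2 \<le> 0" using False by (simp add: field_simps)
    then show ?thesis by (simp add: d_def)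
  qed (simp add: f.zero)
  then show ?thesis by blast
qed

lemma bounded_linear_adjoint_exists:
  fixes T :: "'a::{real_inner, complete_space} \<Rightarrow> 'a"
  assumes "bounded_linear T"
  shows "\<exists>D. \<forall>x y. inner (T x) y = inner x (D y)"
proof -
  interpret bounded_linear T by fact
  have "\<exists>z. \<forall>x. inner (T x) y = inner x z" for y
    using riesz_representation_real[of "\<lambda>x. inner (T x) y"]
      bounded_linear_compose[OF bounded_linear_inner_left assms] by simp
  then show ?thesis by metis
qed

text \<open>The adjoint with respect to the real inner product is already the complex adjoint: the
  imaginary part of \<open>cinner x y\<close> is minus the real part of \<open>cinner (\<i> *\<^sub>C x) y\<close>.\<close>

lemma linear_adjoint_cinner:
  fixes T :: "'a::complex_hilbert \<Rightarrow> 'a"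
  assumes T: "bounded_linear T" "complex_linear T"
  shows "cinner (T x) y = cinner x (linear_adjoint T y)"
proof -
  obtain D where D: "\<And>x y. inner (T x) y = inner x (D y)"
    using bounded_linear_adjoint_exists[OF T(1)] by blast
  have D': "cinner (T x) y = cinner x (D y)" for x y
  proof (rule complex_eqI)
    have "Im (cinner (T x) y) = - Re (cinner (T (\<i> *\<^sub>C x)) y)"
      by (simp add: complex_linearD[OF T(2)] cinner_scaleC_left)
    also have "\<dots> = - Re (cinner (\<i> *\<^sub>C x) (D y))" by (simp add: Re_cinner D)
    finally show "Im (cinner (T x) y) = Im (cinner x (D y))" by (simp add: cinner_scaleC_left)
  qed (simp add: Re_cinner D)
  have "linear_adjoint T = D"
    unfolding linear_adjoint_def
  proof (rule the_equality)
    fix D' assume *: "\<forall>x y. cinner (T x) y = cinner x (D' y)"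
    have "cinner x (D' y) = cinner x (D y)" for x y using * D'[of x y] by metis
    then show "D' = D" by (intro ext cinner_ext_right)
  qed (simp add: D')
  then show ?thesis by (simp add: D')
qed

lemma antilinear_adjoint_eqI:
  assumes "\<And>x y. cinner (T x) y = cinner (D y) (x::'a::complex_inner)"
  shows "antilinear_adjoint T = D"
  unfolding antilinear_adjoint_def
proof (rule the_equality)
  fix D' assume *: "\<forall>x y. cinner (T x) y = cinner (D' y) x"
  have "cinner (D' y) x = cinner (D y) x" for x y using * assms[of x y] by metis
  then show "D' = D" by (intro ext cinner_ext_left)
qed (simp add: assms)

lemma complex_linear_linear_adjoint:
  fixes T :: "'a::complex_hilbert \<Rightarrow> 'a"
  assumes T: "bounded_linear T" "complex_linear T"
  shows "complex_linear (linear_adjoint T)"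
  unfolding complex_linear_def
proof (intro conjI allI; rule cinner_ext_right)
  show "cinner z (linear_adjoint T (x + y)) = cinner z (linear_adjoint T x + linear_adjoint T y)"
    for x y z
    by (simp only: cinner_add_right linear_adjoint_cinner[OF T, symmetric])
  show "cinner z (linear_adjoint T (c *\<^sub>C x)) = cinner z (c *\<^sub>C linear_adjoint T x)" for c x z
    by (simp only: cinner_scaleC_right linear_adjoint_cinner[OF T, symmetric])
qed

section \<open>Finite orthonormal sets\<close>

abbreviation cspan :: "'a::complex_inner set \<Rightarrow> 'a set" where
  "cspan \<equiv> complex_vector.span"

definition orthonormal :: "'a::complex_inner set \<Rightarrow> bool" where
  "orthonormal M \<longleftrightarrow> (\<forall>e\<in>M. \<forall>f\<in>M. cinner e f = (if e = f then 1 else 0))"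

text \<open>The orthogonal projection onto the span of \<open>M\<close> if \<open>M\<close> is finite and orthonormal.\<close>

definition proj :: "'a::complex_inner set \<Rightarrow> 'a \<Rightarrow> 'a" where
  "proj M x = (\<Sum>e\<in>M. cinner x e *\<^sub>C e)"

lemma orthonormal_subset: "orthonormal M \<Longrightarrow> N \<subseteq> M \<Longrightarrow> orthonormal N"
  unfolding orthonormal_def by blast

lemma orthonormal_norm: "orthonormal M \<Longrightarrow> e \<in> M \<Longrightarrow> norm e = 1"
  using cinner_self[of e] unfolding orthonormal_def
  by (metis norm_ge_zero of_real_eq_1_iff power2_eq_1_iff power2_eq_iff_nonneg zero_le_one power_one)

lemma cinner_proj:
  assumes "finite M" "orthonormal M" "f \<in> M"
  shows "cinner (proj M x) f = cinner x f"
proof -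
  have "cinner (proj M x) f = (\<Sum>e\<in>M. cinner x e * cinner e f)"
    by (simp add: proj_def cinner_sum_left cinner_scaleC_left)
  also have "\<dots> = (\<Sum>e\<in>M. if e = f then cinner x e else 0)"
    using assms by (intro sum.cong) (auto simp: orthonormal_def)
  finally show ?thesis using assms by simp
qed

lemma cinner_diff_proj: "finite M \<Longrightarrow> orthonormal M \<Longrightarrow> f \<in> M \<Longrightarrow> cinner (x - proj M x) f = 0"
  by (simp add: cinner_diff_left cinner_proj)

lemma proj_in_span: "proj M x \<in> cspan M"
  unfolding proj_def
  by (intro complex_vector.span_sum complex_vector.span_scale complex_vector.span_base)

lemma cinner_span_eq_0:
  assumes "\<And>e. e \<in> M \<Longrightarrow> cinner x e = 0" "y \<in> cspan M"
  shows "cinner x y = 0"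
  using assms(2)
  by (induction rule: complex_vector.span_induct_alt)
     (auto simp: cinner_zero cinner_add_right cinner_scaleC_right assms(1))

lemma span_orthogonal_eq_0:
  assumes "\<And>e. e \<in> M \<Longrightarrow> cinner x e = 0" "x \<in> cspan M"
  shows "x = 0"
  using cinner_span_eq_0[OF assms] by (rule cinner_eq_zero_imp_zero)

lemma proj_eq_self:
  assumes "finite M" "orthonormal M" "x \<in> cspan M"
  shows "proj M x = x"
  using span_orthogonal_eq_0[of M "x - proj M x"] assms
  by (simp add: cinner_diff_proj complex_vector.span_diff proj_in_span)

lemma norm_proj_pythagoras:
  assumes "finite M" "orthonormal M"
  shows "(norm x)\<^sup>2 = (norm (proj M x))\<^sup>2 + (norm (x - proj M x))\<^sup>2"
    and "(norm (proj M x))\<^sup>2 = (\<Sum>e\<in>M. (cmod (cinner x e))\<^sup>2)"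
proof -
  let ?p = "proj M x" and ?d = "x - proj M x"
  have "cinner ?d ?p = 0"
    using cinner_span_eq_0[OF _ proj_in_span] cinner_diff_proj[OF assms] by blast
  then have "inner ?d ?p = 0" by (metis Re_cinner zero_complex.sel(1))
  then have "(norm (?p + ?d))\<^sup>2 = (norm ?p)\<^sup>2 + (norm ?d)\<^sup>2"
    unfolding power2_norm_eq_inner inner_add_left inner_add_right by (simp add: inner_commute)
  then show "(norm x)\<^sup>2 = (norm ?p)\<^sup>2 + (norm ?d)\<^sup>2" by simp
  have "complex_of_real ((norm ?p)\<^sup>2) = cinner ?p ?p"
    by (rule cinner_self[symmetric])
  also have "\<dots> = cinner ?p (\<Sum>e\<in>M. cinner x e *\<^sub>C e)"
    by (simp only: proj_def)
  also have "\<dots> = (\<Sum>e\<in>M. cnj (cinner x e) * cinner x e)"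
    by (simp add: cinner_sum_right cinner_scaleC_right cinner_proj[OF assms])
  also have "\<dots> = complex_of_real (\<Sum>e\<in>M. (cmod (cinner x e))\<^sup>2)"
    by (simp add: complex_norm_square[unfolded of_real_power] mult.commute)
  finally show "(norm ?p)\<^sup>2 = (\<Sum>e\<in>M. (cmod (cinner x e))\<^sup>2)"
    using of_real_eq_iff by blast
qed

lemma norm_proj_le:
  assumes "finite M" "orthonormal M"
  shows "norm (proj M x) \<le> norm x" "norm (x - proj M x) \<le> norm x"
  using norm_proj_pythagoras(1)[OF assms, of x]
  by (simp_all add: power2_le_imp_le)

lemma bessel_inequality:
  assumes "finite M" "orthonormal M"
  shows "(\<Sum>e\<in>M. (cmod (cinner x e))\<^sup>2) \<le> (norm x)\<^sup>2"
  using norm_proj_pythagoras[OF assms, of x] by simp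

lemma orthonormal_independent:
  assumes "orthonormal M"
  shows "complex_vector.independent M"
  unfolding complex_vector.dependent_def
proof safe
  fix e assume e: "e \<in> M" "e \<in> cspan (M - {e})"
  have "cinner e e = 0"
    using assms e by (intro cinner_span_eq_0[of "M - {e}" e e]) (auto simp: orthonormal_def)
  then show False using assms e by (simp add: orthonormal_def)
qed

lemma dim_span_orthonormal: "orthonormal M \<Longrightarrow> complex_vector.dim (cspan M) = card M"
  by (rule complex_vector.dim_span_eq_card_independent[OF orthonormal_independent])

text \<open>One step of Gram--Schmidt.\<close>

lemma orthonormal_insert:
  assumes "finite M" "orthonormal M" "x \<noteq> proj M x"
  defines "e \<equiv> (1 / norm (x - proj M x)) *\<^sub>R (x - proj M x)"
  shows "orthonormal (insert e M)"
proof -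
  have norm: "norm e = 1" using assms(3) by (simp add: e_def)
  have e: "cinner e f = 0" if "f \<in> M" for f
    using that by (simp add: e_def cinner_scaleR_left cinner_diff_proj assms)
  have e': "cinner f e = 0" if "f \<in> M" for f
    using e[OF that] by (metis cinner_commute complex_cnj_zero)
  show ?thesis
    using assms(2) e e' norm by (auto simp: orthonormal_def cinner_self dest: e)
qed

lemma gram_schmidt:
  assumes "finite B"
  shows "\<exists>N. finite N \<and> orthonormal N \<and> cspan N = cspan B"
  using assms
proof (induction B)
  case empty
  show ?case by (intro exI[of _ "{}"]) (simp add: orthonormal_def)
next
  case (insert b B)
  then obtain N where N: "finite N" "orthonormal N" "cspan N = cspan B"
    by blast
  have span: "cspan (insert b B) = cspan (insert b N)"
    by (simp add: complex_vector.span_insert N(3))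
  show ?case
  proof (cases "b = proj N b")
    case True
    then have "b \<in> cspan N" by (metis proj_in_span)
    then show ?thesis using N span by (metis complex_vector.span_redundant)
  next
    case False
    define r where "r = norm (b - proj N b)"
    define e where "e = (1 / r) *\<^sub>R (b - proj N b)"
    have "cspan (insert e N) = cspan (insert b N)"
      unfolding complex_vector.span_eq
    proof (intro conjI)
      have p: "proj N b \<in> cspan (insert x N)" for x
        using proj_in_span[of N b] complex_vector.span_mono[of N "insert x N"] by blast
      have "b = complex_of_real r *\<^sub>C e + proj N b"
        using False by (simp add: e_def r_def scaleC_complex_of_real)
      moreover have "complex_of_real r *\<^sub>C e + proj N b \<in> cspan (insert e N)"
        by (intro complex_vector.span_add complex_vector.span_scale p)
           (simp add: complex_vector.span_base)
      ultimately have "b \<in> cspan (insert e N)" by metis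
      then show "insert b N \<subseteq> cspan (insert e N)"
        by (auto intro: complex_vector.span_base)
      have "e \<in> cspan (insert b N)"
        unfolding e_def scaleC_complex_of_real[symmetric]
        by (intro complex_vector.span_diff complex_vector.span_scale p)
           (simp add: complex_vector.span_base)
      then show "insert e N \<subseteq> cspan (insert b N)"
        by (auto intro: complex_vector.span_base)
    qed
    then show ?thesis
      using N span orthonormal_insert[OF N(1,2) False]
      by (intro exI[of _ "insert e N"]) (auto simp: e_def r_def)
  qed
qed

lemma orthonormal_basis_iff:
  "orthonormal_basis es V \<longleftrightarrow> distinct es \<and> orthonormal (set es) \<and> cspan (set es) = V"
proof
  assume *: "orthonormal_basis es V"
  have "i = j" if "i < length es" "j < length es" "es ! i = es ! j" for i j
    using * that unfolding orthonormal_basis_def by (metis zero_neq_one)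
  then have "distinct es" unfolding distinct_conv_nth by blast
  then show "distinct es \<and> orthonormal (set es) \<and> cspan (set es) = V"
    using * unfolding orthonormal_basis_def orthonormal_def
    by (auto simp: in_set_conv_nth nth_eq_iff_index_eq)
next
  assume "distinct es \<and> orthonormal (set es) \<and> cspan (set es) = V"
  then show "orthonormal_basis es V"
    unfolding orthonormal_basis_def orthonormal_def by (auto simp: nth_eq_iff_index_eq)
qed

lemma orthonormal_list:
  assumes "finite M" "orthonormal M"
  obtains es where "orthonormal_basis es (cspan M)"
  using finite_distinct_list[OF assms(1)] assms(2) by (auto simp: orthonormal_basis_iff)

lemma ex_orthonormal_basis:
  assumes "finite B"
  shows "\<exists>es. orthonormal_basis es (cspan B)"
proof -
  obtain M where "finite M" "orthonormal M" "cspan M = cspan B"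
    using gram_schmidt[OF assms] by blast
  then show ?thesis by (metis orthonormal_list)
qed

lemma orthonormal_basis_expand:
  assumes "orthonormal_basis es V" "x \<in> V"
  shows "x = (\<Sum>k<length es. cinner x (es ! k) *\<^sub>C (es ! k))"
proof -
  have *: "distinct es" "orthonormal (set es)" "x \<in> cspan (set es)"
    using assms by (auto simp: orthonormal_basis_iff)
  have "x = proj (set es) x" using proj_eq_self[of "set es" x] * by simp
  also have "\<dots> = (\<Sum>e\<leftarrow>es. cinner x e *\<^sub>C e)"
    unfolding proj_def using *(1) by (simp add: sum_list_distinct_conv_sum_set)
  also have "\<dots> = (\<Sum>k<length es. cinner x (es ! k) *\<^sub>C (es ! k))"
    by (simp add: sum_list_sum_nth atLeast0LessThan)
  finally show ?thesis .
qed

section \<open>The nuclear bound\<close>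

text \<open>Bessel families take the place of orthonormal families as test families for the trace norm:
  unlike orthonormality, Bessel's inequality survives passing to the components of pairs.\<close>

definition bessel :: "'i set \<Rightarrow> ('i \<Rightarrow> 'a::complex_inner) \<Rightarrow> bool" where
  "bessel I e \<longleftrightarrow> (\<forall>x. (\<Sum>i\<in>I. (cmod (cinner x (e i)))\<^sup>2) \<le> (norm x)\<^sup>2)"

text \<open>The dual description of the estimate \<open>trace norm \<le> c\<close>; for compact complex linear operators on a
  Hilbert space the two are shown to agree below.  The indices are natural numbers only because
  a definition cannot quantify over index types; see \<open>nuclear_bound_finite\<close>.\<close>

definition nuclear_bound :: "('a::complex_inner \<Rightarrow> 'a) \<Rightarrow> real \<Rightarrow> bool" where
  "nuclear_bound K c \<longleftrightarrow> (\<forall>n e f. bessel {..<n::nat} e \<longrightarrow> bessel {..<n} f \<longrightarrow>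
     (\<Sum>i<n. cmod (cinner (K (e i)) (f i))) \<le> c)"

lemma bessel_orthonormal:
  assumes "finite I" "inj_on e I" "orthonormal (e ` I)"
  shows "bessel I e"
  using bessel_inequality[of "e ` I"] assms by (simp add: bessel_def sum.reindex)

lemma bessel_norm_le:
  assumes "bessel I e" "finite I" "i \<in> I"
  shows "norm (e i) \<le> 1"
proof -
  have "(cmod (cinner (e i) (e i)))\<^sup>2 \<le> (\<Sum>j\<in>I. (cmod (cinner (e i) (e j)))\<^sup>2)"
    using assms by (intro member_le_sum) auto
  also have "\<dots> \<le> (norm (e i))\<^sup>2" using assms(1) by (auto simp: bessel_def)
  finally have "((norm (e i))\<^sup>2)\<^sup>2 \<le> (norm (e i))\<^sup>2" by (simp add: cinner_self norm_power)
  then have "(norm (e i))\<^sup>2 * ((norm (e i))\<^sup>2 - 1) \<le> 0"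
    by (simp add: power2_eq_square algebra_simps)
  then have "norm (e i) = 0 \<or> (norm (e i))\<^sup>2 \<le> 1"
    by (auto simp: mult_le_0_iff)
  then show ?thesis by (auto simp: power_le_one_iff)
qed

lemma nuclear_bound_finite:
  assumes K: "nuclear_bound K c" and "finite I" "bessel I e" "bessel I f"
  shows "(\<Sum>i\<in>I. cmod (cinner (K (e i)) (f i))) \<le> c"
proof -
  obtain h where h: "bij_betw h {..<card I} I"
    using ex_bij_betw_nat_finite[OF \<open>finite I\<close>] by (auto simp: atLeast0LessThan)
  have re: "(\<Sum>i\<in>I. g i) = (\<Sum>i<card I. g (h i))" for g :: "_ \<Rightarrow> real"
    by (rule sum.reindex_bij_betw[OF h, symmetric])
  have "bessel {..<card I} (\<lambda>i. e (h i))" "bessel {..<card I} (\<lambda>i. f (h i))"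
    using assms by (simp_all add: bessel_def re)
  then show ?thesis using K unfolding nuclear_bound_def re by blast
qed

lemma nuclear_bound_nonneg: "nuclear_bound K c \<Longrightarrow> 0 \<le> c"
  using nuclear_bound_finite[of K c "{}::nat set" undefined undefined] by (simp add: bessel_def)

lemma nuclear_bound_mono: "nuclear_bound K c \<Longrightarrow> c \<le> d \<Longrightarrow> nuclear_bound K d"
  unfolding nuclear_bound_def by (meson order_trans)

lemma nuclear_bound_add:
  assumes "nuclear_bound K c" "nuclear_bound L d"
  shows "nuclear_bound (\<lambda>x. K x + L x) (c + d)"
  unfolding nuclear_bound_def
proof (intro allI impI)
  fix n and e f :: "nat \<Rightarrow> 'a" assume *: "bessel {..<n} e" "bessel {..<n} f"
  have "(\<Sum>i<n. cmod (cinner (K (e i) + L (e i)) (f i)))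
      \<le> (\<Sum>i<n. cmod (cinner (K (e i)) (f i)) + cmod (cinner (L (e i)) (f i)))"
    by (intro sum_mono) (simp add: cinner_add_left norm_triangle_ineq)
  also have "\<dots> \<le> c + d"
    using assms * unfolding nuclear_bound_def sum.distrib by (blast intro: add_mono)
  finally show "(\<Sum>i<n. cmod (cinner (K (e i) + L (e i)) (f i))) \<le> c + d" .
qed

lemma nuclear_bound_scaleC:
  assumes "nuclear_bound K c"
  shows "nuclear_bound (\<lambda>x. a *\<^sub>C K x) (cmod a * c)"
  using assms unfolding nuclear_bound_def
  by (auto simp: cinner_scaleC_left norm_mult simp flip: sum_distrib_left intro!: mult_left_mono)

lemma nuclear_bound_diff:
  assumes "nuclear_bound K c" "nuclear_bound L d"
  shows "nuclear_bound (\<lambda>x. K x - L x) (c + d)"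
  using nuclear_bound_add[OF assms(1) nuclear_bound_scaleC[OF assms(2), of "-1"]]
  by (simp add: complex_vector.scale_minus_left scaleC_one)

lemma nuclear_bound_norm:
  assumes "nuclear_bound K c" "complex_linear K"
  shows "norm (K x) \<le> c * norm x"
proof (cases "K x = 0")
  case False
  then have "x \<noteq> 0" using assms(2) complex_linearD(3) by blast
  define e f where "e = (1 / norm x) *\<^sub>R x" and "f = (1 / norm (K x)) *\<^sub>R K x"
  have "cinner e e = 1" "cinner f f = 1"
    using False \<open>x \<noteq> 0\<close> by (simp_all add: cinner_self e_def f_def)
  then have "bessel {0::nat} (\<lambda>_. e)" "bessel {0::nat} (\<lambda>_. f)"
    by (auto intro!: bessel_orthonormal simp: orthonormal_def)
  then have "cmod (cinner (K e) f) \<le> c"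
    using nuclear_bound_finite[OF assms(1), of "{0::nat}" "\<lambda>_. e" "\<lambda>_. f"] by simp
  also have "cinner (K e) f = of_real (norm (K x) / norm x)"
    using False \<open>x \<noteq> 0\<close>
    by (simp add: e_def f_def complex_linearD[OF assms(2)] cinner_scaleR_left cinner_scaleR_right
        cinner_self power2_eq_square)
  finally show ?thesis using \<open>x \<noteq> 0\<close> by (simp add: field_simps norm_divide)
qed (use nuclear_bound_nonneg[OF assms(1)] in simp)

text \<open>For a single term, the sum over a Bessel family is at most \<open>norm e * norm (g e)\<close> by the
  Cauchy--Schwarz inequality in the index of the family.\<close>

lemma nuclear_bound_finite_sum:
  assumes K: "\<And>x. K x = (\<Sum>e\<in>M. cinner x e *\<^sub>C g e)" and M: "\<And>e. e \<in> M \<Longrightarrow> norm e \<le> 1"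
  shows "nuclear_bound K (\<Sum>e\<in>M. norm (g e))"
  unfolding nuclear_bound_def
proof (intro allI impI)
  fix n and x y :: "nat \<Rightarrow> 'a" assume *: "bessel {..<n} x" "bessel {..<n} y"
  have L2: "L2_set (\<lambda>i. cmod (cinner v (z i))) {..<n} \<le> norm v" if "bessel {..<n} z" for v z
    using that by (auto simp: L2_set_def bessel_def intro: real_le_lsqrt sum_nonneg)
  have "(\<Sum>i<n. cmod (cinner (K (x i)) (y i)))
      \<le> (\<Sum>i<n. \<Sum>e\<in>M. cmod (cinner e (x i)) * cmod (cinner (g e) (y i)))"
  proof (intro sum_mono)
    fix i
    have "cmod (cinner (K (x i)) (y i)) \<le> (\<Sum>e\<in>M. cmod (cinner (x i) e * cinner (g e) (y i)))"
      unfolding K cinner_sum_left cinner_scaleC_left by (rule norm_sum)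
    also have "\<dots> = (\<Sum>e\<in>M. cmod (cinner e (x i)) * cmod (cinner (g e) (y i)))"
      by (metis (no_types, lifting) cinner_commute complex_mod_cnj norm_mult)
    finally show "cmod (cinner (K (x i)) (y i))
      \<le> (\<Sum>e\<in>M. cmod (cinner e (x i)) * cmod (cinner (g e) (y i)))" .
  qed
  also have "\<dots> = (\<Sum>e\<in>M. \<Sum>i<n. cmod (cinner e (x i)) * cmod (cinner (g e) (y i)))"
    by (rule sum.swap)
  also have "\<dots> \<le> (\<Sum>e\<in>M. norm (g e))"
  proof (rule sum_mono)
    fix e assume e: "e \<in> M"
    have "(\<Sum>i<n. cmod (cinner e (x i)) * cmod (cinner (g e) (y i)))
        \<le> L2_set (\<lambda>i. cmod (cinner e (x i))) {..<n} * L2_set (\<lambda>i. cmod (cinner (g e) (y i))) {..<n}"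
      using L2_set_mult_ineq[of "\<lambda>i. cmod (cinner e (x i))" "\<lambda>i. cmod (cinner (g e) (y i))"] by simp
    also have "\<dots> \<le> 1 * norm (g e)"
      using L2[OF *(1), of e] L2[OF *(2), of "g e"] M[OF e] by (intro mult_mono) auto
    finally show "(\<Sum>i<n. cmod (cinner e (x i)) * cmod (cinner (g e) (y i))) \<le> norm (g e)" by simp
  qed
  finally show "(\<Sum>i<n. cmod (cinner (K (x i)) (y i))) \<le> (\<Sum>e\<in>M. norm (g e))" .
qed

text \<open>Members of Bessel families have norm at most \<open>1\<close>, so replacing \<open>K\<close> by \<open>L\<close> changes a sum
  of \<open>n\<close> terms by at most \<open>n * \<epsilon>\<close>.\<close>

lemma nuclear_bound_limit:
  assumes "\<And>\<epsilon>. \<epsilon> > 0 \<Longrightarrow> \<exists>L. nuclear_bound L c \<and> (\<forall>x. norm (K x - L x) \<le> \<epsilon> * norm x)"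
  shows "nuclear_bound K c"
  unfolding nuclear_bound_def
proof (intro allI impI)
  fix n and x y :: "nat \<Rightarrow> 'a" assume *: "bessel {..<n} x" "bessel {..<n} y"
  show "(\<Sum>i<n. cmod (cinner (K (x i)) (y i))) \<le> c"
  proof (rule field_le_epsilon)
    fix d :: real assume "d > 0"
    define \<epsilon> where "\<epsilon> = d / Suc n"
    have "\<epsilon> > 0" "n * \<epsilon> \<le> d" using \<open>d > 0\<close> by (auto simp: \<epsilon>_def field_simps)
    then obtain L where L: "nuclear_bound L c" "\<And>x. norm (K x - L x) \<le> \<epsilon> * norm x"
      using assms by blast
    have "(\<Sum>i<n. cmod (cinner (K (x i)) (y i)))
        \<le> (\<Sum>i<n. cmod (cinner (L (x i)) (y i)) + \<epsilon>)"
    proof (rule sum_mono)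
      fix i assume i: "i \<in> {..<n}"
      have "cmod (cinner (K (x i) - L (x i)) (y i)) \<le> norm (K (x i) - L (x i)) * norm (y i)"
        by (rule cinner_cauchy_schwarz)
      also have "\<dots> \<le> (\<epsilon> * 1) * 1"
        using L(2)[of "x i"] bessel_norm_le[OF *(1) _ i] bessel_norm_le[OF *(2) _ i] \<open>\<epsilon> > 0\<close>
        by (intro mult_mono order_trans[OF L(2)]) auto
      finally show "cmod (cinner (K (x i)) (y i)) \<le> cmod (cinner (L (x i)) (y i)) + \<epsilon>"
        using norm_triangle_sub[of "cinner (K (x i)) (y i)" "cinner (L (x i)) (y i)"]
        by (simp add: cinner_diff_left)
    qed
    also have "\<dots> \<le> c + d"
      using L(1) * \<open>n * \<epsilon> \<le> d\<close> unfolding nuclear_bound_def sum.distrib by (fastforce intro: add_mono)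
    finally show "(\<Sum>i<n. cmod (cinner (K (x i)) (y i))) \<le> c + d" .
  qed
qed

section \<open>Singular numbers of a compact operator\<close>

text \<open>Orthonormal eigenvectors of \<open>T\<^sup>* T\<close> whose singular numbers are at least \<open>\<tau>\<close>.  For a unit
  eigenvector \<open>e\<close> the eigenvalue is necessarily \<open>(norm (T e))\<^sup>2\<close>.\<close>

definition singular_family :: "('a::complex_hilbert \<Rightarrow> 'a) \<Rightarrow> real \<Rightarrow> 'a set \<Rightarrow> bool" where
  "singular_family T \<tau> M \<longleftrightarrow> finite M \<and> orthonormal M \<and>
     (\<forall>e\<in>M. \<tau> \<le> norm (T e) \<and>
       linear_adjoint T (T e) = complex_of_real ((norm (T e))\<^sup>2) *\<^sub>C e)"

definition maximal_singular_family :: "('a::complex_hilbert \<Rightarrow> 'a) \<Rightarrow> real \<Rightarrow> 'a set \<Rightarrow> bool" where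
  "maximal_singular_family T \<tau> M \<longleftrightarrow> singular_family T \<tau> M \<and>
     (\<forall>e. singular_family T \<tau> (insert e M) \<longrightarrow> e \<in> M)"

lemma bounded_linear_compact_operator:
  assumes T: "complex_linear T" "compact_operator T"
  shows "bounded_linear T"
proof -
  have "bounded (T ` cball 0 1)"
    using T(2) by (meson compact_operator_def compact_imp_bounded bounded_subset closure_subset)
  then obtain b where "\<forall>y\<in>T ` cball 0 1. norm y \<le> b"
    unfolding bounded_iff by blast
  then have b: "norm (T x) \<le> b" if "norm x \<le> 1" for x using that by simp
  have "norm (T x) \<le> norm x * b" for x
  proof (cases "x = 0")
    case False
    have "norm (T ((1 / norm x) *\<^sub>R x)) \<le> b" using False by (intro b) simp
    then show ?thesis using False by (simp add: complex_linearD[OF T(1)] field_simps)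
  qed (simp add: complex_linearD[OF T(1)])
  then show ?thesis
    by (intro bounded_linear_intro[of T b]) (simp_all add: complex_linearD[OF T(1)])
qed

locale compact_linear =
  fixes T :: "'a::complex_hilbert \<Rightarrow> 'a"
  assumes linear: "complex_linear T" and compact: "compact_operator T"
begin

abbreviation "adj \<equiv> linear_adjoint T"

abbreviation "s \<equiv> linear_singular_number T"

lemma bounded: "bounded_linear T"
  using linear compact by (rule bounded_linear_compact_operator)

lemmas adjoint = linear_adjoint_cinner[OF bounded linear]

lemmas adj_linear = complex_linear_linear_adjoint[OF bounded linear]

lemma adjoint': "cinner (adj x) y = cinner x (T y)"
  by (metis adjoint cinner_commute)

lemma bounded_linear_adj: "bounded_linear adj"
proof -
  obtain b where b: "b \<ge> 0" "\<And>x. norm (T x) \<le> norm x * b"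
    using bounded_linear.nonneg_bounded[OF bounded] by auto
  have "norm (adj y) \<le> norm y * b" for y
  proof (cases "adj y = 0")
    case False
    have "(norm (adj y))\<^sup>2 = cmod (cinner (T (adj y)) y)"
      by (simp add: adjoint cinner_self norm_power)
    also have "\<dots> \<le> norm (T (adj y)) * norm y" by (rule cinner_cauchy_schwarz)
    also have "\<dots> \<le> (norm (adj y) * b) * norm y" by (intro mult_right_mono b) simp
    finally show ?thesis using False by (simp add: power2_eq_square field_simps)
  qed (simp add: b)
  then show ?thesis
    by (intro bounded_linear_intro[of adj b]) (simp_all add: complex_linearD[OF adj_linear])
qed

lemma singular_eigenvalue:
  assumes "adj (T x) = complex_of_real u *\<^sub>C x"
  shows "(norm (T x))\<^sup>2 = u * (norm x)\<^sup>2"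
proof -
  have "complex_of_real ((norm (T x))\<^sup>2) = complex_of_real (u * (norm x)\<^sup>2)"
    using adjoint[of x "T x"] assms by (simp add: cinner_scaleC_right cinner_self)
  then show ?thesis using of_real_eq_iff by blast
qed

lemma eigenvectors_orthogonal:
  assumes "adj (T x) = complex_of_real u *\<^sub>C x" "adj (T y) = complex_of_real v *\<^sub>C y" "u \<noteq> v"
  shows "cinner x y = 0"
proof -
  have "cinner (adj (T x)) y = cinner x (adj (T y))" by (simp add: adjoint' adjoint)
  then show ?thesis using assms by (simp add: cinner_scaleC_left cinner_scaleC_right)
qed

lemma singular_familyD:
  assumes "singular_family T \<tau> M"
  shows "finite M" "orthonormal M" "e \<in> M \<Longrightarrow> \<tau> \<le> norm (T e)"
    "e \<in> M \<Longrightarrow> adj (T e) = complex_of_real ((norm (T e))\<^sup>2) *\<^sub>C e"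
  using assms by (auto simp: singular_family_def)

lemma singular_images_orthogonal:
  assumes "singular_family T \<tau> M" "e \<in> M" "f \<in> M" "e \<noteq> f"
  shows "cinner (T e) (T f) = 0"
  using singular_familyD[OF assms(1)] assms(2-) adjoint[of e "T f"]
  by (simp add: cinner_scaleC_right orthonormal_def)

text \<open>The images under \<open>T\<close> of the members of a singular family are at mutual distance at least
  \<open>\<tau>\<close>, while a compact set contains only boundedly many such points.\<close>

lemma singular_family_card_bounded:
  assumes "\<tau> > 0"
  shows "\<exists>n. \<forall>M. singular_family T \<tau> M \<longrightarrow> card M \<le> n"
proof -
  obtain k where k: "finite k" "closure (T ` cball 0 1) \<subseteq> (\<Union>x\<in>k. ball x (\<tau> / 2))"
    using compact assms unfolding compact_operator_def compact_eq_totally_bounded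
    by (meson half_gt_zero)
  have "card M \<le> card k" if M: "singular_family T \<tau> M" for M
  proof -
    have "\<exists>x\<in>k. T e \<in> ball x (\<tau> / 2)" if "e \<in> M" for e
    proof -
      have "T e \<in> closure (T ` cball 0 1)"
        using orthonormal_norm[OF singular_familyD(2)[OF M] that]
        by (intro subsetD[OF closure_subset]) auto
      then show ?thesis using k(2) by blast
    qed
    then obtain c where c: "\<And>e. e \<in> M \<Longrightarrow> c e \<in> k \<and> T e \<in> ball (c e) (\<tau> / 2)" by metis
    have "inj_on c M"
    proof (rule inj_onI, rule ccontr)
      fix e f assume ef: "e \<in> M" "f \<in> M" "c e = c f" "e \<noteq> f"
      have "inner (T e) (T f) = 0"
        using singular_images_orthogonal[OF M ef(1,2,4)] by (simp flip: Re_cinner)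
      then have "(norm (T e - T f))\<^sup>2 = (norm (T e))\<^sup>2 + (norm (T f))\<^sup>2"
        unfolding power2_norm_eq_inner inner_diff_left inner_diff_right by (simp add: inner_commute)
      moreover have "\<tau>\<^sup>2 \<le> (norm (T e))\<^sup>2"
        using singular_familyD(3)[OF M ef(1)] assms by (intro power_mono) auto
      ultimately have "\<tau>\<^sup>2 \<le> (norm (T e - T f))\<^sup>2"
        by (smt (verit) zero_le_power2)
      then have "\<tau> \<le> dist (T e) (T f)" unfolding dist_norm by (rule power2_le_imp_le) simp
      moreover have "dist (c e) (T e) < \<tau> / 2" "dist (c e) (T f) < \<tau> / 2"
        using c[OF ef(1)] c[OF ef(2)] unfolding ef(3) by simp_all
      then have "dist (T e) (T f) < \<tau>" by (rule dist_triangle_half_r)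
      ultimately show False by simp
    qed
    then show ?thesis using c k(1) by (intro card_inj_on_le[of c]) auto
  qed
  then show ?thesis by blast
qed

lemma maximal_singular_family_exists:
  assumes "\<tau> > 0" "singular_family T \<tau> M"
  obtains N where "maximal_singular_family T \<tau> N" "M \<subseteq> N"
proof -
  let ?P = "\<lambda>N. M \<subseteq> N \<and> singular_family T \<tau> N"
  obtain n where n: "\<And>M. singular_family T \<tau> M \<Longrightarrow> card M \<le> n"
    using singular_family_card_bounded[OF assms(1)] by blast
  have "\<exists>N. ?P N \<and> (\<forall>N'. ?P N' \<longrightarrow> card N' \<le> card N)"
    using assms(2) by (intro ex_has_greatest_nat[of ?P M card "Suc n"]) (auto simp: less_Suc_eq_le n)
  then obtain N where N: "?P N" "\<And>N'. ?P N' \<Longrightarrow> card N' \<le> card N" by blast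
  have "e \<in> N" if "singular_family T \<tau> (insert e N)" for e
    using N(2)[of "insert e N"] N(1) that singular_familyD(1)[of \<tau> N] card_insert_disjoint[of N e]
    by (cases "e \<in> N") auto
  then show ?thesis using N(1) that unfolding maximal_singular_family_def by blast
qed

lemma maximal_singular_family_ex:
  assumes "\<tau> > 0"
  obtains N where "maximal_singular_family T \<tau> N"
  using maximal_singular_family_exists[OF assms, of "{}"]
  by (auto simp: singular_family_def orthonormal_def)

lemma maximal_singular_familyD:
  assumes "maximal_singular_family T \<tau> M"
  shows "singular_family T \<tau> M" "finite M" "orthonormal M" "e \<in> M \<Longrightarrow> \<tau> \<le> norm (T e)"
    "e \<in> M \<Longrightarrow> adj (T e) = complex_of_real ((norm (T e))\<^sup>2) *\<^sub>C e"
  using assms singular_familyD unfolding maximal_singular_family_def by blast+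

text \<open>Otherwise \<open>y\<close>, normalised, could be added to the family.\<close>

lemma maximal_singular_family_orthogonal:
  assumes M: "maximal_singular_family T \<tau> M" and \<tau>: "\<tau> > 0"
    and y: "adj (T y) = complex_of_real u *\<^sub>C y" "\<tau>\<^sup>2 \<le> u" "\<And>e. e \<in> M \<Longrightarrow> cinner y e = 0"
  shows "y = 0"
proof (rule ccontr)
  assume "y \<noteq> 0"
  define e where "e = (1 / norm y) *\<^sub>R y"
  have norm: "norm e = 1" using \<open>y \<noteq> 0\<close> by (simp add: e_def)
  have Pe: "adj (T e) = complex_of_real u *\<^sub>C e"
    using y(1) by (simp add: e_def complex_linearD[OF linear] complex_linearD[OF adj_linear]
        scaleC_scaleC mult.commute flip: scaleC_complex_of_real)
  have u: "(norm (T e))\<^sup>2 = u" using singular_eigenvalue[OF Pe] norm by simp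
  then have "\<tau> \<le> norm (T e)" using y(2) by (simp add: power2_le_imp_le)
  have orth: "cinner e f = 0" "cinner f e = 0" if "f \<in> M" for f
    using y(3)[OF that] cinner_commute[of f e] by (simp_all add: e_def cinner_scaleR_left)
  have "e \<notin> M" using orth(1)[of e] norm by (auto simp: cinner_self)
  have "orthonormal (insert e M)"
    using maximal_singular_familyD(3)[OF M] orth norm \<open>e \<notin> M\<close>
    by (auto simp: orthonormal_def cinner_self)
  then have "singular_family T \<tau> (insert e M)"
    using maximal_singular_familyD[OF M] Pe u \<open>\<tau> \<le> norm (T e)\<close> unfolding singular_family_def by auto
  then show False using M \<open>e \<notin> M\<close> by (auto simp: maximal_singular_family_def)
qed

text \<open>The difference between \<open>x\<close> and its projection is again an eigenvector for \<open>u\<close>, now orthogonal to the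
  whole family: eigenvectors for different eigenvalues of \<open>T\<^sup>* T\<close> are orthogonal anyway.\<close>

lemma eigenspace_subset_span:
  assumes M: "maximal_singular_family T \<tau> M" and \<tau>: "\<tau> > 0" and u: "\<tau>\<^sup>2 \<le> u"
    and x: "adj (T x) = complex_of_real u *\<^sub>C x"
  shows "x \<in> cspan {e\<in>M. (norm (T e))\<^sup>2 = u}" (is "x \<in> cspan ?N")
proof -
  note MD = maximal_singular_familyD[OF M]
  have N: "finite ?N" "orthonormal ?N" using MD by (auto intro: orthonormal_subset)
  define y where "y = x - proj ?N x"
  have "adj (T (proj ?N x)) = (\<Sum>e\<in>?N. cinner x e *\<^sub>C adj (T e))"
    by (simp add: proj_def complex_linearD[OF linear] complex_linearD[OF adj_linear])
  also have "\<dots> = (\<Sum>e\<in>?N. complex_of_real u *\<^sub>C (cinner x e *\<^sub>C e))"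
    using MD(5) by (intro sum.cong) (auto simp: scaleC_scaleC mult.commute)
  finally have "adj (T (proj ?N x)) = complex_of_real u *\<^sub>C proj ?N x"
    by (simp add: proj_def complex_vector.scale_sum_right)
  then have y: "adj (T y) = complex_of_real u *\<^sub>C y"
    using x by (simp add: y_def complex_linearD[OF linear] complex_linearD[OF adj_linear]
        complex_vector.scale_right_diff_distrib)
  have "cinner y e = 0" if "e \<in> M" for e
  proof (cases "(norm (T e))\<^sup>2 = u")
    case True
    then show ?thesis using that N by (simp add: y_def cinner_diff_proj)
  next
    case False
    then show ?thesis using eigenvectors_orthogonal[OF y MD(5)[OF that]] by auto
  qed
  then have "y = 0" using maximal_singular_family_orthogonal[OF M \<tau> y u] by blast
  then show ?thesis using proj_in_span[of ?N x] by (simp add: y_def)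
qed

lemma eigenspace_eq_span:
  assumes M: "maximal_singular_family T \<tau> M" and \<tau>: "\<tau> > 0" and u: "\<tau>\<^sup>2 \<le> u"
  shows "{x. adj (T x) = complex_of_real u *\<^sub>C x} = cspan {e\<in>M. (norm (T e))\<^sup>2 = u}"
proof (intro subset_antisym subsetI CollectI)
  fix x assume "x \<in> cspan {e\<in>M. (norm (T e))\<^sup>2 = u}"
  then show "adj (T x) = complex_of_real u *\<^sub>C x"
  proof (induction rule: complex_vector.span_induct_alt)
    case (step c e y)
    then have "adj (T e) = complex_of_real u *\<^sub>C e"
      using maximal_singular_familyD(5)[OF M, of e] by auto
    then show ?case using step(2)
      by (simp add: complex_linearD[OF linear] complex_linearD[OF adj_linear] scaleC_add_right
          scaleC_scaleC mult.commute)
  qed (simp add: complex_linearD[OF linear] complex_linearD[OF adj_linear])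
qed (use eigenspace_subset_span[OF assms] in auto)

text \<open>By maximality the members with a given eigenvalue form an orthonormal basis of its eigenspace, so
  multiplicities can be counted in the family.\<close>

lemma eigenvalue_count_singular_family:
  assumes M: "maximal_singular_family T \<tau> M" and \<tau>: "\<tau> > 0" and u: "\<tau>\<^sup>2 \<le> u"
  shows "eigenvalue_count (adj \<circ> T) u = card {e\<in>M. u \<le> (norm (T e))\<^sup>2}"
proof -
  note MD = maximal_singular_familyD[OF M]
  let ?g = "\<lambda>e. (norm (T e))\<^sup>2" and ?S = "{e\<in>M. u \<le> (norm (T e))\<^sup>2}"
  have eq: "{v. u \<le> v \<and> is_eigenvalue (adj \<circ> T) (complex_of_real v)} = ?g ` ?S"
  proof (intro subset_antisym subsetI)
    fix v assume "v \<in> {v. u \<le> v \<and> is_eigenvalue (adj \<circ> T) (complex_of_real v)}"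
    then obtain x where x: "u \<le> v" "x \<noteq> 0" "adj (T x) = complex_of_real v *\<^sub>C x"
      by (auto simp: is_eigenvalue_def)
    then have "x \<in> cspan {e\<in>M. ?g e = v}"
      using eigenspace_subset_span[OF M \<tau>, of v x] u by simp
    then have "{e\<in>M. ?g e = v} \<noteq> {}" using x(2) by (metis complex_vector.span_empty singletonD)
    then show "v \<in> ?g ` ?S" using x(1) by auto
  next
    fix v assume "v \<in> ?g ` ?S"
    then obtain e where e: "e \<in> M" "u \<le> ?g e" "v = ?g e" by auto
    then have "e \<noteq> 0" using orthonormal_norm[OF MD(3) e(1)] by auto
    then show "v \<in> {v. u \<le> v \<and> is_eigenvalue (adj \<circ> T) (complex_of_real v)}"
      using e MD(5)[OF e(1)] by (auto simp: is_eigenvalue_def)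
  qed
  have dim: "complex_vector.dim {x. (adj \<circ> T) x = complex_of_real v *\<^sub>C x} = card {e\<in>?S. ?g e = v}"
    if "v \<in> ?g ` ?S" for v
  proof -
    have v: "u \<le> v" using that by auto
    then have "{e\<in>?S. ?g e = v} = {e\<in>M. ?g e = v}" by auto
    moreover have "orthonormal {e\<in>M. ?g e = v}" using MD(3) by (auto intro: orthonormal_subset)
    moreover have "{x. (adj \<circ> T) x = complex_of_real v *\<^sub>C x} = cspan {e\<in>M. ?g e = v}"
      using eigenspace_eq_span[OF M \<tau>, of v] v u by simp
    ultimately show ?thesis by (simp only: dim_span_orthonormal)
  qed
  have "eigenvalue_count (adj \<circ> T) u = (\<Sum>v\<in>?g ` ?S. card {e\<in>?S. ?g e = v})"
    unfolding eigenvalue_count_def eq using dim by (intro sum.cong) auto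
  also have "\<dots> = card ?S"
    using sum.image_gen[of ?S "\<lambda>_. 1::nat" ?g] MD(2) by simp
  finally show ?thesis .
qed

text \<open>In a list with decreasing norms, more than \<open>j\<close> eigenvalues are at least \<open>u\<close> if and only if
  \<open>u \<le> (norm (T (es ! j)))\<^sup>2\<close>; this identifies the supremum that defines the \<open>j\<close>-th eigenvalue.\<close>

lemma singular_number_nth:
  assumes M: "maximal_singular_family T \<tau> M" and \<tau>: "\<tau> > 0"
    and es: "set es = M" "distinct es" "sorted_wrt (\<lambda>e f. norm (T e) \<ge> norm (T f)) es"
    and j: "j < length es"
  shows "s j = norm (T (es ! j))"
proof -
  note MD = maximal_singular_familyD[OF M]
  let ?P = "adj \<circ> T" and ?g = "\<lambda>e. (norm (T e))\<^sup>2"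
  have esj: "es ! j \<in> M" using es j by auto
  have g: "\<tau>\<^sup>2 \<le> ?g (es ! j)" using MD(4)[OF esj] \<tau> by (intro power_mono) auto
  have le: "norm (T (es ! k)) \<le> norm (T (es ! i))" if "i \<le> k" "k < length es" for i k
    using that es(3) by (cases "i = k") (auto simp: sorted_wrt_iff_nth_less)
  have "ordered_eigenvalue ?P j = ?g (es ! j)"
    unfolding ordered_eigenvalue_def
  proof (rule cSup_eq_maximum)
    have "es ! j \<noteq> 0" using orthonormal_norm[OF MD(3) esj] by auto
    then have "is_eigenvalue ?P (complex_of_real (?g (es ! j)))"
      using MD(5)[OF esj] by (auto simp: is_eigenvalue_def)
    moreover have "j < eigenvalue_count ?P (?g (es ! j))"
    proof -
      have "(!) es ` {..j} \<subseteq> {e\<in>M. ?g (es ! j) \<le> ?g e}"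
        using es(1) j by (auto intro!: power_mono le)
      then have "card ((!) es ` {..j}) \<le> card {e\<in>M. ?g (es ! j) \<le> ?g e}"
        using MD(2) by (intro card_mono) auto
      moreover have "inj_on ((!) es) {..j}" using es(2) j by (auto simp: inj_on_def nth_eq_iff_index_eq)
      ultimately show ?thesis
        by (simp add: eigenvalue_count_singular_family[OF M \<tau> g] card_image)
    qed
    moreover have "0 < ?g (es ! j)" using g \<tau> by (smt (verit) zero_less_power)
    ultimately show "?g (es ! j)
        \<in> insert 0 {u. 0 < u \<and> is_eigenvalue ?P (complex_of_real u) \<and> j < eigenvalue_count ?P u}"
      by simp
  next
    fix u assume u: "u \<in> insert 0 {u. 0 < u \<and> is_eigenvalue ?P (complex_of_real u) \<and>
      j < eigenvalue_count ?P u}"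
    show "u \<le> ?g (es ! j)"
    proof (rule ccontr)
      assume less: "\<not> u \<le> ?g (es ! j)"
      have "\<tau>\<^sup>2 \<le> u" using g less by simp
      then have "eigenvalue_count ?P u = card {e\<in>M. u \<le> ?g e}"
        by (rule eigenvalue_count_singular_family[OF M \<tau>])
      also have "{e\<in>M. u \<le> ?g e} \<subseteq> (!) es ` {..<j}"
      proof
        fix e assume e: "e \<in> {e\<in>M. u \<le> ?g e}"
        then obtain i where i: "i < length es" "e = es ! i" using es(1) by (auto simp: in_set_conv_nth)
        have "i < j"
        proof (rule ccontr)
          assume "\<not> i < j"
          then have "?g e \<le> ?g (es ! j)" using le[of j i] i by (auto intro: power_mono)
          then show False using e less unfolding mem_Collect_eq by linarith
        qed
        then show "e \<in> (!) es ` {..<j}" using i by auto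
      qed
      then have "card {e\<in>M. u \<le> ?g e} \<le> card {..<j}"
        by (meson card_image_le card_mono finite_imageI finite_lessThan order_trans)
      finally have "eigenvalue_count ?P u \<le> j" by simp
      moreover have "u \<noteq> 0" using \<open>\<tau>\<^sup>2 \<le> u\<close> \<tau> by auto
      ultimately show False using u by auto
    qed
  qed
  then show ?thesis by (simp add: linear_singular_number_def)
qed

lemma sum_singular_family:
  assumes M: "maximal_singular_family T \<tau> M" and \<tau>: "\<tau> > 0"
  shows "(\<Sum>e\<in>M. norm (T e)) = (\<Sum>j<card M. s j)"
proof -
  obtain xs where xs: "set xs = M" "distinct xs"
    using finite_distinct_list maximal_singular_familyD(2)[OF M] by blast
  define es where "es = rev (sort_key (\<lambda>e. norm (T e)) xs)"
  have es: "set es = M" "distinct es" using xs by (auto simp: es_def)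
  have "sorted_wrt (\<lambda>e f. norm (T e) \<ge> norm (T f)) es"
    unfolding es_def sorted_wrt_rev by (rule sorted_sort_key[unfolded sorted_map])
  then have "s j = norm (T (es ! j))" if "j < length es" for j
    using singular_number_nth[OF M \<tau> es] that by blast
  moreover have "card M = length es" using es by (metis distinct_card)
  ultimately have "(\<Sum>j<card M. s j) = (\<Sum>j<length es. norm (T (es ! j)))" by simp
  also have "\<dots> = (\<Sum>e\<leftarrow>es. norm (T e))" by (simp add: sum_list_sum_nth atLeast0LessThan)
  also have "\<dots> = (\<Sum>e\<in>M. norm (T e))" using es by (simp add: sum_list_distinct_conv_sum_set)
  finally show ?thesis by simp
qed

lemma singular_number_le:
  assumes M: "maximal_singular_family T \<tau> M" and \<tau>: "\<tau> > 0" and j: "card M \<le> j"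
  shows "s j \<le> \<tau>"
proof -
  have "ordered_eigenvalue (adj \<circ> T) j \<le> \<tau>\<^sup>2"
    unfolding ordered_eigenvalue_def
  proof (rule cSup_least)
    fix u assume u: "u \<in> insert 0 {u. 0 < u \<and> is_eigenvalue (adj \<circ> T) (complex_of_real u) \<and>
      j < eigenvalue_count (adj \<circ> T) u}"
    show "u \<le> \<tau>\<^sup>2"
    proof (rule ccontr)
      assume less: "\<not> u \<le> \<tau>\<^sup>2"
      then have "eigenvalue_count (adj \<circ> T) u = card {e\<in>M. u \<le> (norm (T e))\<^sup>2}"
        by (intro eigenvalue_count_singular_family[OF M \<tau>]) simp
      also have "\<dots> \<le> card M" using maximal_singular_familyD(2)[OF M] by (intro card_mono) auto
      finally show False using u j less by (auto simp: not_le dest: less_trans)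
    qed
  qed simp
  then show ?thesis using \<tau> by (simp add: linear_singular_number_def real_le_lsqrt)
qed

lemma singular_number_nonneg: "0 \<le> s j"
proof -
  let ?A = "{u. 0 < u \<and> is_eigenvalue (adj \<circ> T) (complex_of_real u) \<and>
    j < eigenvalue_count (adj \<circ> T) u}"
  obtain b where b: "b \<ge> 0" "\<And>x. norm (T x) \<le> norm x * b"
    using bounded_linear.nonneg_bounded[OF bounded] by auto
  have "u \<le> b\<^sup>2" if u: "is_eigenvalue (adj \<circ> T) (complex_of_real u)" for u
  proof -
    obtain x where x: "x \<noteq> 0" "adj (T x) = complex_of_real u *\<^sub>C x"
      using u by (auto simp: is_eigenvalue_def)
    have "u * (norm x)\<^sup>2 = (norm (T x))\<^sup>2" using singular_eigenvalue[OF x(2)] by simp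
    also have "\<dots> \<le> (norm x * b)\<^sup>2" by (intro power_mono b) simp
    finally show ?thesis using x(1) by (simp add: power_mult_distrib)
  qed
  then have "bdd_above (insert 0 ?A)" by (auto intro!: bdd_aboveI[of _ "b\<^sup>2"])
  then have "0 \<le> ordered_eigenvalue (adj \<circ> T) j"
    unfolding ordered_eigenvalue_def by (rule cSup_upper[rotated]) simp
  then show ?thesis by (simp add: linear_singular_number_def)
qed

text \<open>The spectral theorem in the form needed here.  Suppose that the supremum \<open>m\<close> of the norms of \<open>T x\<close>
  over the unit ball of the orthogonal complement of \<open>M\<close> exceeds \<open>\<tau>\<close>, and let \<open>X n\<close> be a maximising
  sequence.  The complement is invariant under \<open>T\<^sup>* T\<close>, which has norm at most \<open>m\<^sup>2\<close> there, and this
  forces \<open>T\<^sup>* T (X n) - m\<^sup>2 X n \<longlonglongrightarrow> 0\<close>.  As \<open>T (X n)\<close> has a convergent subsequence, so has \<open>X n\<close>;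
  its limit is an eigenvector for \<open>m\<^sup>2\<close> orthogonal to \<open>M\<close>, contradicting maximality.\<close>

lemma norm_orthogonal_complement_le:
  assumes M: "maximal_singular_family T \<tau> M" and \<tau>: "\<tau> > 0"
    and y: "\<And>e. e \<in> M \<Longrightarrow> cinner y e = 0"
  shows "norm (T y) \<le> \<tau> * norm y"
proof (rule ccontr)
  note MD = maximal_singular_familyD[OF M]
  assume contra: "\<not> norm (T y) \<le> \<tau> * norm y"
  define W where "W = {x. \<forall>e\<in>M. cinner x e = 0}"
  define Q where "Q = (\<lambda>x. norm (T x)) ` {x\<in>W. norm x \<le> 1}"
  define m where "m = Sup Q"
  obtain b where b: "b \<ge> 0" "\<And>x. norm (T x) \<le> norm x * b"
    using bounded_linear.nonneg_bounded[OF bounded] by auto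
  have "norm (T x) \<le> b" if "norm x \<le> 1" for x
    using b(2)[of x] mult_right_mono[OF that b(1)] by simp
  then have bdd: "bdd_above Q" by (auto simp: Q_def intro!: bdd_aboveI[of _ b])
  have W_scale: "r *\<^sub>R x \<in> W" if "x \<in> W" for r x using that by (simp add: W_def cinner_scaleR_left)
  have m_le: "norm (T x) \<le> m * norm x" if x: "x \<in> W" for x
  proof (cases "x = 0")
    case False
    have "norm (T ((1 / norm x) *\<^sub>R x)) \<in> Q" unfolding Q_def using False W_scale[OF x] by auto
    then have "norm (T ((1 / norm x) *\<^sub>R x)) \<le> m" unfolding m_def by (rule cSup_upper[OF _ bdd])
    then show ?thesis using False by (simp add: complex_linearD[OF linear] field_simps)
  qed (simp add: complex_linearD[OF linear])
  have "y \<in> W" using y by (simp add: W_def)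
  have "\<tau> * norm y < m * norm y" using contra m_le[OF \<open>y \<in> W\<close>] by simp
  then have "\<tau> < m" by (metis mult_less_cancel_right norm_ge_zero not_le)
  then have "m > 0" using \<tau> by simp
  have "Q \<noteq> {}" by (auto simp: Q_def W_def cinner_zero intro!: exI[of _ 0])
  have "\<exists>x\<in>W. norm x \<le> 1 \<and> m - 1 / real (Suc n) < norm (T x)" for n
    using less_cSupD[OF \<open>Q \<noteq> {}\<close>, of "m - 1 / real (Suc n)"] by (auto simp: m_def Q_def)
  then obtain X where X: "\<And>n. X n \<in> W" "\<And>n. norm (X n) \<le> 1"
    "\<And>n. m - 1 / real (Suc n) < norm (T (X n))" by metis
  have TX_le: "norm (T (X n)) \<le> m" for n
  proof -
    have "m * norm (X n) \<le> m * 1" using X(2)[of n] \<open>m > 0\<close> by (intro mult_left_mono) auto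
    then show ?thesis using m_le[OF X(1), of n] by linarith
  qed
  have "(\<lambda>n. norm (T (X n))) \<longlonglongrightarrow> m"
  proof (rule tendsto_sandwich)
    show "(\<lambda>n. m - 1 / real (Suc n)) \<longlonglongrightarrow> m"
      using tendsto_diff[OF tendsto_const LIMSEQ_Suc[OF lim_1_over_n], of m] by simp
    show "\<forall>\<^sub>F n in sequentially. m - 1 / real (Suc n) \<le> norm (T (X n))"
      using less_imp_le[OF X(3)] by (intro always_eventually allI)
    show "\<forall>\<^sub>F n in sequentially. norm (T (X n)) \<le> m" using TX_le by simp
  qed simp
  then have normTX: "(\<lambda>n. (norm (T (X n)))\<^sup>2) \<longlonglongrightarrow> m\<^sup>2" by (rule tendsto_power)
  have P_le: "norm (adj (T x)) \<le> m\<^sup>2 * norm x" if x: "x \<in> W" for x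
  proof (cases "adj (T x) = 0")
    case False
    have W: "adj (T x) \<in> W" unfolding W_def
    proof safe
      fix e assume e: "e \<in> M"
      have "cinner (adj (T x)) e = cinner x (adj (T e))" by (simp add: adjoint adjoint')
      then show "cinner (adj (T x)) e = 0"
        using MD(5)[OF e] x e by (simp add: W_def cinner_scaleC_right)
    qed
    have "(norm (adj (T x)))\<^sup>2 = cmod (cinner (T (adj (T x))) (T x))"
      by (simp add: adjoint cinner_self norm_power)
    also have "\<dots> \<le> norm (T (adj (T x))) * norm (T x)" by (rule cinner_cauchy_schwarz)
    also have "\<dots> \<le> (m * norm (adj (T x))) * (m * norm x)"
      using \<open>m > 0\<close> by (intro mult_mono m_le W x) auto
    finally show ?thesis using False by (simp add: power2_eq_square field_simps)
  qed simp
  define d where "d n = adj (T (X n)) - m\<^sup>2 *\<^sub>R X n" for n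
  have d_le: "(norm (d n))\<^sup>2 \<le> 2 * m\<^sup>2 * (m\<^sup>2 - (norm (T (X n)))\<^sup>2)" for n
  proof -
    have "inner (adj (T (X n))) (X n) = (norm (T (X n)))\<^sup>2"
      using adjoint'[of "T (X n)" "X n"] by (simp add: cinner_self flip: Re_cinner)
    then have "(norm (d n))\<^sup>2
        = (norm (adj (T (X n))))\<^sup>2 - 2 * m\<^sup>2 * (norm (T (X n)))\<^sup>2 + (m\<^sup>2)\<^sup>2 * (norm (X n))\<^sup>2"
      unfolding d_def power2_norm_eq_inner inner_diff_left inner_diff_right
      by (simp add: inner_commute power2_eq_square)
    also have "(norm (adj (T (X n))))\<^sup>2 \<le> (m\<^sup>2 * 1)\<^sup>2"
      using P_le[OF X(1)[of n]] mult_left_mono[OF X(2)[of n], of "m\<^sup>2"]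
      by (intro power_mono) auto
    also have "(m\<^sup>2)\<^sup>2 * (norm (X n))\<^sup>2 \<le> (m\<^sup>2)\<^sup>2 * 1"
      using X(2)[of n] by (intro mult_left_mono) (auto simp: power_le_one_iff)
    finally show ?thesis by (simp add: algebra_simps power2_eq_square)
  qed
  have "(\<lambda>n. (norm (d n))\<^sup>2) \<longlonglongrightarrow> 0"
  proof (rule tendsto_sandwich[of "\<lambda>_. 0"])
    have "(\<lambda>n. 2 * m\<^sup>2 * (m\<^sup>2 - (norm (T (X n)))\<^sup>2)) \<longlonglongrightarrow> 2 * m\<^sup>2 * (m\<^sup>2 - m\<^sup>2)"
      by (intro tendsto_intros normTX)
    then show "(\<lambda>n. 2 * m\<^sup>2 * (m\<^sup>2 - (norm (T (X n)))\<^sup>2)) \<longlonglongrightarrow> 0" by simp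
  qed (use d_le in auto)
  then have "(\<lambda>n. sqrt ((norm (d n))\<^sup>2)) \<longlonglongrightarrow> sqrt 0" by (rule tendsto_real_sqrt)
  then have d0: "d \<longlonglongrightarrow> 0" by (simp add: tendsto_norm_zero_iff)
  have "T (X n) \<in> closure (T ` cball 0 1)" for n
    using X(2)[of n] by (intro subsetD[OF closure_subset]) auto
  then obtain z r where r: "strict_mono r" "((\<lambda>n. T (X n)) \<circ> r) \<longlonglongrightarrow> z"
    using compact unfolding compact_operator_def compact_def by metis
  have "(\<lambda>n. (1 / m\<^sup>2) *\<^sub>R (adj (T (X (r n))) - d (r n))) \<longlonglongrightarrow> (1 / m\<^sup>2) *\<^sub>R (adj z - 0)"
    using r LIMSEQ_subseq_LIMSEQ[OF d0 r(1)]
    by (intro tendsto_intros bounded_linear.tendsto[OF bounded_linear_adj]) (auto simp: o_def)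
  then have Xr: "(\<lambda>n. X (r n)) \<longlonglongrightarrow> (1 / m\<^sup>2) *\<^sub>R adj z" (is "_ \<longlonglongrightarrow> ?x")
    using \<open>m > 0\<close> by (simp add: d_def)
  have Tx: "T ?x = z"
    using LIMSEQ_unique[OF bounded_linear.tendsto[OF bounded Xr]] r(2) by (simp add: o_def)
  have "(\<lambda>n. norm (T (X (r n)))) \<longlonglongrightarrow> norm z" using r(2) by (auto simp: o_def intro: tendsto_norm)
  moreover have "(\<lambda>n. norm (T (X (r n)))) \<longlonglongrightarrow> m"
    using LIMSEQ_subseq_LIMSEQ[OF \<open>(\<lambda>n. norm (T (X n))) \<longlonglongrightarrow> m\<close> r(1)] by (simp add: o_def)
  ultimately have "norm z = m" by (rule LIMSEQ_unique)
  have "adj (T ?x) = complex_of_real (m\<^sup>2) *\<^sub>C ?x"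
    unfolding Tx scaleC_complex_of_real using \<open>m > 0\<close> by simp
  moreover have "\<tau>\<^sup>2 \<le> m\<^sup>2" using \<open>\<tau> < m\<close> \<tau> by (intro power_mono) auto
  moreover have "cinner ?x e = 0" if "e \<in> M" for e
  proof -
    have "(\<lambda>n. cinner (X (r n)) e) \<longlonglongrightarrow> cinner ?x e" by (intro tendsto_cinner Xr tendsto_const)
    moreover have "cinner (X (r n)) e = 0" for n using X(1) that by (simp add: W_def)
    ultimately show ?thesis by (simp add: LIMSEQ_const_iff)
  qed
  ultimately have "?x = 0" using maximal_singular_family_orthogonal[OF M \<tau>] by blast
  then have "T 0 = z" using Tx by metis
  then have "z = 0" using complex_linearD(3)[OF linear] by metis
  then show False using \<open>norm z = m\<close> \<open>m > 0\<close> by simp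
qed

lemma norm_truncation_le:
  assumes M: "maximal_singular_family T \<tau> M" and \<tau>: "\<tau> > 0"
  shows "norm (T x - T (proj M x)) \<le> \<tau> * norm x"
proof -
  note MD = maximal_singular_familyD[OF M]
  have "norm (T (x - proj M x)) \<le> \<tau> * norm (x - proj M x)"
    using MD by (intro norm_orthogonal_complement_le[OF M \<tau>]) (simp add: cinner_diff_proj)
  also have "\<dots> \<le> \<tau> * norm x" using \<tau> norm_proj_le[OF MD(2,3)] by (intro mult_left_mono) auto
  finally show ?thesis by (simp add: complex_linearD[OF linear])
qed

text \<open>The images of the members of \<open>M\<close>, normalised, are orthonormal as well, and pairing the two
  families in the nuclear bound yields exactly this sum.\<close>

lemma sum_singular_family_le_nuclear_bound:
  assumes "nuclear_bound T c" and M: "singular_family T \<tau> M" and \<tau>: "\<tau> > 0"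
  shows "(\<Sum>e\<in>M. norm (T e)) \<le> c"
proof -
  note MD = singular_familyD[OF M]
  define f where "f e = (1 / norm (T e)) *\<^sub>R T e" for e
  have pos: "norm (T e) > 0" if "e \<in> M" for e using MD(3)[OF that] \<tau> by linarith
  have f1: "cinner (f e) (f e) = 1" if "e \<in> M" for e
    using pos[OF that] by (simp add: f_def cinner_self)
  have f0: "cinner (f e) (f e') = 0" if "e \<in> M" "e' \<in> M" "e \<noteq> e'" for e e'
    using singular_images_orthogonal[OF M that] by (simp add: f_def cinner_scaleR_left cinner_scaleR_right)
  have "inj_on f M" using f0 f1 by (intro inj_onI) (metis zero_neq_one)
  moreover have "orthonormal (f ` M)" using f0 f1 by (auto simp: orthonormal_def)
  ultimately have "bessel M f" using MD(1) by (intro bessel_orthonormal)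
  moreover have "bessel M (\<lambda>e. e)" using MD by (intro bessel_orthonormal) auto
  ultimately have "(\<Sum>e\<in>M. cmod (cinner (T e) (f e))) \<le> c"
    using nuclear_bound_finite[OF assms(1) MD(1)] by blast
  moreover have "cmod (cinner (T e) (f e)) = norm (T e)" if "e \<in> M" for e
    using pos[OF that] by (simp add: f_def cinner_scaleR_right cinner_self norm_mult power2_eq_square)
  ultimately show ?thesis by simp
qed

text \<open>The singular numbers not accounted for by a maximal family at level \<open>\<tau>\<close> are at most \<open>\<tau>\<close>.  There
  may be only finitely many nonzero ones, so \<open>card M\<close> need not exceed \<open>n\<close> for small \<open>\<tau>\<close>; but then the
  missing ones contribute at most \<open>n * \<tau>\<close>, which is arbitrarily small.\<close>

lemma sum_singular_numbers_le_family:
  assumes M: "maximal_singular_family T \<tau> M" and \<tau>: "\<tau> > 0"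
  shows "(\<Sum>j<n. s j) \<le> (\<Sum>j<card M. s j) + n * \<tau>"
proof -
  have "(\<Sum>j<n. s j) \<le> (\<Sum>j<n. (if j < card M then s j else 0) + \<tau>)"
    using singular_number_le[OF M \<tau>] \<tau> by (intro sum_mono) auto
  also have "\<dots> = (\<Sum>j\<in>{..<n} \<inter> {..<card M}. s j) + n * \<tau>"
    by (simp add: sum.distrib sum.If_cases lessThan_def)
  also have "\<dots> \<le> (\<Sum>j<card M. s j) + n * \<tau>"
    using singular_number_nonneg by (intro add_right_mono sum_mono2) auto
  finally show ?thesis .
qed

lemma sum_singular_numbers_le:
  assumes "nuclear_bound T c"
  shows "(\<Sum>j<n. s j) \<le> c"
proof (rule field_le_epsilon)
  fix d :: real assume "d > 0"
  define \<tau> where "\<tau> = d / Suc n"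
  have \<tau>: "\<tau> > 0" "n * \<tau> \<le> d" using \<open>d > 0\<close> by (auto simp: \<tau>_def field_simps)
  obtain M where M: "maximal_singular_family T \<tau> M" using maximal_singular_family_ex[OF \<tau>(1)] .
  have "(\<Sum>j<card M. s j) \<le> c"
    using sum_singular_family_le_nuclear_bound[OF assms maximal_singular_familyD(1)[OF M] \<tau>(1)]
    by (simp add: sum_singular_family[OF M \<tau>(1)])
  then show "(\<Sum>j<n. s j) \<le> c + d"
    using sum_singular_numbers_le_family[OF M \<tau>(1), of n] \<tau>(2) by linarith
qed

lemma summable_singular_numbers:
  assumes "nuclear_bound T c"
  shows "summable s" "suminf s \<le> c"
proof -
  show "summable s"
    using sum_singular_numbers_le[OF assms] singular_number_nonneg
    by (intro summableI_nonneg_bounded[of s c]) auto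
  then show "suminf s \<le> c" by (rule suminf_le_const) (rule sum_singular_numbers_le[OF assms])
qed

text \<open>A larger family \<open>N\<close> at a smaller level approximates \<open>T\<close> in operator norm, and the part of \<open>T\<close> that it
  adds to \<open>M\<close> is a finite sum whose nuclear bound is a partial sum of the remaining singular numbers.\<close>

lemma nuclear_bound_truncation:
  assumes "summable s" and M: "maximal_singular_family T \<tau> M" and \<tau>: "\<tau> > 0"
  shows "nuclear_bound (\<lambda>x. T x - T (proj M x)) (suminf s - (\<Sum>j<card M. s j))"
proof (rule nuclear_bound_limit)
  fix \<epsilon> :: real assume "\<epsilon> > 0"
  note MD = maximal_singular_familyD[OF M]
  define \<sigma> where "\<sigma> = min \<tau> \<epsilon>"
  have \<sigma>: "\<sigma> > 0" "\<sigma> \<le> \<tau>" "\<sigma> \<le> \<epsilon>" using \<tau> \<open>\<epsilon> > 0\<close> by (auto simp: \<sigma>_def)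
  have "singular_family T \<sigma> M" using MD(1) \<sigma>(2) unfolding singular_family_def by force
  then obtain N where N: "maximal_singular_family T \<sigma> N" "M \<subseteq> N"
    using maximal_singular_family_exists[OF \<sigma>(1)] by blast
  note ND = maximal_singular_familyD[OF N(1)]
  define L where "L x = T (proj N x) - T (proj M x)" for x
  have "L x = (\<Sum>e\<in>N - M. cinner x e *\<^sub>C T e)" for x
    using sum.subset_diff[OF N(2) ND(2), of "\<lambda>e. cinner x e *\<^sub>C T e"]
    by (simp add: L_def proj_def complex_linearD[OF linear])
  then have "nuclear_bound L (\<Sum>e\<in>N - M. norm (T e))"
    by (rule nuclear_bound_finite_sum) (use orthonormal_norm[OF ND(3)] in auto)
  moreover have "(\<Sum>e\<in>N - M. norm (T e)) \<le> suminf s - (\<Sum>j<card M. s j)"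
    using sum.subset_diff[OF N(2) ND(2), of "\<lambda>e. norm (T e)"]
      sum_le_suminf[OF assms(1), of "{..<card N}"] singular_number_nonneg
    by (simp add: sum_singular_family[OF N(1) \<sigma>(1)] sum_singular_family[OF M \<tau>])
  ultimately have "nuclear_bound L (suminf s - (\<Sum>j<card M. s j))"
    by (rule nuclear_bound_mono)
  moreover have "norm ((T x - T (proj M x)) - L x) \<le> \<epsilon> * norm x" for x
    using norm_truncation_le[OF N(1) \<sigma>(1), of x] mult_right_mono[OF \<sigma>(3), of "norm x"]
    by (simp add: L_def)
  ultimately show "\<exists>L. nuclear_bound L (suminf s - (\<Sum>j<card M. s j)) \<and>
      (\<forall>x. norm ((T x - T (proj M x)) - L x) \<le> \<epsilon> * norm x)" by blast
qed

lemma nuclear_bound_suminf: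
  assumes "summable s"
  shows "nuclear_bound T (suminf s)"
proof -
  obtain M where M: "maximal_singular_family T 1 M" using maximal_singular_family_ex[of 1] by auto
  have "nuclear_bound (\<lambda>x. T (proj M x)) (\<Sum>e\<in>M. norm (T e))"
    by (rule nuclear_bound_finite_sum)
       (use orthonormal_norm[OF maximal_singular_familyD(3)[OF M]] in
         \<open>auto simp: proj_def complex_linearD[OF linear]\<close>)
  from nuclear_bound_add[OF nuclear_bound_truncation[OF assms M] this] show ?thesis
    by (simp add: sum_singular_family[OF M])
qed

lemma nuclear_approximation:
  assumes "summable s" "\<epsilon> > 0"
  obtains M where "finite M" "orthonormal M" "nuclear_bound (\<lambda>x. T x - T (proj M x)) \<epsilon>"
proof -
  obtain n where n: "norm (\<Sum>i. s (i + n)) < \<epsilon> / 2"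
    using suminf_exist_split[of "\<epsilon> / 2" s] assms by auto
  then have n: "suminf s - (\<Sum>j<n. s j) < \<epsilon> / 2"
    using suminf_minus_initial_segment[OF assms(1), of n] unfolding real_norm_def by linarith
  define \<tau> where "\<tau> = \<epsilon> / 2 / Suc n"
  have \<tau>: "\<tau> > 0" "n * \<tau> \<le> \<epsilon> / 2" using \<open>\<epsilon> > 0\<close> by (auto simp: \<tau>_def field_simps)
  obtain M where M: "maximal_singular_family T \<tau> M" using maximal_singular_family_ex[OF \<tau>(1)] .
  have "suminf s - (\<Sum>j<card M. s j) \<le> \<epsilon>"
    using sum_singular_numbers_le_family[OF M \<tau>(1), of n] \<tau>(2) n by linarith
  then show ?thesis
    using that maximal_singular_familyD[OF M]
      nuclear_bound_mono[OF nuclear_bound_truncation[OF assms(1) M \<tau>(1)]] by blast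
qed

end

section \<open>Determinants of finite rank perturbations of the identity\<close>

text \<open>Both sides are the determinant of the block matrix with rows \<open>(1, -X)\<close> and \<open>(Y, 1)\<close>: multiplying it by
  the unitriangular block matrix with rows \<open>(1, X)\<close> and \<open>(0, 1)\<close> from the left or from the right makes it
  lower triangular.\<close>

lemma det_sylvester:
  fixes X Y :: "'a::idom mat"
  assumes X: "X \<in> carrier_mat n m" and Y: "Y \<in> carrier_mat m n"
  shows "det (1\<^sub>m n + X * Y) = det (1\<^sub>m m + Y * X)"
proof -
  define M where "M = four_block_mat (1\<^sub>m n) (- X) Y (1\<^sub>m m)"
  define U where "U = four_block_mat (1\<^sub>m n) X (0\<^sub>m m n) (1\<^sub>m m)"
  have carr: "M \<in> carrier_mat (n + m) (n + m)" "U \<in> carrier_mat (n + m) (n + m)"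
    using X Y by (auto simp: M_def U_def)
  have XY: "X * Y \<in> carrier_mat n n" "Y * X \<in> carrier_mat m m" using X Y by auto
  have detU: "det U = 1"
    unfolding U_def using X by (subst det_four_block_mat_lower_left_zero[of _ n _ m]) auto
  have MU: "M * U = four_block_mat (1\<^sub>m n) (0\<^sub>m n m) Y (1\<^sub>m m + Y * X)"
  proof -
    have "M * U = four_block_mat (1\<^sub>m n * 1\<^sub>m n + (- X) * 0\<^sub>m m n) (1\<^sub>m n * X + (- X) * 1\<^sub>m m)
        (Y * 1\<^sub>m n + 1\<^sub>m m * 0\<^sub>m m n) (Y * X + 1\<^sub>m m * 1\<^sub>m m)"
      unfolding M_def U_def using X Y by (intro mult_four_block_mat) auto
    also have "\<dots> = four_block_mat (1\<^sub>m n) (0\<^sub>m n m) Y (1\<^sub>m m + Y * X)"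
      using X Y XY by (intro cong_four_block_mat) (auto simp: comm_add_mat[of _ m m])
    finally show ?thesis .
  qed
  have UM: "U * M = four_block_mat (1\<^sub>m n + X * Y) (0\<^sub>m n m) Y (1\<^sub>m m)"
  proof -
    have "U * M = four_block_mat (1\<^sub>m n * 1\<^sub>m n + X * Y) (1\<^sub>m n * (- X) + X * 1\<^sub>m m)
        (0\<^sub>m m n * 1\<^sub>m n + 1\<^sub>m m * Y) (0\<^sub>m m n * (- X) + 1\<^sub>m m * 1\<^sub>m m)"
      unfolding M_def U_def using X Y by (intro mult_four_block_mat) auto
    also have "\<dots> = four_block_mat (1\<^sub>m n + X * Y) (0\<^sub>m n m) Y (1\<^sub>m m)"
      using X Y XY by (intro cong_four_block_mat) auto
    finally show ?thesis .
  qed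
  have "det (M * U) = det (1\<^sub>m m + Y * X)"
    unfolding MU using X Y XY by (subst det_four_block_mat_upper_right_zero[of _ n _ m]) auto
  moreover have "det (U * M) = det (1\<^sub>m n + X * Y)"
    unfolding UM using X Y XY by (subst det_four_block_mat_upper_right_zero[of _ n _ m]) auto
  ultimately show ?thesis using carr by (simp add: det_mult detU)
qed

lemma compression_matrix_carrier [simp]:
  "compression_matrix es S \<in> carrier_mat (length es) (length es)"
  by (simp add: compression_matrix_def)

lemma compression_matrix_nth:
  "i < length es \<Longrightarrow> j < length es \<Longrightarrow> compression_matrix es S $$ (i, j) = cinner (S (es ! j)) (es ! i)"
  by (simp add: compression_matrix_def)

lemma compression_matrix_add_id:
  assumes "orthonormal_basis es V"
  shows "1\<^sub>m (length es) + compression_matrix es K = compression_matrix es (\<lambda>x. x + K x)"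
  using assms
  by (intro eq_matI) (auto simp: compression_matrix_def orthonormal_basis_def cinner_add_left)

lemma compression_matrix_compose:
  assumes es: "orthonormal_basis es V" and T: "complex_linear T" and S: "\<And>e. e \<in> set es \<Longrightarrow> S e \<in> V"
  shows "compression_matrix es (\<lambda>x. T (S x)) = compression_matrix es T * compression_matrix es S"
proof (rule eq_matI)
  fix i j assume "i < dim_row (compression_matrix es T * compression_matrix es S)"
    "j < dim_col (compression_matrix es T * compression_matrix es S)"
  then have ij: "i < length es" "j < length es" by (auto simp: compression_matrix_def)
  have "T (S (es ! j)) = T (\<Sum>k<length es. cinner (S (es ! j)) (es ! k) *\<^sub>C (es ! k))"
    using orthonormal_basis_expand[OF es S, of "es ! j"] ij by simp
  also have "\<dots> = (\<Sum>k<length es. cinner (S (es ! j)) (es ! k) *\<^sub>C T (es ! k))"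
    by (simp add: complex_linearD[OF T])
  finally have "cinner (T (S (es ! j))) (es ! i)
      = (\<Sum>k<length es. cinner (S (es ! j)) (es ! k) * cinner (T (es ! k)) (es ! i))"
    by (simp add: cinner_sum_left cinner_scaleC_left)
  then show "compression_matrix es (\<lambda>x. T (S x)) $$ (i, j)
      = (compression_matrix es T * compression_matrix es S) $$ (i, j)"
    using ij by (simp add: compression_matrix_def scalar_prod_def atLeast0LessThan mult.commute)
qed (auto simp: compression_matrix_def)

text \<open>The matrix of \<open>K\<close> on the larger basis is \<open>X Y\<close> and the one on the smaller basis is \<open>Y X\<close>,
  where \<open>X\<close> contains the coordinates of the smaller basis.\<close>

lemma det_compression_matrix_eq:
  assumes K: "complex_linear K" and es: "orthonormal_basis es V" and fs: "orthonormal_basis fs W"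
    and V: "range K \<subseteq> V" "V \<subseteq> W"
  shows "det (1\<^sub>m (length fs) + compression_matrix fs K) = det (1\<^sub>m (length es) + compression_matrix es K)"
proof -
  let ?n = "length fs" and ?m = "length es"
  define X where "X = mat ?n ?m (\<lambda>(k, i). cinner (es ! i) (fs ! k))"
  define Y where "Y = mat ?m ?n (\<lambda>(i, l). cinner (K (fs ! l)) (es ! i))"
  have carr: "X \<in> carrier_mat ?n ?m" "Y \<in> carrier_mat ?m ?n" by (auto simp: X_def Y_def)
  have "X * Y = compression_matrix fs K"
  proof (rule eq_matI)
    fix k l assume "k < dim_row (compression_matrix fs K)" "l < dim_col (compression_matrix fs K)"
    then have kl: "k < ?n" "l < ?n" by (auto simp: compression_matrix_def)
    have "K (fs ! l) = (\<Sum>i<?m. cinner (K (fs ! l)) (es ! i) *\<^sub>C (es ! i))"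
      using V(1) by (intro orthonormal_basis_expand[OF es]) auto
    from arg_cong[OF this, of "\<lambda>v. cinner v (fs ! k)"] have "cinner (K (fs ! l)) (fs ! k)
        = (\<Sum>i<?m. cinner (K (fs ! l)) (es ! i) * cinner (es ! i) (fs ! k))"
      by (simp only: cinner_scaleC_left cinner_sum_left)
    then show "(X * Y) $$ (k, l) = compression_matrix fs K $$ (k, l)"
      using kl carr
      by (simp add: compression_matrix_nth scalar_prod_def X_def Y_def atLeast0LessThan mult.commute)
  qed (auto simp: compression_matrix_def X_def Y_def)
  moreover have "Y * X = compression_matrix es K"
  proof (rule eq_matI)
    fix i j assume "i < dim_row (compression_matrix es K)" "j < dim_col (compression_matrix es K)"
    then have ij: "i < ?m" "j < ?m" by (auto simp: compression_matrix_def)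
    have "es ! j \<in> W" using es ij V(2) complex_vector.span_base[of "es ! j" "set es"]
      by (auto simp: orthonormal_basis_iff)
    then have "K (es ! j) = K (\<Sum>l<?n. cinner (es ! j) (fs ! l) *\<^sub>C (fs ! l))"
      using orthonormal_basis_expand[OF fs] by simp
    then have "cinner (K (es ! j)) (es ! i)
        = (\<Sum>l<?n. cinner (es ! j) (fs ! l) * cinner (K (fs ! l)) (es ! i))"
      by (simp add: complex_linearD[OF K] cinner_sum_left cinner_scaleC_left)
    then show "(Y * X) $$ (i, j) = compression_matrix es K $$ (i, j)"
      using ij carr
      by (simp add: compression_matrix_nth scalar_prod_def X_def Y_def atLeast0LessThan mult.commute)
  qed (auto simp: compression_matrix_def X_def Y_def)
  ultimately show ?thesis using det_sylvester[OF carr] by simp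
qed

text \<open>Complex linear with finite-dimensional range; asking only for a finite set whose span
  contains the range makes closure under the algebraic operations immediate.\<close>

definition finite_rank_linear :: "('a::complex_inner \<Rightarrow> 'a) \<Rightarrow> bool" where
  "finite_rank_linear K \<longleftrightarrow> complex_linear K \<and> (\<exists>B. finite B \<and> range K \<subseteq> cspan B)"

lemma range_span_subset_iff:
  "range_span K \<subseteq> cspan B \<longleftrightarrow> range K \<subseteq> cspan B"
  unfolding range_span_def
  by (meson complex_vector.span_minimal complex_vector.subspace_span complex_vector.span_superset
      order_trans)

lemma range_span_finite:
  assumes "finite B" "range K \<subseteq> cspan B"
  shows "\<exists>B'. finite B' \<and> range_span K = cspan B'"
proof -
  obtain B' where B': "B' \<subseteq> range_span K" "complex_vector.independent B'"
    "range_span K \<subseteq> cspan B'"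
    using complex_vector.basis_exists by metis
  have "B' \<subseteq> cspan B" using B'(1) assms(2) range_span_subset_iff by blast
  then have "finite B'" using complex_vector.independent_span_bound[OF assms(1) B'(2)] by blast
  moreover have "range_span K = cspan B'"
    using B' complex_vector.span_mono[OF B'(1)] unfolding range_span_def
    by (simp add: complex_vector.span_span subset_antisym)
  ultimately show ?thesis by blast
qed

lemma finite_rank_linear_iff: "finite_rank_linear K \<longleftrightarrow> complex_linear K \<and> finite_rank K"
proof -
  have "complex_linear K \<Longrightarrow> real_linear K"
    by (simp add: real_linear_def complex_linearD)
  moreover have "range K \<subseteq> range_span K"
    unfolding range_span_def by (rule complex_vector.span_superset)
  ultimately show ?thesis
    unfolding finite_rank_linear_def finite_rank_def using range_span_finite by metis
qed

lemma range_basis: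
  assumes "finite B" "range K \<subseteq> cspan B"
  shows "orthonormal_basis (range_basis K) (range_span K)"
proof -
  obtain B' where "finite B'" "range_span K = cspan B'"
    using range_span_finite[OF assms] by blast
  then have "\<exists>es. orthonormal_basis es (range_span K)" using ex_orthonormal_basis[of B'] by simp
  then show ?thesis unfolding range_basis_def by (rule someI_ex)
qed

text \<open>This frees the determinant from the chosen basis of the range, so that several operators can be
  compared in a common basis.\<close>

lemma finite_rank_det_eq:
  assumes K: "complex_linear K" and fs: "orthonormal_basis fs W" and W: "range K \<subseteq> W"
  shows "finite_rank_det K = det (compression_matrix fs (\<lambda>x. x + K x))"
proof -
  have W': "W = cspan (set fs)" using fs by (simp add: orthonormal_basis_iff)
  then have "orthonormal_basis (range_basis K) (range_span K)"
    using W by (intro range_basis[of "set fs"]) auto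
  then have "finite_rank_det K = det (1\<^sub>m (length fs) + compression_matrix fs K)"
    unfolding finite_rank_det_def Let_def
    by (rule det_compression_matrix_eq[OF K _ fs, symmetric])
       (use W W' range_span_subset_iff[of K "set fs"] in
        \<open>auto simp: range_span_def intro: complex_vector.span_base\<close>)
  then show ?thesis by (simp add: compression_matrix_add_id[OF fs])
qed

lemma finite_rank_common_basis:
  assumes "finite_rank_linear K" "finite_rank_linear L"
  obtains fs where "orthonormal_basis fs (cspan (set fs))"
    "range K \<subseteq> cspan (set fs)" "range L \<subseteq> cspan (set fs)"
proof -
  obtain A B where AB: "finite A" "range K \<subseteq> cspan A" "finite B"
    "range L \<subseteq> cspan B"
    using assms unfolding finite_rank_linear_def by blast
  obtain fs where fs: "orthonormal_basis fs (cspan (A \<union> B))"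
    using ex_orthonormal_basis AB by (metis finite_UnI)
  then have "cspan (set fs) = cspan (A \<union> B)"
    by (simp add: orthonormal_basis_iff)
  then show ?thesis
    using that[of fs] fs AB complex_vector.span_mono[of A "A \<union> B"]
      complex_vector.span_mono[of B "A \<union> B"] by auto
qed

lemma finite_rank_basis:
  assumes "finite_rank_linear K"
  obtains fs where "orthonormal_basis fs (cspan (set fs))" "range K \<subseteq> cspan (set fs)"
  using finite_rank_common_basis[OF assms assms] by metis

text \<open>The hypothesis on \<open>M\<close> says \<open>I + M = (I + K) (I + L)\<close>.\<close>

lemma finite_rank_det_mult:
  assumes K: "finite_rank_linear K" and L: "finite_rank_linear L"
    and M: "\<And>x. M x = K x + L x + K (L x)"
  shows "finite_rank_det M = finite_rank_det K * finite_rank_det L"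
proof -
  obtain fs where fs: "orthonormal_basis fs (cspan (set fs))"
    "range K \<subseteq> cspan (set fs)" "range L \<subseteq> cspan (set fs)"
    using finite_rank_common_basis[OF K L] .
  have lin: "complex_linear K" "complex_linear L" using K L by (auto simp: finite_rank_linear_def)
  have M': "complex_linear M"
    unfolding complex_linear_def M using lin
    by (simp add: complex_linearD scaleC_add_right)
  have rM: "range M \<subseteq> cspan (set fs)"
    using fs(2,3) by (auto simp: M intro!: complex_vector.span_add)
  have "(\<lambda>x. x + M x) = (\<lambda>x. (\<lambda>y. y + K y) (x + L x))"
    by (rule ext) (simp add: M complex_linearD[OF lin(1)])
  then have "compression_matrix fs (\<lambda>x. x + M x)
      = compression_matrix fs (\<lambda>x. x + K x) * compression_matrix fs (\<lambda>x. x + L x)"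
    using compression_matrix_compose[OF fs(1), of "\<lambda>x. x + K x" "\<lambda>x. x + L x"] lin fs(3)
    by (simp add: complex_linear_def scaleC_add_right complex_vector.span_add
        complex_vector.span_base range_subsetD)
  then show ?thesis
    unfolding finite_rank_det_eq[OF M' fs(1) rM] finite_rank_det_eq[OF lin(1) fs(1,2)]
      finite_rank_det_eq[OF lin(2) fs(1,3)] by (simp add: det_mult[of _ "length fs"])
qed

text \<open>A kernel vector satisfies \<open>x = - K x\<close>, so it lies in the range of \<open>K\<close> and is detected by the matrix.\<close>

lemma finite_rank_det_eq_0_iff:
  assumes K: "finite_rank_linear K"
  shows "finite_rank_det K = 0 \<longleftrightarrow> (\<exists>x. x \<noteq> 0 \<and> x + K x = 0)"
proof -
  obtain fs where fs: "orthonormal_basis fs (cspan (set fs))"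
    "range K \<subseteq> cspan (set fs)"
    using finite_rank_basis[OF K] .
  have lin: "complex_linear K" using K by (auto simp: finite_rank_linear_def)
  let ?n = "length fs" and ?A = "compression_matrix fs (\<lambda>x. x + K x)"
  define vec_of where "vec_of x = vec ?n (\<lambda>k. cinner x (fs ! k))" for x
  have mult: "?A *\<^sub>v vec_of x = vec_of (x + K x)" if x: "x \<in> cspan (set fs)" for x
  proof (rule eq_vecI)
    fix i assume "i < dim_vec (vec_of (x + K x))"
    then have i: "i < ?n" by (simp add: vec_of_def)
    have "x + K x = (\<Sum>k<?n. cinner x (fs ! k) *\<^sub>C (fs ! k + K (fs ! k)))"
      using orthonormal_basis_expand[OF fs(1) x]
      by (simp add: scaleC_add_right sum.distrib flip: complex_linearD[OF lin])
    then have "cinner (x + K x) (fs ! i)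
        = (\<Sum>k<?n. cinner x (fs ! k) * cinner (fs ! k + K (fs ! k)) (fs ! i))"
      by (simp add: cinner_sum_left cinner_scaleC_left)
    then show "(?A *\<^sub>v vec_of x) $ i = vec_of (x + K x) $ i"
      using i by (simp add: vec_of_def compression_matrix_def scalar_prod_def atLeast0LessThan
          mult.commute)
  qed (simp add: vec_of_def compression_matrix_def)
  have vec0: "vec_of x = 0\<^sub>v ?n \<longleftrightarrow> x = 0" if x: "x \<in> cspan (set fs)" for x
  proof
    assume "vec_of x = 0\<^sub>v ?n"
    then have "cinner x (fs ! k) = 0" if "k < ?n" for k
      using that by (metis index_vec index_zero_vec(1) vec_of_def)
    then show "x = 0" using x by (intro span_orthogonal_eq_0[of "set fs" x]) (auto simp: in_set_conv_nth)
  qed (auto simp: vec_of_def cinner_zero)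
  have surj: "\<exists>x\<in>cspan (set fs). v = vec_of x" if v: "v \<in> carrier_vec ?n" for v
  proof
    let ?x = "\<Sum>k<?n. (v $ k) *\<^sub>C (fs ! k)"
    show "?x \<in> cspan (set fs)"
      by (intro complex_vector.span_sum complex_vector.span_scale complex_vector.span_base) auto
    have "cinner ?x (fs ! i) = v $ i" if "i < ?n" for i
    proof -
      have "cinner ?x (fs ! i) = (\<Sum>k<?n. if k = i then v $ k else 0)"
        unfolding cinner_sum_left cinner_scaleC_left
        using fs(1) that by (intro sum.cong) (auto simp: orthonormal_basis_def)
      then show ?thesis using that by simp
    qed
    then show "v = vec_of ?x" using v by (intro eq_vecI) (auto simp: vec_of_def)
  qed
  have cl: "x + K x \<in> cspan (set fs)" if "x \<in> cspan (set fs)" for x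
    using that fs(2) by (auto intro: complex_vector.span_add)
  have "finite_rank_det K = 0 \<longleftrightarrow> (\<exists>v. v \<in> carrier_vec ?n \<and> v \<noteq> 0\<^sub>v ?n \<and> ?A *\<^sub>v v = 0\<^sub>v ?n)"
    unfolding finite_rank_det_eq[OF lin fs] by (rule det_0_iff_vec_prod_zero) simp
  also have "\<dots> \<longleftrightarrow> (\<exists>x\<in>cspan (set fs). x \<noteq> 0 \<and> x + K x = 0)"
  proof
    assume "\<exists>v. v \<in> carrier_vec ?n \<and> v \<noteq> 0\<^sub>v ?n \<and> ?A *\<^sub>v v = 0\<^sub>v ?n"
    then obtain x where "x \<in> cspan (set fs)" "vec_of x \<noteq> 0\<^sub>v ?n"
      "?A *\<^sub>v vec_of x = 0\<^sub>v ?n" using surj by blast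
    then show "\<exists>x\<in>cspan (set fs). x \<noteq> 0 \<and> x + K x = 0"
      using mult vec0 cl by metis
  next
    assume "\<exists>x\<in>cspan (set fs). x \<noteq> 0 \<and> x + K x = 0"
    then obtain x where "x \<in> cspan (set fs)" "x \<noteq> 0" "x + K x = 0" by blast
    moreover have "vec_of x \<in> carrier_vec ?n" by (simp add: vec_of_def)
    ultimately show "\<exists>v. v \<in> carrier_vec ?n \<and> v \<noteq> 0\<^sub>v ?n \<and> ?A *\<^sub>v v = 0\<^sub>v ?n"
      using mult vec0 cl by metis
  qed
  also have "\<dots> \<longleftrightarrow> (\<exists>x. x \<noteq> 0 \<and> x + K x = 0)"
  proof -
    have "x \<in> cspan (set fs)" if "x + K x = 0" for x
    proof -
      have "x = - K x" using that by (simp add: eq_neg_iff_add_eq_0)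
      then show ?thesis using fs(2) complex_vector.span_neg by (metis range_subsetD)
    qed
    then show ?thesis by blast
  qed
  finally show ?thesis .
qed

lemma finite_rank_det_rank_one:
  assumes K: "\<And>x. K x = cinner x a *\<^sub>C b"
  shows "finite_rank_linear K" "finite_rank_det K = 1 + cinner b a"
proof -
  have lin: "complex_linear K"
    by (simp add: complex_linear_def K cinner_add_left cinner_scaleC_left scaleC_add_left scaleC_scaleC)
  have "range K \<subseteq> cspan {b}"
    by (auto simp: K intro: complex_vector.span_scale complex_vector.span_base)
  then show "finite_rank_linear K" using lin unfolding finite_rank_linear_def by blast
  show "finite_rank_det K = 1 + cinner b a"
  proof (cases "b = 0")
    case True
    have "orthonormal_basis [] {0::'a}" by (simp add: orthonormal_basis_def)
    then have "finite_rank_det K = det (compression_matrix [] (\<lambda>x. x + K x))"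
      using lin by (intro finite_rank_det_eq[of _ _ "{0}"])
        (auto simp: K True complex_vector.scale_zero_right)
    then show ?thesis by (simp add: True cinner_zero compression_matrix_def)
  next
    case False
    define e where "e = (1 / norm b) *\<^sub>R b"
    have e: "cinner e e = 1" using False by (simp add: e_def cinner_self)
    have b: "b = norm b *\<^sub>R e" using False by (simp add: e_def)
    have "orthonormal_basis [e] (cspan {e})"
      using e by (simp add: orthonormal_basis_def)
    moreover have "range K \<subseteq> cspan {e}"
    proof safe
      fix x
      have "K x = (cinner x a * norm b) *\<^sub>C e"
        unfolding K by (subst b) (simp add: scaleC_scaleC flip: scaleC_complex_of_real)
      then show "K x \<in> cspan {e}"
        by (simp add: complex_vector.span_scale complex_vector.span_base)
    qed
    ultimately have "finite_rank_det K = det (compression_matrix [e] (\<lambda>x. x + K x))"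
      using lin by (intro finite_rank_det_eq)
    also have "\<dots> = cinner (e + K e) e"
      by (subst det_single) (auto simp: compression_matrix_def)
    also have "\<dots> = 1 + cinner e a * cinner b e"
      by (simp add: K cinner_add_left cinner_scaleC_left e)
    also have "cinner b e = complex_of_real (norm b)"
      by (metis b cinner_scaleR_left e mult.right_neutral)
    also have "cinner e a * complex_of_real (norm b) = cinner b a"
      by (metis b cinner_scaleR_left mult.commute)
    finally show ?thesis .
  qed
qed

lemma finite_rank_det_tendsto:
  assumes K: "\<And>m. complex_linear (Ks m)" "complex_linear K"
    and fs: "orthonormal_basis fs W" "\<And>m. range (Ks m) \<subseteq> W" "range K \<subseteq> W"
    and lim: "\<And>x. (\<lambda>m. Ks m x) \<longlonglongrightarrow> K x"
  shows "(\<lambda>m. finite_rank_det (Ks m)) \<longlonglongrightarrow> finite_rank_det K"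
proof -
  let ?n = "length fs"
  have "(\<lambda>m. compression_matrix fs (\<lambda>x. x + Ks m x) $$ (i, j))
      \<longlonglongrightarrow> compression_matrix fs (\<lambda>x. x + K x) $$ (i, j)" if "i < ?n" "j < ?n" for i j
    using that by (simp add: compression_matrix_nth) (intro tendsto_cinner tendsto_intros lim)
  then have "(\<lambda>m. det (compression_matrix fs (\<lambda>x. x + Ks m x)))
      \<longlonglongrightarrow> det (compression_matrix fs (\<lambda>x. x + K x))"
    unfolding det_def'[OF compression_matrix_carrier]
    by (intro tendsto_sum tendsto_mult tendsto_const tendsto_prod) (auto dest: permutes_in_image)
  then show ?thesis
    using finite_rank_det_eq[OF K(1) fs(1,2)] finite_rank_det_eq[OF K(2) fs(1,3)] by simp
qed

section \<open>Small perturbations of the identity\<close>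

definition perturbation_inverse :: "('a::complex_inner \<Rightarrow> 'a) \<Rightarrow> 'a \<Rightarrow> 'a" where
  "perturbation_inverse E = inv_into UNIV (\<lambda>x. x + E x)"

text \<open>The equation \<open>x + E x = y\<close> says that \<open>x\<close> is a fixed point of the contraction \<open>x \<mapsto> y - E x\<close>.\<close>

lemma perturbation_inverse:
  fixes E :: "'a::complex_hilbert \<Rightarrow> 'a"
  assumes E: "complex_linear E" "\<And>x. norm (E x) \<le> q * norm x" and q: "q \<le> 1 / 2"
  shows "perturbation_inverse E (x + E x) = x"
    "perturbation_inverse E y + E (perturbation_inverse E y) = y"
    "complex_linear (perturbation_inverse E)"
    "norm (perturbation_inverse E y) \<le> 2 * norm y"
proof -
  let ?f = "\<lambda>x. x + E x"
  have half: "norm (E x) \<le> norm x / 2" for x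
    using E(2)[of x] mult_right_mono[OF q, of "norm x"] by simp
  have lower: "norm x \<le> 2 * norm (x + E x)" for x
    using half[of x] norm_triangle_ineq2[of x "- E x"] by simp
  have diff: "?f x - ?f y = ?f (x - y)" for x y by (simp add: complex_linearD[OF E(1)])
  have "inj ?f"
  proof (rule injI)
    fix x y assume "?f x = ?f y"
    then have "norm (?f (x - y)) = 0" by (simp flip: diff)
    then show "x = y" using lower[of "x - y"] by simp
  qed
  have "surj ?f"
  proof (rule surjI)
    fix y
    have "\<exists>!x. y - E x = x"
    proof (rule banach_fix_type[of "1/2"])
      show "\<forall>x z. dist (y - E x) (y - E z) \<le> 1 / 2 * dist x z"
      proof (intro allI)
        fix x z
        have "dist (y - E x) (y - E z) = norm (E (z - x))"
          by (simp add: dist_norm complex_linearD[OF E(1)])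
        then show "dist (y - E x) (y - E z) \<le> 1 / 2 * dist x z"
          using half[of "z - x"] by (simp add: dist_norm norm_minus_commute)
      qed
    qed auto
    then have "\<exists>x. y = x + E x" by (metis diff_add_cancel)
    then show "?f (inv_into UNIV ?f y) = y" by (metis f_inv_into_f rangeI)
  qed
  show l: "perturbation_inverse E (x + E x) = x" for x
    unfolding perturbation_inverse_def using \<open>inj ?f\<close> by (rule inv_f_f)
  show r: "perturbation_inverse E y + E (perturbation_inverse E y) = y" for y
    unfolding perturbation_inverse_def using surj_f_inv_f[OF \<open>surj ?f\<close>] by simp
  show "norm (perturbation_inverse E y) \<le> 2 * norm y"
    using lower[of "perturbation_inverse E y"] unfolding r .
  show "complex_linear (perturbation_inverse E)"
    unfolding complex_linear_def
  proof (intro conjI allI)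
    fix x y c
    let ?J = "perturbation_inverse E"
    have "?J ((?J x + ?J y) + E (?J x + ?J y)) = ?J x + ?J y" by (rule l)
    moreover have "(?J x + ?J y) + E (?J x + ?J y) = x + y"
      using r[of x] r[of y] by (simp add: complex_linearD[OF E(1)] algebra_simps)
    ultimately show "?J (x + y) = ?J x + ?J y" by simp
    have "?J (c *\<^sub>C ?J x + E (c *\<^sub>C ?J x)) = c *\<^sub>C ?J x" by (rule l)
    moreover have "c *\<^sub>C ?J x + E (c *\<^sub>C ?J x) = c *\<^sub>C x"
      using r[of x] by (simp add: complex_linearD[OF E(1)] flip: scaleC_add_right)
    ultimately show "?J (c *\<^sub>C x) = c *\<^sub>C ?J x" by simp
  qed
qed

lemma finite_rank_linear_sum:
  assumes "finite I" and K: "\<And>x. K x = (\<Sum>i\<in>I. cinner x (a i) *\<^sub>C b i)"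
  shows "finite_rank_linear K"
proof -
  have "complex_linear K"
    by (simp add: complex_linear_def K cinner_add_left cinner_scaleC_left scaleC_add_left
      scaleC_scaleC sum.distrib complex_vector.scale_sum_right)
  moreover have "range K \<subseteq> cspan (b ` I)"
  proof safe
    fix x
    show "K x \<in> cspan (b ` I)" unfolding K
      by (intro complex_vector.span_sum complex_vector.span_scale complex_vector.span_base) auto
  qed
  ultimately show ?thesis using assms(1) unfolding finite_rank_linear_def by blast
qed

lemma finite_rank_linear_compose:
  assumes "complex_linear B" "finite_rank_linear K"
  shows "finite_rank_linear (\<lambda>x. B (K x))"
proof -
  obtain A where A: "finite A" "range K \<subseteq> cspan A"
    using assms(2) by (auto simp: finite_rank_linear_def)
  have "B y \<in> cspan (B ` A)" if "y \<in> cspan A" for y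
    using that
  proof (induction rule: complex_vector.span_induct_alt)
    case (step c x y)
    then show ?case unfolding complex_linearD[OF assms(1)]
      by (intro complex_vector.span_add complex_vector.span_scale) (auto intro: complex_vector.span_base)
  qed (simp add: complex_linearD[OF assms(1)] complex_vector.span_zero)
  then have "range (\<lambda>x. B (K x)) \<subseteq> cspan (B ` A)" using A by auto
  moreover have "complex_linear (\<lambda>x. B (K x))"
    using assms by (simp add: finite_rank_linear_def complex_linear_def)
  ultimately show ?thesis using A(1) unfolding finite_rank_linear_def by blast
qed

lemma finite_rank_linear_compose_right:
  assumes "finite_rank_linear K" "complex_linear B"
  shows "finite_rank_linear (\<lambda>x. K (B x))"
proof -
  have "complex_linear (\<lambda>x. K (B x))"
    using assms by (simp add: finite_rank_linear_def complex_linear_def)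
  moreover have "range (\<lambda>x. K (B x)) \<subseteq> range K" by auto
  ultimately show ?thesis using assms(1) unfolding finite_rank_linear_def by blast
qed

lemma finite_rank_linear_diff:
  assumes "finite_rank_linear K" "finite_rank_linear L"
  shows "finite_rank_linear (\<lambda>x. K x - L x)"
proof -
  obtain fs where fs: "range K \<subseteq> cspan (set fs)" "range L \<subseteq> cspan (set fs)"
    using finite_rank_common_basis[OF assms] by metis
  then have "range (\<lambda>x. K x - L x) \<subseteq> cspan (set fs)"
    by (auto intro!: complex_vector.span_diff)
  moreover have "complex_linear (\<lambda>x. K x - L x)"
    using assms by (simp add: finite_rank_linear_def complex_linear_def
      complex_vector.scale_right_diff_distrib)
  ultimately show ?thesis unfolding finite_rank_linear_def by blast
qed

text \<open>Add the rank one terms one at a time.  If \<open>S\<close> is the sum so far and \<open>R\<close> is the next term, then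
  \<open>I + S + R = (I + S) (I + (I + S)\<^sup>-\<^sup>1 R)\<close>, and the second factor has determinant \<open>1 + z\<close> with
  \<open>\<bar>z\<bar> \<le> 2 * (norm (a j) * norm (b j))\<close>, because the smallness hypothesis bounds the inverse by \<open>2\<close>.\<close>

lemma finite_rank_det_sum_near_1:
  fixes a b :: "'i \<Rightarrow> 'a::complex_hilbert"
  assumes "finite I" and K: "\<And>x. K x = (\<Sum>i\<in>I. cinner x (a i) *\<^sub>C b i)"
    and small: "(\<Sum>i\<in>I. norm (a i) * norm (b i)) \<le> 1 / 2"
  shows "cmod (finite_rank_det K - 1) \<le> (\<Prod>i\<in>I. 1 + 2 * (norm (a i) * norm (b i))) - 1"
  using assms
proof (induction I arbitrary: K)
  case empty
  then have "finite_rank_det K = 1"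
    using finite_rank_det_rank_one[of K 0 0] by (simp add: cinner_zero complex_vector.scale_zero_right)
  then show ?case by simp
next
  case (insert j I)
  define S where "S x = (\<Sum>i\<in>I. cinner x (a i) *\<^sub>C b i)" for x
  let ?\<nu> = "\<Sum>i\<in>I. norm (a i) * norm (b i)" and ?t = "norm (a j) * norm (b j)"
  have \<nu>: "?\<nu> + ?t \<le> 1 / 2" using insert by (simp add: add.commute)
  then have \<nu>': "?\<nu> \<le> 1 / 2" using mult_nonneg_nonneg[OF norm_ge_zero[of "a j"] norm_ge_zero[of "b j"]] by linarith
  have IH: "cmod (finite_rank_det S - 1) \<le> (\<Prod>i\<in>I. 1 + 2 * (norm (a i) * norm (b i))) - 1"
    using insert.IH[OF S_def \<nu>'] .
  have S: "finite_rank_linear S" by (rule finite_rank_linear_sum[OF insert.hyps(1) S_def])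
  then have linS: "complex_linear S" by (simp add: finite_rank_linear_def)
  have "norm (S x) \<le> ?\<nu> * norm x" for x
  proof -
    have "norm (S x) \<le> (\<Sum>i\<in>I. norm x * norm (a i) * norm (b i))"
      unfolding S_def by (intro order_trans[OF norm_sum] sum_mono)
        (auto simp: norm_scaleC intro!: mult_right_mono cinner_cauchy_schwarz)
    then show ?thesis by (simp add: sum_distrib_left mult_ac)
  qed
  note J = perturbation_inverse[OF linS this \<nu>']
  let ?J = "perturbation_inverse S"
  define R where "R x = cinner x (a j) *\<^sub>C ?J (b j)" for x
  define z where "z = cinner (?J (b j)) (a j)"
  have R: "finite_rank_linear R" "finite_rank_det R = 1 + z"
    using finite_rank_det_rank_one[of R] by (auto simp: R_def z_def)
  have "K x = S x + R x + S (R x)" for x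
  proof -
    have "R x + S (R x) = cinner x (a j) *\<^sub>C (?J (b j) + S (?J (b j)))"
      by (simp add: R_def complex_linearD(2)[OF linS] scaleC_add_right)
    then have "R x + S (R x) = cinner x (a j) *\<^sub>C b j" by (simp only: J(2))
    moreover have "K x = S x + cinner x (a j) *\<^sub>C b j"
      using insert.hyps insert.prems(1)[of x] by (simp add: S_def)
    ultimately show ?thesis by (simp add: add.assoc)
  qed
  then have det: "finite_rank_det K = finite_rank_det S * (1 + z)"
    using finite_rank_det_mult[OF S R(1)] R(2) by simp
  have z: "cmod z \<le> 2 * ?t"
    using order_trans[OF cinner_cauchy_schwarz[of "?J (b j)" "a j"]
        mult_right_mono[OF J(4)[of "b j"], of "norm (a j)"]]
    by (simp add: z_def mult_ac)
  let ?p = "\<Prod>i\<in>I. 1 + 2 * (norm (a i) * norm (b i))"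
  have "cmod (finite_rank_det K - 1) = cmod ((finite_rank_det S - 1) * (1 + z) + z)"
    by (simp add: det algebra_simps)
  also have "\<dots> \<le> cmod (finite_rank_det S - 1) * cmod (1 + z) + cmod z"
    by (metis norm_mult norm_triangle_ineq)
  also have "\<dots> \<le> (?p - 1) * (1 + 2 * ?t) + 2 * ?t"
    using IH z norm_triangle_ineq[of 1 z] order_trans[OF norm_ge_zero IH]
    by (intro add_mono mult_mono) auto
  also have "\<dots> = (\<Prod>i\<in>insert j I. 1 + 2 * (norm (a i) * norm (b i))) - 1"
    using insert.hyps by (simp add: algebra_simps)
  finally show ?case .
qed

lemma finite_rank_det_sum_near_1_exp:
  fixes a b :: "'i \<Rightarrow> 'a::complex_hilbert"
  assumes "finite I" and K: "\<And>x. K x = (\<Sum>i\<in>I. cinner x (a i) *\<^sub>C b i)"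
    and \<nu>: "(\<Sum>i\<in>I. norm (a i) * norm (b i)) \<le> \<nu>" "\<nu> \<le> 1 / 2"
  shows "cmod (finite_rank_det K - 1) \<le> exp (2 * \<nu>) - 1"
proof -
  have "(\<Prod>i\<in>I. 1 + 2 * (norm (a i) * norm (b i))) \<le> (\<Prod>i\<in>I. exp (2 * (norm (a i) * norm (b i))))"
    by (intro prod_mono) (auto intro: exp_ge_add_one_self)
  also have "\<dots> = exp (2 * (\<Sum>i\<in>I. norm (a i) * norm (b i)))"
    by (simp add: exp_sum[OF assms(1)] sum_distrib_left)
  also have "\<dots> \<le> exp (2 * \<nu>)" using \<nu>(1) by simp
  finally show ?thesis
    using finite_rank_det_sum_near_1[OF assms(1) K order_trans[OF \<nu>]] by linarith
qed

section \<open>Nuclear operators\<close>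

lemma compact_operatorI:
  assumes "T ` cball 0 1 \<subseteq> S" "compact S"
  shows "compact_operator T"
proof -
  have "closure (T ` cball 0 1) \<subseteq> S"
    using assms by (simp add: closure_minimal compact_imp_closed)
  then have "closure (T ` cball 0 1) = S \<inter> closure (T ` cball 0 1)" by blast
  then show ?thesis
    unfolding compact_operator_def by (metis assms(2) closed_closure compact_Int_closed)
qed

lemma compact_operatorD: "compact_operator T \<Longrightarrow> compact (closure (T ` cball 0 1))"
  unfolding compact_operator_def .

lemma image_unit_ball_closure: "norm x \<le> 1 \<Longrightarrow> T x \<in> closure (T ` cball 0 1)"
  by (intro subsetD[OF closure_subset]) auto

lemma compact_operator_add:
  assumes "compact_operator T" "compact_operator S"
  shows "compact_operator (\<lambda>x. T x + S x)"
proof (rule compact_operatorI)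
  show "compact {x + y |x y. x \<in> closure (T ` cball 0 1) \<and> y \<in> closure (S ` cball 0 1)}"
    using assms by (intro compact_sums) (auto dest: compact_operatorD)
qed (use image_unit_ball_closure in fastforce)

lemma compact_operator_scaleC:
  assumes "compact_operator T"
  shows "compact_operator (\<lambda>x. c *\<^sub>C T x)"
proof (rule compact_operatorI)
  show "compact ((\<lambda>y. c *\<^sub>C y) ` closure (T ` cball 0 1))"
    using compact_operatorD[OF assms]
    by (intro compact_continuous_image continuous_intros
        bounded_linear.continuous_on[OF bounded_bilinear.bounded_linear_right[OF bounded_bilinear_scaleC]])
qed (use image_unit_ball_closure in fastforce)

lemma compact_operator_diff:
  assumes "compact_operator T" "compact_operator S"
  shows "compact_operator (\<lambda>x. T x - S x)"
  using compact_operator_add[OF assms(1) compact_operator_scaleC[OF assms(2), of "-1"]]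
  by (simp add: complex_vector.scale_minus_left scaleC_one)

text \<open>For complex linear \<open>K\<close> on a Hilbert space this is equivalent to \<open>K\<close> being trace class with trace norm
  at most \<open>c\<close> (\<open>nuclear_iff_trace_class\<close>), but sums can be estimated without singular numbers.\<close>

definition nuclear :: "('a::complex_inner \<Rightarrow> 'a) \<Rightarrow> real \<Rightarrow> bool" where
  "nuclear K c \<longleftrightarrow> complex_linear K \<and> compact_operator K \<and> nuclear_bound K c"

lemma nuclear_add: "nuclear K c \<Longrightarrow> nuclear L d \<Longrightarrow> nuclear (\<lambda>x. K x + L x) (c + d)"
  unfolding nuclear_def
  by (auto intro!: compact_operator_add nuclear_bound_add simp: complex_linear_def scaleC_add_right)

lemma nuclear_diff: "nuclear K c \<Longrightarrow> nuclear L d \<Longrightarrow> nuclear (\<lambda>x. K x - L x) (c + d)"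
  unfolding nuclear_def
  by (auto intro!: compact_operator_diff nuclear_bound_diff
      simp: complex_linear_def complex_vector.scale_right_diff_distrib)

lemma nuclear_scaleC: "nuclear K c \<Longrightarrow> nuclear (\<lambda>x. a *\<^sub>C K x) (cmod a * c)"
  unfolding nuclear_def using nuclear_bound_scaleC compact_operator_scaleC
  by (auto simp: complex_linear_def scaleC_add_right complex_vector.scale_left_commute)

lemma nuclear_minus_commute: "nuclear (\<lambda>x. K x - L x) c \<Longrightarrow> nuclear (\<lambda>x. L x - K x) c"
  using nuclear_scaleC[of "\<lambda>x. K x - L x" c "-1"]
  by (simp add: complex_vector.scale_minus_left scaleC_one)

lemma nuclear_trans:
  "nuclear (\<lambda>x. K x - L x) c \<Longrightarrow> nuclear (\<lambda>x. L x - M x) d \<Longrightarrow> nuclear (\<lambda>x. K x - M x) (c + d)"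
  using nuclear_add[of "\<lambda>x. K x - L x" c "\<lambda>x. L x - M x" d] by simp

lemma nuclear_mono: "nuclear K c \<Longrightarrow> c \<le> d \<Longrightarrow> nuclear K d"
  unfolding nuclear_def using nuclear_bound_mono by blast

lemma nuclear_nonneg: "nuclear K c \<Longrightarrow> 0 \<le> c"
  unfolding nuclear_def using nuclear_bound_nonneg by blast

lemma nuclear_norm: "nuclear K c \<Longrightarrow> norm (K x) \<le> c * norm x"
  unfolding nuclear_def using nuclear_bound_norm by blast

lemma nuclear_linear: "nuclear K c \<Longrightarrow> complex_linear K"
  unfolding nuclear_def by blast

lemma nuclear_compact_linear: "nuclear K c \<Longrightarrow> compact_linear K"
  unfolding nuclear_def by unfold_locales auto

lemma nuclear_finite_rank_approximation:
  fixes K :: "'a::complex_hilbert \<Rightarrow> 'a"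
  assumes K: "nuclear K c" and \<epsilon>: "\<epsilon> > 0"
  obtains F where "finite_rank_linear F" "nuclear (\<lambda>x. K x - F x) \<epsilon>"
proof -
  interpret compact_linear K by (rule nuclear_compact_linear[OF K])
  have "summable (linear_singular_number K)"
    using K by (intro summable_singular_numbers(1)[of c]) (simp add: nuclear_def)
  then obtain M where M: "finite M" "orthonormal M" "nuclear_bound (\<lambda>x. K x - K (proj M x)) \<epsilon>"
    using nuclear_approximation \<epsilon> by blast
  have "K (proj M x) = (\<Sum>e\<in>M. cinner x e *\<^sub>C K e)" for x
    by (simp add: proj_def complex_linearD[OF linear])
  then have F: "finite_rank_linear (\<lambda>x. K (proj M x))"
    by (rule finite_rank_linear_sum[OF M(1)])
  have "(\<lambda>x. K x - K (proj M x)) ` cball 0 1 \<subseteq> closure (K ` cball 0 1)"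
  proof safe
    fix x :: 'a assume "x \<in> cball 0 1"
    then have "norm (x - proj M x) \<le> 1" using norm_proj_le(2)[OF M(1,2), of x] by simp
    then have "K (x - proj M x) \<in> closure (K ` cball 0 1)" by (rule image_unit_ball_closure)
    then show "K x - K (proj M x) \<in> closure (K ` cball 0 1)" by (simp add: complex_linearD[OF linear])
  qed
  then have "compact_operator (\<lambda>x. K x - K (proj M x))"
    by (rule compact_operatorI[OF _ compact_operatorD[OF compact]])
  moreover have "complex_linear (\<lambda>x. K x - K (proj M x))"
    using linear F by (simp add: finite_rank_linear_def complex_linear_def
      complex_vector.scale_right_diff_distrib)
  ultimately have "nuclear (\<lambda>x. K x - K (proj M x)) \<epsilon>" using M(3) by (simp add: nuclear_def)
  then show ?thesis using that F by blast
qed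

lemma nuclear_finite_rank_sequence:
  fixes K :: "'a::complex_hilbert \<Rightarrow> 'a"
  assumes K: "nuclear K c"
  obtains Ls where "\<And>m. finite_rank_linear (Ls m)"
    "\<And>m. nuclear (\<lambda>x. Ls m x - K x) (1 / real (Suc m))"
proof -
  have "\<exists>L. finite_rank_linear L \<and> nuclear (\<lambda>x. K x - L x) (1 / real (Suc m))" for m
    using nuclear_finite_rank_approximation[OF K, of "1 / real (Suc m)"] by auto
  then obtain Ls where "\<And>m. finite_rank_linear (Ls m)"
    "\<And>m. nuclear (\<lambda>x. K x - Ls m x) (1 / real (Suc m))" by metis
  then show ?thesis using that nuclear_minus_commute by blast
qed

lemma inverse_Suc_tendsto_0: "(\<lambda>m. 1 / real (Suc m)) \<longlonglongrightarrow> 0"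
  by (rule LIMSEQ_Suc[OF lim_1_over_n])

section \<open>Limits of finite rank determinants\<close>

text \<open>Truncating \<open>E\<close> to maximal singular families at levels tending to \<open>0\<close> gives sums of rank one
  operators, to which the previous estimate applies uniformly.  The ranges of the truncations stay
  in the range of \<open>B \<circ> E\<close>, so their determinants converge.\<close>

lemma finite_rank_det_compose_near_1:
  fixes B E :: "'a::complex_hilbert \<Rightarrow> 'a"
  assumes E: "finite_rank_linear E" "nuclear E \<nu>"
    and B: "complex_linear B" "\<And>x. norm (B x) \<le> \<beta> * norm x" "0 \<le> \<beta>" and small: "\<beta> * \<nu> \<le> 1 / 2"
  shows "cmod (finite_rank_det (\<lambda>x. B (E x)) - 1) \<le> exp (2 * (\<beta> * \<nu>)) - 1"
proof -
  interpret compact_linear E by (rule nuclear_compact_linear[OF E(2)])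
  have "\<exists>M. maximal_singular_family E (1 / real (Suc m)) M" for m
    using maximal_singular_family_ex[of "1 / real (Suc m)"] by auto
  then obtain M where M: "\<And>m. maximal_singular_family E (1 / real (Suc m)) (M m)" by metis
  note MD = maximal_singular_familyD[OF M]
  define L where "L m x = B (E (proj (M m) x))" for m x
  have L_sum: "L m x = (\<Sum>e\<in>M m. cinner x e *\<^sub>C B (E e))" for m x
    by (simp add: L_def proj_def complex_linearD[OF linear] complex_linearD[OF B(1)])
  have lim: "(\<lambda>m. L m x) \<longlonglongrightarrow> B (E x)" for x
  proof (rule Lim_null[THEN iffD2], rule Lim_null_comparison)
    show "\<forall>\<^sub>F m in sequentially. norm (L m x - B (E x)) \<le> \<beta> * norm x * (1 / real (Suc m))"
    proof (intro always_eventually allI)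
      fix m
      have "norm (L m x - B (E x)) = norm (B (E x - E (proj (M m) x)))"
        by (simp add: L_def complex_linearD[OF B(1)] norm_minus_commute)
      also have "\<dots> \<le> \<beta> * norm (E x - E (proj (M m) x))" by (rule B(2))
      also have "\<dots> \<le> \<beta> * (1 / real (Suc m) * norm x)"
        using norm_truncation_le[OF M] B(3) by (intro mult_left_mono) auto
      finally show "norm (L m x - B (E x)) \<le> \<beta> * norm x * (1 / real (Suc m))"
        by (simp add: mult_ac)
    qed
    show "(\<lambda>m. \<beta> * norm x * (1 / real (Suc m))) \<longlonglongrightarrow> 0"
      by (intro tendsto_mult_right_zero LIMSEQ_Suc[OF lim_1_over_n])
  qed
  have BE: "finite_rank_linear (\<lambda>x. B (E x))" by (rule finite_rank_linear_compose[OF B(1) E(1)])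
  obtain fs where fs: "orthonormal_basis fs (cspan (set fs))"
    "range (\<lambda>x. B (E x)) \<subseteq> cspan (set fs)"
    using finite_rank_basis[OF BE] .
  have fin: "finite_rank_linear (L m)" for m by (rule finite_rank_linear_sum[OF MD(2) L_sum])
  have "range (L m) \<subseteq> cspan (set fs)" for m using fs(2) by (auto simp: L_def)
  then have "(\<lambda>m. finite_rank_det (L m)) \<longlonglongrightarrow> finite_rank_det (\<lambda>x. B (E x))"
    using fin BE fs(1,2) lim
    by (intro finite_rank_det_tendsto[of L "\<lambda>x. B (E x)" fs "cspan (set fs)"])
       (auto simp: finite_rank_linear_def)
  then have "(\<lambda>m. cmod (finite_rank_det (L m) - 1)) \<longlonglongrightarrow> cmod (finite_rank_det (\<lambda>x. B (E x)) - 1)"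
    by (intro tendsto_intros)
  moreover have "cmod (finite_rank_det (L m) - 1) \<le> exp (2 * (\<beta> * \<nu>)) - 1" for m
  proof (rule finite_rank_det_sum_near_1_exp[OF MD(2) L_sum _ small])
    have "(\<Sum>e\<in>M m. norm e * norm (B (E e))) \<le> (\<Sum>e\<in>M m. \<beta> * norm (E e))"
      using orthonormal_norm[OF MD(3)] B(2) by (intro sum_mono) auto
    also have "\<dots> \<le> \<beta> * \<nu>"
      unfolding sum_distrib_left[symmetric]
      using E(2) B(3) MD(1) by (intro mult_left_mono sum_singular_family_le_nuclear_bound)
        (auto simp: nuclear_def)
    finally show "(\<Sum>e\<in>M m. norm e * norm (B (E e))) \<le> \<beta> * \<nu>" .
  qed
  ultimately show ?thesis by (intro Lim_bounded[of _ _ 0]) auto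
qed

lemma exp_minus_1_le: "exp x - 1 \<le> 2 * x" if "0 \<le> x" "x \<le> 1" for x :: real
proof -
  have "exp x \<le> 1 + x + x\<^sup>2" using that by (intro exp_bound)
  moreover have "x\<^sup>2 \<le> x * 1" unfolding power2_eq_square using that by (intro mult_left_mono)
  ultimately show ?thesis by simp
qed

text \<open>With \<open>E\<^sub>m = K\<^sub>m - F\<close> and \<open>J\<^sub>m = (I + E\<^sub>m)\<^sup>-\<^sup>1\<close> one has \<open>I + K\<^sub>m = (I + F J\<^sub>m) (I + E\<^sub>m)\<close>.  The determinants of
  the first factors converge because all ranges lie in that of \<open>F\<close>.  Those of the second factors
  are Cauchy because of \<open>I + E\<^sub>m = (I + E\<^sub>n) (I + J\<^sub>n (E\<^sub>m - E\<^sub>n))\<close>, and stay close to \<open>1\<close>.\<close>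

lemma finite_rank_det_limit_aux:
  fixes K F :: "'a::complex_hilbert \<Rightarrow> 'a"
  assumes F: "finite_rank_linear F" and KF: "nuclear (\<lambda>x. K x - F x) (1 / 16)" and K: "nuclear K c"
    and Ks: "\<And>m. finite_rank_linear (Ks m)" "\<And>m. nuclear (\<lambda>x. Ks m x - K x) (\<delta> m)"
    and \<delta>: "\<delta> \<longlonglongrightarrow> 0" "\<And>m. \<delta> m \<le> 1 / 16"
  shows "\<exists>d. cmod (d - 1) \<le> 1 / 2 \<and> (\<lambda>m. finite_rank_det (Ks m)) \<longlonglongrightarrow>
    finite_rank_det (\<lambda>x. F (perturbation_inverse (\<lambda>x. K x - F x) x)) * d"
proof -
  let ?J = "perturbation_inverse (\<lambda>x. K x - F x)"
  define E where "E m x = Ks m x - F x" for m x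
  define Jm where "Jm m = perturbation_inverse (E m)" for m
  have \<delta>0: "0 \<le> \<delta> m" for m using nuclear_nonneg[OF Ks(2)] .
  have E: "nuclear (E m) (1 / 8)" for m
    unfolding E_def by (rule nuclear_mono[OF nuclear_trans[OF Ks(2) KF]]) (use \<delta>(2)[of m] in simp)
  have finE: "finite_rank_linear (E m)" for m
    unfolding E_def by (intro finite_rank_linear_diff Ks F)
  note J = perturbation_inverse[OF nuclear_linear[OF KF] nuclear_norm[OF KF], simplified]
  note Jm = perturbation_inverse[OF nuclear_linear[OF E] nuclear_norm[OF E], simplified, folded Jm_def]
  note linF = F[unfolded finite_rank_linear_def, THEN conjunct1]
  have split: "finite_rank_det (Ks m) = finite_rank_det (\<lambda>x. F (Jm m x)) * finite_rank_det (E m)" for m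
  proof (rule finite_rank_det_mult[OF finite_rank_linear_compose_right[OF F Jm(3)] finE])
    fix x
    have "F (Jm m x) + F (Jm m (E m x)) = F x"
      by (simp only: Jm(1) flip: complex_linearD(1)[OF linF] complex_linearD(1)[OF Jm(3)])
    moreover have "Ks m x = F x + E m x" by (simp add: E_def)
    ultimately show "Ks m x = F (Jm m x) + E m x + F (Jm m (E m x))" by (simp add: algebra_simps)
  qed
  have limF: "(\<lambda>m. finite_rank_det (\<lambda>x. F (Jm m x))) \<longlonglongrightarrow> finite_rank_det (\<lambda>x. F (?J x))"
  proof -
    obtain fs where fs: "orthonormal_basis fs (cspan (set fs))"
      "range F \<subseteq> cspan (set fs)"
      using finite_rank_basis[OF F] .
    have F_bound: "norm (F x) \<le> (c + 1 / 16) * norm x" for x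
      using nuclear_norm[OF nuclear_diff[OF K KF]] by simp
    have "(\<lambda>m. F (Jm m x)) \<longlonglongrightarrow> F (?J x)" for x
    proof (rule Lim_null[THEN iffD2], rule Lim_null_comparison)
      show "\<forall>\<^sub>F m in sequentially. norm (F (Jm m x) - F (?J x)) \<le> (c + 1 / 16) * (2 * norm (?J x)) * \<delta> m"
      proof (intro always_eventually allI)
        fix m
        have "Jm m x - ?J x = Jm m (x - (?J x + E m (?J x)))"
          by (simp only: complex_linearD(5)[OF Jm(3)] Jm(1))
        also have "x - (?J x + E m (?J x)) = - (Ks m (?J x) - K (?J x))"
          using J(2)[of x] by (simp add: E_def algebra_simps)
        finally have "norm (Jm m x - ?J x) \<le> 2 * norm (Ks m (?J x) - K (?J x))"
          using Jm(4)[of m "- (Ks m (?J x) - K (?J x))"] by (simp only: norm_minus_cancel)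
        also have "\<dots> \<le> 2 * (\<delta> m * norm (?J x))"
          using nuclear_norm[OF Ks(2)[of m], of "?J x"] by simp
        finally have "norm (Jm m x - ?J x) \<le> 2 * (\<delta> m * norm (?J x))" .
        then have "(c + 1 / 16) * norm (Jm m x - ?J x) \<le> (c + 1 / 16) * (2 * (\<delta> m * norm (?J x)))"
          using nuclear_nonneg[OF K] by (intro mult_left_mono) auto
        then show "norm (F (Jm m x) - F (?J x)) \<le> (c + 1 / 16) * (2 * norm (?J x)) * \<delta> m"
          using F_bound[of "Jm m x - ?J x"] by (simp add: complex_linearD[OF linF] mult_ac)
      qed
      show "(\<lambda>m. (c + 1 / 16) * (2 * norm (?J x)) * \<delta> m) \<longlonglongrightarrow> 0"
        using \<delta>(1) by (rule tendsto_mult_right_zero)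
    qed
    then show ?thesis
      using finite_rank_linear_compose_right[OF F Jm(3)] finite_rank_linear_compose_right[OF F J(3)] fs(1,2)
      by (intro finite_rank_det_tendsto[of _ _ fs "cspan (set fs)"])
         (auto simp: finite_rank_linear_def)
  qed
  have near_1: "cmod (finite_rank_det (E m) - 1) \<le> 1 / 2" for m
  proof -
    have "cmod (finite_rank_det (\<lambda>x. E m x) - 1) \<le> exp (2 * (1 * (1 / 8))) - 1"
      by (rule finite_rank_det_compose_near_1[OF finE E, of "\<lambda>x. x"]) (auto simp: complex_linear_def)
    also have "\<dots> \<le> 1 / 2" using exp_minus_1_le[of "1 / 4"] by simp
    finally show ?thesis .
  qed
  have diff: "cmod (finite_rank_det (E m) - finite_rank_det (E n)) \<le> 16 * (\<delta> m + \<delta> n)" for m n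
  proof -
    define L where "L x = Jm n (E m x - E n x)" for x
    have D: "nuclear (\<lambda>x. E m x - E n x) (\<delta> m + \<delta> n)"
      using nuclear_trans[OF Ks(2) nuclear_minus_commute[OF Ks(2)]] by (simp add: E_def)
    have finD: "finite_rank_linear (\<lambda>x. E m x - E n x)" by (intro finite_rank_linear_diff finE)
    have "L x + E n (L x) = E m x - E n x" for x unfolding L_def by (rule Jm(2))
    then have "E m x = E n x + L x + E n (L x)" for x by (simp add: algebra_simps)
    then have det: "finite_rank_det (E m) = finite_rank_det (E n) * finite_rank_det L"
      unfolding L_def
      by (intro finite_rank_det_mult finE finite_rank_linear_compose[OF Jm(3) finD])
    have "cmod (finite_rank_det L - 1) \<le> exp (2 * (2 * (\<delta> m + \<delta> n))) - 1"
      unfolding L_def using \<delta>(2)[of m] \<delta>(2)[of n]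
      by (intro finite_rank_det_compose_near_1[OF finD D Jm(3) Jm(4)]) auto
    also have "\<dots> \<le> 8 * (\<delta> m + \<delta> n)"
      using exp_minus_1_le[of "2 * (2 * (\<delta> m + \<delta> n))"] \<delta>(2)[of m] \<delta>(2)[of n] \<delta>0[of m] \<delta>0[of n] by simp
    finally have L1: "cmod (finite_rank_det L - 1) \<le> 8 * (\<delta> m + \<delta> n)" .
    have E2: "cmod (finite_rank_det (E n)) \<le> 2"
      using near_1[of n] norm_triangle_sub[of "finite_rank_det (E n)" 1] by simp
    have "finite_rank_det (E m) - finite_rank_det (E n)
        = finite_rank_det (E n) * (finite_rank_det L - 1)"
      by (simp add: det algebra_simps)
    then show ?thesis using mult_mono[OF E2 L1] by (simp add: norm_mult)
  qed
  have "Cauchy (\<lambda>m. finite_rank_det (E m))"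
  proof (rule metric_CauchyI)
    fix e :: real assume e: "e > 0"
    then have "\<forall>\<^sub>F m in sequentially. \<delta> m < e / 32" using \<delta>(1) by (intro order_tendstoD(2)) auto
    then obtain N where N: "\<And>m. m \<ge> N \<Longrightarrow> \<delta> m < e / 32" by (auto simp: eventually_sequentially)
    have "dist (finite_rank_det (E m)) (finite_rank_det (E n)) < e" if "m \<ge> N" "n \<ge> N" for m n
    proof -
      have "16 * (\<delta> m + \<delta> n) < e" using N[OF that(1)] N[OF that(2)] by simp
      then show ?thesis unfolding dist_norm by (rule le_less_trans[OF diff])
    qed
    then show "\<exists>M. \<forall>m\<ge>M. \<forall>n\<ge>M. dist (finite_rank_det (E m)) (finite_rank_det (E n)) < e" by blast
  qed
  then obtain d where d: "(\<lambda>m. finite_rank_det (E m)) \<longlonglongrightarrow> d"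
    using Cauchy_convergent convergent_def by blast
  have "(\<lambda>m. cmod (finite_rank_det (E m) - 1)) \<longlonglongrightarrow> cmod (d - 1)" by (intro tendsto_intros d)
  then have "cmod (d - 1) \<le> 1 / 2" by (rule Lim_bounded[of _ _ 0]) (use near_1 in auto)
  moreover have "(\<lambda>m. finite_rank_det (Ks m)) \<longlonglongrightarrow> finite_rank_det (\<lambda>x. F (?J x)) * d"
    unfolding split by (intro tendsto_mult limF d)
  ultimately show ?thesis by blast
qed

lemma finite_rank_det_limit:
  fixes K F :: "'a::complex_hilbert \<Rightarrow> 'a"
  assumes F: "finite_rank_linear F" and KF: "nuclear (\<lambda>x. K x - F x) (1 / 16)" and K: "nuclear K c"
    and Ks: "\<And>m. finite_rank_linear (Ks m)" "\<And>m. nuclear (\<lambda>x. Ks m x - K x) (\<delta> m)"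
    and \<delta>: "\<delta> \<longlonglongrightarrow> 0"
  shows "\<exists>d. cmod (d - 1) \<le> 1 / 2 \<and> (\<lambda>m. finite_rank_det (Ks m)) \<longlonglongrightarrow>
    finite_rank_det (\<lambda>x. F (perturbation_inverse (\<lambda>x. K x - F x) x)) * d"
proof -
  have "\<forall>\<^sub>F m in sequentially. \<delta> m < 1 / 16" using \<delta> by (intro order_tendstoD(2)) auto
  then obtain N where N: "\<And>m. m \<ge> N \<Longrightarrow> \<delta> m < 1 / 16" by (auto simp: eventually_sequentially)
  have "\<exists>d. cmod (d - 1) \<le> 1 / 2 \<and> (\<lambda>m. finite_rank_det (Ks (m + N))) \<longlonglongrightarrow>
    finite_rank_det (\<lambda>x. F (perturbation_inverse (\<lambda>x. K x - F x) x)) * d"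
    using N by (intro finite_rank_det_limit_aux[OF F KF K Ks LIMSEQ_ignore_initial_segment[OF \<delta>]])
      (auto intro: less_imp_le)
  then obtain d where d: "cmod (d - 1) \<le> 1 / 2" "(\<lambda>m. finite_rank_det (Ks (m + N))) \<longlonglongrightarrow>
    finite_rank_det (\<lambda>x. F (perturbation_inverse (\<lambda>x. K x - F x) x)) * d" by blast
  show ?thesis using d(1) LIMSEQ_offset[OF d(2)] by (intro exI[of _ d] conjI)
qed

text \<open>Two approximating sequences have the same limit because their interleaving also converges.
  The limit is \<open>det (I + F J)\<close> times a nonzero number, where \<open>J = (I + K - F)\<^sup>-\<^sup>1\<close>, and
  \<open>I + K = (I + F J) (I + K - F)\<close> with invertible second factor; so it vanishes exactly when
  \<open>I + K\<close> has a kernel.\<close>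

lemma finite_rank_det_limit_exists:
  fixes K :: "'a::complex_hilbert \<Rightarrow> 'a"
  assumes K: "nuclear K c"
  obtains d where "d = 0 \<longleftrightarrow> (\<exists>x. x \<noteq> 0 \<and> x + K x = 0)"
    and "\<And>Ks \<delta>. (\<And>m. finite_rank_linear (Ks m)) \<Longrightarrow> (\<And>m. nuclear (\<lambda>x. Ks m x - K x) (\<delta> m)) \<Longrightarrow>
      \<delta> \<longlonglongrightarrow> 0 \<Longrightarrow> (\<lambda>m. finite_rank_det (Ks m)) \<longlonglongrightarrow> d"
proof -
  obtain F where F: "finite_rank_linear F" "nuclear (\<lambda>x. K x - F x) (1 / 16)"
    using nuclear_finite_rank_approximation[OF K, of "1 / 16"] by auto
  let ?E = "\<lambda>x. K x - F x"
  let ?J = "perturbation_inverse ?E"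
  let ?D = "finite_rank_det (\<lambda>x. F (?J x))"
  note J = perturbation_inverse[OF nuclear_linear[OF F(2)] nuclear_norm[OF F(2)], simplified]
  note lim = finite_rank_det_limit[OF F K]
  obtain Ls where Ls: "\<And>m. finite_rank_linear (Ls m)"
    "\<And>m. nuclear (\<lambda>x. Ls m x - K x) (1 / real (Suc m))" using nuclear_finite_rank_sequence[OF K] by blast
  obtain d where d: "cmod (d - 1) \<le> 1 / 2" "(\<lambda>m. finite_rank_det (Ls m)) \<longlonglongrightarrow> ?D * d"
    using lim[OF Ls inverse_Suc_tendsto_0] by blast
  have "d \<noteq> 0" using d(1) by auto
  then have "?D * d = 0 \<longleftrightarrow> (\<exists>y. y \<noteq> 0 \<and> y + F (?J y) = 0)"
    using finite_rank_det_eq_0_iff[OF finite_rank_linear_compose_right[OF F(1) J(3)]] by simp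
  also have "\<dots> \<longleftrightarrow> (\<exists>x. x \<noteq> 0 \<and> x + K x = 0)"
  proof
    assume "\<exists>y. y \<noteq> 0 \<and> y + F (?J y) = 0"
    then obtain y where y: "y \<noteq> 0" "y + F (?J y) = 0" by blast
    have "?J y \<noteq> 0" using J(2)[of y] y(1) complex_linearD(3)[OF nuclear_linear[OF F(2)]] by auto
    moreover have "?J y + K (?J y) = 0" using J(2)[of y] y(2) by (simp add: algebra_simps)
    ultimately show "\<exists>x. x \<noteq> 0 \<and> x + K x = 0" by blast
  next
    assume "\<exists>x. x \<noteq> 0 \<and> x + K x = 0"
    then obtain x where x: "x \<noteq> 0" "x + K x = 0" by blast
    let ?y = "x + ?E x"
    have "?y \<noteq> 0" using J(1)[of x] x(1) complex_linearD(3)[OF J(3)] by auto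
    moreover have "?y + F (?J ?y) = 0" using x(2) by (simp add: J(1) del: add_diff_eq)
    ultimately show "\<exists>y. y \<noteq> 0 \<and> y + F (?J y) = 0" by blast
  qed
  finally have zero: "?D * d = 0 \<longleftrightarrow> (\<exists>x. x \<noteq> 0 \<and> x + K x = 0)" .
  have "(\<lambda>m. finite_rank_det (Ks m)) \<longlonglongrightarrow> ?D * d"
    if Ks: "\<And>m. finite_rank_linear (Ks m)" "\<And>m. nuclear (\<lambda>x. Ks m x - K x) (\<delta> m)" "\<delta> \<longlonglongrightarrow> 0"
    for Ks \<delta>
  proof -
    define M where "M n = (if even n then Ls (n div 2) else Ks (n div 2))" for n :: nat
    define \<eta> where "\<eta> n = 1 / real (Suc (n div 2)) + \<delta> (n div 2)" for n :: nat
    have "filterlim (\<lambda>n::nat. n div 2) sequentially sequentially"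
      unfolding filterlim_at_top eventually_sequentially
      by (metis div_le_mono nonzero_mult_div_cancel_left zero_neq_numeral)
    then have "\<eta> \<longlonglongrightarrow> 0 + 0"
      unfolding \<eta>_def by (intro tendsto_add filterlim_compose[OF inverse_Suc_tendsto_0] filterlim_compose[OF Ks(3)])
    moreover have "nuclear (\<lambda>x. M n x - K x) (\<eta> n)" for n
    proof (cases "even n")
      case True
      then show ?thesis using nuclear_mono[OF Ls(2)[of "n div 2"], of "\<eta> n"] nuclear_nonneg[OF Ks(2)]
        by (simp add: M_def \<eta>_def)
    next
      case False
      then show ?thesis using nuclear_mono[OF Ks(2)[of "n div 2"], of "\<eta> n"]
        by (simp add: M_def \<eta>_def)
    qed
    moreover have "finite_rank_linear (M n)" for n by (simp add: M_def Ls Ks)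
    ultimately obtain d' where d': "(\<lambda>n. finite_rank_det (M n)) \<longlonglongrightarrow> ?D * d'"
      using lim[of M \<eta>] by auto
    have "strict_mono (\<lambda>n::nat. 2 * n)" "strict_mono (\<lambda>n::nat. Suc (2 * n))"
      by (auto simp: strict_mono_def)
    from LIMSEQ_subseq_LIMSEQ[OF d' this(1)] LIMSEQ_subseq_LIMSEQ[OF d' this(2)]
    have "(\<lambda>n. finite_rank_det (Ls n)) \<longlonglongrightarrow> ?D * d'" "(\<lambda>n. finite_rank_det (Ks n)) \<longlonglongrightarrow> ?D * d'"
      by (simp_all add: o_def M_def)
    then show ?thesis using LIMSEQ_unique[OF d(2)] by metis
  qed
  then show ?thesis using that zero by blast
qed

section \<open>Trace class operators and Fredholm determinants\<close>

lemma compact_operator_zero: "compact_operator (\<lambda>_. 0)"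
  by (rule compact_operatorI[of _ "{0}"]) auto

lemma scaleC_half: "(1/2) *\<^sub>C (x + x) = (x::'a::complex_inner)"
  by (simp add: scaleC_add_right scaleC_one flip: scaleC_add_left)

lemma linear_part_eqI:
  assumes C: "complex_linear C" and A: "antilinear A" and R: "\<And>x. R x = C x + A x"
  shows "linear_part R = C" "antilinear_part R = A"
proof -
  have Ci: "\<i> *\<^sub>C C (\<i> *\<^sub>C x) = - C x" for x
    by (simp add: complex_linearD[OF C] scaleC_scaleC complex_vector.scale_minus_left scaleC_one)
  have Ai: "\<i> *\<^sub>C A (\<i> *\<^sub>C x) = A x" for x
    using A by (simp add: antilinear_def scaleC_scaleC scaleC_one)
  have "R x - \<i> *\<^sub>C R (\<i> *\<^sub>C x) = C x + C x" "R x + \<i> *\<^sub>C R (\<i> *\<^sub>C x) = A x + A x" for x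
    by (simp_all add: R scaleC_add_right Ci Ai)
  then show "linear_part R = C" "antilinear_part R = A"
    by (simp_all add: fun_eq_iff linear_part_def antilinear_part_def scaleC_half)
qed

lemma linear_part_complex_linear:
  assumes "complex_linear K"
  shows "linear_part K = K" "antilinear_part K = (\<lambda>_. 0)"
  by (rule linear_part_eqI[OF assms]; simp add: antilinear_def complex_vector.scale_zero_right)+

lemma antilinear_singular_number_zero: "antilinear_singular_number (\<lambda>_. 0) = (\<lambda>_. 0)"
proof
  fix j
  have "antilinear_adjoint (\<lambda>_. 0) = (\<lambda>_::'a. 0::'a)"
    by (rule antilinear_adjoint_eqI) (simp add: cinner_zero)
  then have P: "antilinear_adjoint (\<lambda>_. 0) \<circ> (\<lambda>_. 0) = (\<lambda>_::'a. 0::'a)" by (simp add: o_def)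
  have "\<not> is_eigenvalue (\<lambda>_. 0::'a) (complex_of_real u)" if "u > 0" for u
    using that by (auto simp: is_eigenvalue_def complex_vector.scale_eq_0_iff)
  then have E: "{u. 0 < u \<and> is_eigenvalue (\<lambda>_. 0::'a) (complex_of_real u)
      \<and> j < eigenvalue_count (\<lambda>_. 0::'a) u} = {}" by blast
  show "antilinear_singular_number (\<lambda>_. 0::'a) j = 0"
    unfolding antilinear_singular_number_def ordered_eigenvalue_def P E by simp
qed

lemma trace_class_complex_linear:
  assumes "complex_linear K"
  shows "trace_class K \<longleftrightarrow> compact_operator K \<and> summable (linear_singular_number K)"
    and "trace_norm K = suminf (linear_singular_number K)"
proof -
  have "real_linear K" by (simp add: real_linear_def complex_linearD[OF assms])
  then show "trace_class K \<longleftrightarrow> compact_operator K \<and> summable (linear_singular_number K)"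
    by (simp add: trace_class_def linear_part_complex_linear[OF assms] compact_operator_zero
        antilinear_singular_number_zero)
  show "trace_norm K = suminf (linear_singular_number K)"
    by (simp add: trace_norm_def linear_part_complex_linear[OF assms] antilinear_singular_number_zero)
qed

lemma nuclear_suminf:
  fixes K :: "'a::complex_hilbert \<Rightarrow> 'a"
  assumes "complex_linear K" "compact_operator K" "summable (linear_singular_number K)"
  shows "nuclear K (suminf (linear_singular_number K))"
proof -
  interpret compact_linear K using assms by unfold_locales
  show ?thesis using assms nuclear_bound_suminf by (simp add: nuclear_def)
qed

lemma nuclear_iff_trace_class:
  fixes K :: "'a::complex_hilbert \<Rightarrow> 'a"
  assumes K: "complex_linear K"
  shows "nuclear K c \<longleftrightarrow> trace_class K \<and> trace_norm K \<le> c"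
proof
  assume n: "nuclear K c"
  interpret compact_linear K by (rule nuclear_compact_linear[OF n])
  show "trace_class K \<and> trace_norm K \<le> c"
    using n summable_singular_numbers[of c] compact
    by (simp add: trace_class_complex_linear[OF K] nuclear_def)
next
  assume "trace_class K \<and> trace_norm K \<le> c"
  then show "nuclear K c"
    using nuclear_mono[OF nuclear_suminf[OF K]] by (simp add: trace_class_complex_linear[OF K])
qed

lemma trace_norm_convergent_iff:
  fixes K :: "'a::complex_hilbert \<Rightarrow> 'a"
  assumes "\<And>n. complex_linear (Ks n)" "complex_linear K"
  shows "trace_norm_convergent Ks K \<longleftrightarrow>
    (\<exists>\<delta>. \<delta> \<longlonglongrightarrow> 0 \<and> (\<forall>n\<ge>1. nuclear (\<lambda>x. Ks n x - K x) (\<delta> n)))"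
proof -
  have lin: "complex_linear (\<lambda>x. Ks n x - K x)" for n
    using assms by (simp add: complex_linear_def complex_vector.scale_right_diff_distrib)
  note iff = nuclear_iff_trace_class[OF lin]
  show ?thesis
  proof
    assume "trace_norm_convergent Ks K"
    then show "\<exists>\<delta>. \<delta> \<longlonglongrightarrow> 0 \<and> (\<forall>n\<ge>1. nuclear (\<lambda>x. Ks n x - K x) (\<delta> n))"
      unfolding trace_norm_convergent_def iff
      by (intro exI[of _ "\<lambda>n. trace_norm (\<lambda>x. Ks n x - K x)"]) simp
  next
    assume "\<exists>\<delta>. \<delta> \<longlonglongrightarrow> 0 \<and> (\<forall>n\<ge>1. nuclear (\<lambda>x. Ks n x - K x) (\<delta> n))"
    then obtain \<delta> where \<delta>: "\<delta> \<longlonglongrightarrow> 0" "\<And>n. n \<ge> 1 \<Longrightarrow> nuclear (\<lambda>x. Ks n x - K x) (\<delta> n)" by blast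
    have tc: "trace_class (\<lambda>x. Ks n x - K x)" "trace_norm (\<lambda>x. Ks n x - K x) \<le> \<delta> n"
      if "n \<ge> 1" for n using \<delta>(2)[OF that] by (auto simp: iff)
    have "0 \<le> trace_norm (\<lambda>x. Ks n x - K x)" if "n \<ge> 1" for n
      by (rule nuclear_nonneg) (use tc(1)[OF that] iff in auto)
    then have "(\<lambda>n. trace_norm (\<lambda>x. Ks n x - K x)) \<longlonglongrightarrow> 0"
      using tc(2) by (intro tendsto_sandwich[OF _ _ tendsto_const \<delta>(1)])
        (auto simp: eventually_sequentially)
    then show "trace_norm_convergent Ks K" using tc(1) by (simp add: trace_norm_convergent_def)
  qed
qed

lemma fredholm_det:
  fixes K :: "'a::complex_hilbert \<Rightarrow> 'a"
  assumes K: "nuclear K c"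
  shows fredholm_det_eq_0_iff: "fredholm_det (\<lambda>x. x + K x) = 0 \<longleftrightarrow> (\<exists>x. x \<noteq> 0 \<and> x + K x = 0)"
    and fredholm_det_limit: "\<And>Ks \<delta>. (\<And>m. finite_rank_linear (Ks m)) \<Longrightarrow>
      (\<And>m. nuclear (\<lambda>x. Ks m x - K x) (\<delta> m)) \<Longrightarrow> \<delta> \<longlonglongrightarrow> 0 \<Longrightarrow>
      (\<lambda>m. finite_rank_det (Ks m)) \<longlonglongrightarrow> fredholm_det (\<lambda>x. x + K x)"
proof -
  obtain d where d: "d = 0 \<longleftrightarrow> (\<exists>x. x \<noteq> 0 \<and> x + K x = 0)"
    and lim: "\<And>Ks \<delta>. (\<And>m. finite_rank_linear (Ks m)) \<Longrightarrow> (\<And>m. nuclear (\<lambda>x. Ks m x - K x) (\<delta> m)) \<Longrightarrow>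
      \<delta> \<longlonglongrightarrow> 0 \<Longrightarrow> (\<lambda>m. finite_rank_det (Ks m)) \<longlonglongrightarrow> d"
    using finite_rank_det_limit_exists[OF K] by blast
  let ?P = "\<lambda>d. \<forall>Ks. (\<forall>m. complex_linear (Ks m) \<and> finite_rank (Ks m)) \<longrightarrow>
        trace_norm_convergent Ks (\<lambda>x. x + K x - x) \<longrightarrow> (\<lambda>m. finite_rank_det (Ks m)) \<longlonglongrightarrow> d"
  have simp_K: "(\<lambda>x. x + K x - x) = K" by simp
  obtain Ls where Ls: "\<And>m. finite_rank_linear (Ls m)"
    "\<And>m. nuclear (\<lambda>x. Ls m x - K x) (1 / real (Suc m))" using nuclear_finite_rank_sequence[OF K] by blast
  have "trace_norm_convergent Ls K"
    using Ls inverse_Suc_tendsto_0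
    by (subst trace_norm_convergent_iff) (auto simp: finite_rank_linear_def nuclear_linear[OF K])
  then have unique: "d' = d" if "?P d'" for d'
    using that lim[OF Ls inverse_Suc_tendsto_0] Ls(1) LIMSEQ_unique
    unfolding simp_K finite_rank_linear_iff by blast
  have "?P d"
  proof (intro allI impI)
    fix Ks :: "nat \<Rightarrow> 'a \<Rightarrow> 'a"
    assume Ks: "\<forall>m. complex_linear (Ks m) \<and> finite_rank (Ks m)"
      and "trace_norm_convergent Ks (\<lambda>x. x + K x - x)"
    then obtain \<delta> where \<delta>: "\<delta> \<longlonglongrightarrow> 0" "\<And>n. n \<ge> 1 \<Longrightarrow> nuclear (\<lambda>x. Ks n x - K x) (\<delta> n)"
      unfolding simp_K using nuclear_linear[OF K] by (subst (asm) trace_norm_convergent_iff) auto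
    \<comment> \<open>Convergence in trace norm says nothing about the term with index \<open>0\<close>.\<close>
    have "(\<lambda>m. finite_rank_det (Ks (Suc m))) \<longlonglongrightarrow> d"
      using Ks \<delta> by (intro lim[of _ "\<lambda>m. \<delta> (Suc m)"]) (auto simp: finite_rank_linear_iff LIMSEQ_Suc)
    then show "(\<lambda>m. finite_rank_det (Ks m)) \<longlonglongrightarrow> d" by (rule LIMSEQ_imp_Suc)
  qed
  then have fd: "fredholm_det (\<lambda>x. x + K x) = d"
    unfolding fredholm_det_def by (intro the_equality unique)
  show "fredholm_det (\<lambda>x. x + K x) = 0 \<longleftrightarrow> (\<exists>x. x \<noteq> 0 \<and> x + K x = 0)"
    unfolding fd by (rule d)
  show "\<And>Ks \<delta>. (\<And>m. finite_rank_linear (Ks m)) \<Longrightarrow> (\<And>m. nuclear (\<lambda>x. Ks m x - K x) (\<delta> m)) \<Longrightarrow>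
      \<delta> \<longlonglongrightarrow> 0 \<Longrightarrow> (\<lambda>m. finite_rank_det (Ks m)) \<longlonglongrightarrow> fredholm_det (\<lambda>x. x + K x)"
    unfolding fd by (rule lim)
qed

text \<open>Choose finite rank \<open>F i\<close> close to \<open>Ks i\<close> in trace norm and in determinant; then \<open>F i\<close> approximates \<open>K\<close>.\<close>

lemma fredholm_det_tendsto:
  fixes K :: "'a::complex_hilbert \<Rightarrow> 'a"
  assumes K: "nuclear K c" and Ks: "\<And>i. nuclear (\<lambda>x. Ks i x - K x) (\<delta> i)" and \<delta>: "\<delta> \<longlonglongrightarrow> 0"
  shows "(\<lambda>i. fredholm_det (\<lambda>x. x + Ks i x)) \<longlonglongrightarrow> fredholm_det (\<lambda>x. x + K x)"
proof -
  let ?d = "\<lambda>i. fredholm_det (\<lambda>x. x + Ks i x)" and ?r = "\<lambda>i. 1 / real (Suc i)"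
  have Ks': "nuclear (Ks i) (\<delta> i + c)" for i using nuclear_add[OF Ks[of i] K] by simp
  have "\<exists>F. finite_rank_linear F \<and> nuclear (\<lambda>x. F x - Ks i x) (?r i) \<and>
      cmod (finite_rank_det F - ?d i) \<le> ?r i" for i
  proof -
    obtain Ls where Ls: "\<And>m. finite_rank_linear (Ls m)"
      "\<And>m. nuclear (\<lambda>x. Ls m x - Ks i x) (?r m)" using nuclear_finite_rank_sequence[OF Ks'[of i]] by blast
    have "(\<lambda>m. finite_rank_det (Ls m)) \<longlonglongrightarrow> ?d i"
      by (rule fredholm_det_limit[OF Ks' Ls inverse_Suc_tendsto_0])
    from LIMSEQ_D[OF this, of "?r i"] obtain N
      where N: "\<And>m. m \<ge> N \<Longrightarrow> cmod (finite_rank_det (Ls m) - ?d i) < ?r i" by auto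
    define m where "m = max N i"
    have "?r m \<le> ?r i" by (simp add: m_def frac_le)
    then have "nuclear (\<lambda>x. Ls m x - Ks i x) (?r i)"
      using nuclear_mono[OF Ls(2)] by blast
    then show ?thesis using Ls(1) N[of m] by (intro exI[of _ "Ls m"]) (simp add: m_def less_imp_le)
  qed
  then obtain F where F: "\<And>i. finite_rank_linear (F i)" "\<And>i. nuclear (\<lambda>x. F i x - Ks i x) (?r i)"
    "\<And>i. cmod (finite_rank_det (F i) - ?d i) \<le> ?r i" by metis
  have "(\<lambda>i. finite_rank_det (F i)) \<longlonglongrightarrow> fredholm_det (\<lambda>x. x + K x)"
  proof (rule fredholm_det_limit[OF K F(1) nuclear_trans[OF F(2) Ks]])
    show "(\<lambda>i. ?r i + \<delta> i) \<longlonglongrightarrow> 0" using tendsto_add[OF inverse_Suc_tendsto_0 \<delta>] by simp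
  qed
  moreover have "(\<lambda>i. finite_rank_det (F i) - ?d i) \<longlonglongrightarrow> 0"
    by (rule Lim_null_comparison[OF always_eventually inverse_Suc_tendsto_0]) (use F(3) in blast)
  ultimately have "(\<lambda>i. finite_rank_det (F i) - (finite_rank_det (F i) - ?d i))
      \<longlonglongrightarrow> fredholm_det (\<lambda>x. x + K x) - 0"
    by (rule tendsto_diff)
  then show ?thesis by simp
qed

section \<open>Complexification\<close>

lemma scaleC_decompose: "c *\<^sub>C x = Re c *\<^sub>R x + Im c *\<^sub>R (\<i> *\<^sub>C (x::'a::complex_inner))"
proof -
  have "c *\<^sub>C x = (complex_of_real (Re c) + complex_of_real (Im c) * \<i>) *\<^sub>C x"
    by (simp add: complex_eq mult.commute flip: complex_eq)
  then show ?thesis by (simp only: scaleC_add_left scaleC_complex_of_real flip: scaleC_scaleC)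
qed

lemma real_linearD:
  assumes "real_linear R"
  shows "R (x + y) = R x + R y" "R (r *\<^sub>R x) = r *\<^sub>R R x" "R (- x) = - R x"
proof -
  show "R (x + y) = R x + R y" using assms by (simp add: real_linear_def)
  show sc: "R (r *\<^sub>R x) = r *\<^sub>R R x" for r x using assms by (simp add: real_linear_def)
  show "R (- x) = - R x" using sc[of "-1" x] by simp
qed

lemma real_linear_parts:
  assumes R: "real_linear R"
  shows "complex_linear (linear_part R)" "antilinear (antilinear_part R)"
    and "R x = linear_part R x + antilinear_part R x"
proof -
  note [simp] = real_linearD[OF R]
  have scR: "c *\<^sub>C r *\<^sub>R y = r *\<^sub>R c *\<^sub>C y" for c r and y :: 'a
    by (simp add: scaleC_scaleC mult.commute flip: scaleC_complex_of_real)
  have ii: "\<i> *\<^sub>C \<i> *\<^sub>C y = - y" for y :: 'a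
    by (simp add: scaleC_scaleC complex_vector.scale_minus_left scaleC_one)
  have add: "linear_part R (x + y) = linear_part R x + linear_part R y"
    "antilinear_part R (x + y) = antilinear_part R x + antilinear_part R y" for x y
    by (simp_all add: linear_part_def antilinear_part_def scaleC_add_right
        complex_vector.scale_right_diff_distrib algebra_simps)
  have sc: "linear_part R (r *\<^sub>R x) = r *\<^sub>R linear_part R x"
    "antilinear_part R (r *\<^sub>R x) = r *\<^sub>R antilinear_part R x" for r x
    by (simp_all add: linear_part_def antilinear_part_def scaleC_add_right scR
        complex_vector.scale_right_diff_distrib algebra_simps)
  have half: "\<i> *\<^sub>C (1/2) *\<^sub>C y = (1/2) *\<^sub>C \<i> *\<^sub>C y" for y :: 'a
    by (rule complex_vector.scale_left_commute)
  have i: "linear_part R (\<i> *\<^sub>C x) = \<i> *\<^sub>C linear_part R x"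
    "antilinear_part R (\<i> *\<^sub>C x) = - (\<i> *\<^sub>C antilinear_part R x)" for x
    by (simp_all add: linear_part_def antilinear_part_def half ii scaleC_add_right
        complex_vector.scale_right_diff_distrib complex_vector.scale_minus_right)
  have "linear_part R (c *\<^sub>C x) = c *\<^sub>C linear_part R x" for c x
  proof -
    have "linear_part R (c *\<^sub>C x) = Re c *\<^sub>R linear_part R x + Im c *\<^sub>R (\<i> *\<^sub>C linear_part R x)"
      unfolding scaleC_decompose[of c x] by (simp only: add sc i)
    then show ?thesis by (simp only: scaleC_decompose[of c "linear_part R x"])
  qed
  then show "complex_linear (linear_part R)" unfolding complex_linear_def using add by blast
  have "antilinear_part R (c *\<^sub>C x) = cnj c *\<^sub>C antilinear_part R x" for c x
  proof -
    have "antilinear_part R (c *\<^sub>C x)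
        = Re c *\<^sub>R antilinear_part R x + Im c *\<^sub>R (- (\<i> *\<^sub>C antilinear_part R x))"
      unfolding scaleC_decompose[of c x] by (simp only: add sc i)
    then show ?thesis by (simp add: scaleC_decompose[of "cnj c" "antilinear_part R x"])
  qed
  then show "antilinear (antilinear_part R)" unfolding antilinear_def using add by blast
  have "linear_part R x + antilinear_part R x = (1/2) *\<^sub>C (R x + R x)"
    by (simp add: linear_part_def antilinear_part_def flip: scaleC_add_right)
  then show "R x = linear_part R x + antilinear_part R x" by (simp add: scaleC_half)
qed

locale unitary_conj =
  fixes \<kappa> :: "'a::complex_hilbert \<Rightarrow> 'a"
  assumes uc: "unitary_conjugation \<kappa>"
begin

lemma conj_add: "\<kappa> (x + y) = \<kappa> x + \<kappa> y"
  using uc by (simp add: unitary_conjugation_def antilinear_def)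

lemma conj_scaleC: "\<kappa> (c *\<^sub>C x) = cnj c *\<^sub>C \<kappa> x"
  using uc by (simp add: unitary_conjugation_def antilinear_def)

lemma conj_scaleR: "\<kappa> (r *\<^sub>R x) = r *\<^sub>R \<kappa> x"
  by (simp add: conj_scaleC flip: scaleC_complex_of_real)

lemma conj_conj [simp]: "\<kappa> (\<kappa> x) = x"
  using uc by (simp add: unitary_conjugation_def fun_eq_iff)

lemma conj_norm [simp]: "norm (\<kappa> x) = norm x"
  using uc by (simp add: unitary_conjugation_def)

lemma conj_zero [simp]: "\<kappa> 0 = 0"
  using conj_scaleR[of 0 0] by simp

lemma conj_minus: "\<kappa> (- x) = - \<kappa> x"
  using conj_scaleR[of "-1" x] by simp

lemma conj_diff: "\<kappa> (x - y) = \<kappa> x - \<kappa> y"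
  using conj_add[of x "- y"] by (simp add: conj_minus)

lemma bounded_linear_conj: "bounded_linear \<kappa>"
  by (rule bounded_linear_intro[of _ 1]) (simp_all add: conj_add conj_scaleR)

lemma inner_conj: "inner (\<kappa> x) (\<kappa> y) = inner x y"
  unfolding dot_norm conj_add[symmetric] by simp

text \<open>An isometry preserves the real inner product by polarisation; antilinearity turns the imaginary part around.\<close>

lemma cinner_conj: "cinner (\<kappa> x) (\<kappa> y) = cnj (cinner x y)"
proof (rule complex_eqI)
  have Im: "Im (cinner u v) = inner u (\<i> *\<^sub>C v)" for u v :: 'a
    by (simp add: cinner_scaleC_right flip: Re_cinner)
  have "Im (cinner (\<kappa> x) (\<kappa> y)) = inner (\<kappa> x) (\<kappa> (- (\<i> *\<^sub>C y)))"
    by (simp add: Im conj_scaleC conj_minus complex_vector.scale_minus_left)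
  also have "\<dots> = - Im (cinner x y)"
    by (simp only: inner_conj Im inner_minus_right)
  finally show "Im (cinner (\<kappa> x) (\<kappa> y)) = Im (cnj (cinner x y))" by simp
qed (simp add: Re_cinner inner_conj)

lemma cinner_conj_left: "cinner (\<kappa> x) y = cnj (cinner x (\<kappa> y))"
  using cinner_conj[of x "\<kappa> y"] by simp

lemma compact_operator_conj:
  assumes "compact_operator A"
  shows "compact_operator (\<lambda>x. \<kappa> (A x))"
proof (rule compact_operatorI)
  show "compact (\<kappa> ` closure (A ` cball 0 1))"
    using compact_operatorD[OF assms]
    by (intro compact_continuous_image linear_continuous_on bounded_linear_conj)
qed (auto intro!: imageI image_unit_ball_closure)

lemma complex_linear_conj_antilinear:
  "antilinear A \<Longrightarrow> complex_linear (\<lambda>x. \<kappa> (A x))"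
  by (simp add: complex_linear_def antilinear_def conj_add conj_scaleC)

text \<open>Composing with the conjugation yields a complex linear operator \<open>G\<close> with \<open>G\<^sup>* G = A\<^sup>* A\<close>.\<close>

lemma antilinear_singular_number_conv:
  assumes A: "antilinear A" and compact: "compact_operator A"
  shows "antilinear_singular_number A = linear_singular_number (\<lambda>x. \<kappa> (A x))"
proof -
  let ?G = "\<lambda>x. \<kappa> (A x)"
  note lin = complex_linear_conj_antilinear[OF A]
  note bnd = bounded_linear_compact_operator[OF lin compact_operator_conj[OF compact]]
  have "antilinear_adjoint A = (\<lambda>y. linear_adjoint ?G (\<kappa> y))"
  proof (rule antilinear_adjoint_eqI)
    fix x y
    have "cinner (A x) y = cnj (cinner (?G x) (\<kappa> y))" by (simp add: cinner_conj)
    also have "\<dots> = cinner (linear_adjoint ?G (\<kappa> y)) x"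
      by (metis linear_adjoint_cinner[OF bnd lin] cinner_commute)
    finally show "cinner (A x) y = cinner (linear_adjoint ?G (\<kappa> y)) x" .
  qed
  then have "antilinear_adjoint A \<circ> A = linear_adjoint ?G \<circ> ?G" by (simp add: fun_eq_iff)
  then show ?thesis
    by (intro ext) (simp only: antilinear_singular_number_def linear_singular_number_def)
qed

lemma trace_class_nuclear:
  assumes R: "trace_class R"
  shows "nuclear (linear_part R) (trace_norm R)"
    "nuclear (\<lambda>x. \<kappa> (antilinear_part R x)) (trace_norm R)"
proof -
  have Rl: "real_linear R" using R by (simp add: trace_class_def)
  note parts = real_linear_parts[OF Rl]
  note R' = R[unfolded trace_class_def]
  note conv = antilinear_singular_number_conv[OF parts(2)]
  have C: "nuclear (linear_part R) (suminf (linear_singular_number (linear_part R)))"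
    using R' parts by (intro nuclear_suminf) auto
  have G: "nuclear (\<lambda>x. \<kappa> (antilinear_part R x)) (suminf (antilinear_singular_number (antilinear_part R)))"
    using R' conv complex_linear_conj_antilinear[OF parts(2)] compact_operator_conj
      nuclear_suminf[of "\<lambda>x. \<kappa> (antilinear_part R x)"] by auto
  show "nuclear (linear_part R) (trace_norm R)"
    using nuclear_mono[OF C] nuclear_nonneg[OF G] by (simp add: trace_norm_def)
  show "nuclear (\<lambda>x. \<kappa> (antilinear_part R x)) (trace_norm R)"
    using nuclear_mono[OF G] nuclear_nonneg[OF C] by (simp add: trace_norm_def)
qed

text \<open>The block operator with rows \<open>(C, \<kappa> G \<kappa>)\<close> and \<open>(G, \<kappa> C \<kappa>)\<close>, which for \<open>G = \<kappa> A\<close> is the complexification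
  of \<open>C + A\<close>.  It is expressed through \<open>G\<close> because \<open>C\<close> and \<open>G\<close> are both complex linear.\<close>

definition conj_block :: "('a \<Rightarrow> 'a) \<Rightarrow> ('a \<Rightarrow> 'a) \<Rightarrow> 'a \<times> 'a \<Rightarrow> 'a \<times> 'a" where
  "conj_block C G z = (C (fst z) + \<kappa> (G (\<kappa> (snd z))), G (fst z) + \<kappa> (C (\<kappa> (snd z))))"

lemma complex_linear_conj_block:
  assumes "complex_linear C" "complex_linear G"
  shows "complex_linear (conj_block C G)"
  using assms
  by (simp add: complex_linear_def conj_block_def conj_add conj_scaleC scaleC_prod_def scaleC_add_right)

text \<open>Test Bessel's inequality on the vectors \<open>(x, 0)\<close> and \<open>(0, x)\<close>.\<close>

lemma bessel_components:
  fixes e :: "'i \<Rightarrow> 'a \<times> 'a"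
  assumes "bessel I e"
  shows "bessel I (\<lambda>i. fst (e i))" "bessel I (\<lambda>i. snd (e i))"
  unfolding bessel_def
proof safe
  fix x :: 'a
  have "cinner (x, 0) (e i) = cinner x (fst (e i))" "cinner (0, x) (e i) = cinner x (snd (e i))" for i
    by (simp_all add: cinner_prod_def cinner_zero)
  then show "(\<Sum>i\<in>I. (cmod (cinner x (fst (e i))))\<^sup>2) \<le> (norm x)\<^sup>2"
    "(\<Sum>i\<in>I. (cmod (cinner x (snd (e i))))\<^sup>2) \<le> (norm x)\<^sup>2"
    using assms[unfolded bessel_def, rule_format, of "(x, 0)"]
      assms[unfolded bessel_def, rule_format, of "(0, x)"] by (simp_all add: norm_prod_def)
qed

lemma bessel_conj: "bessel I e \<Longrightarrow> bessel I (\<lambda>i. \<kappa> (e i))"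
  unfolding bessel_def
proof safe
  fix x assume *: "\<forall>x. (\<Sum>i\<in>I. (cmod (cinner x (e i)))\<^sup>2) \<le> (norm x)\<^sup>2"
  have "cmod (cinner x (\<kappa> (e i))) = cmod (cinner (\<kappa> x) (e i))" for i by (simp add: cinner_conj_left)
  then show "(\<Sum>i\<in>I. (cmod (cinner x (\<kappa> (e i))))\<^sup>2) \<le> (norm x)\<^sup>2"
    using *[rule_format, of "\<kappa> x"] by simp
qed

lemma nuclear_bound_conj_block:
  assumes C: "nuclear_bound C c" and G: "nuclear_bound G d"
  shows "nuclear_bound (conj_block C G) (2 * (c + d))"
  unfolding nuclear_bound_def
proof (intro allI impI)
  fix n and e f :: "nat \<Rightarrow> 'a \<times> 'a" assume *: "bessel {..<n} e" "bessel {..<n} f"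
  let ?x = "\<lambda>i. fst (e i)" and ?y = "\<lambda>i. \<kappa> (snd (e i))"
    and ?u = "\<lambda>i. fst (f i)" and ?v = "\<lambda>i. snd (f i)"
  have bd: "(\<Sum>i<n. cmod (cinner (K (a i)) (b i))) \<le> k"
    if "nuclear_bound K k" "bessel {..<n} a" "bessel {..<n} b" for K k and a b :: "nat \<Rightarrow> 'a"
    using that by (simp add: nuclear_bound_def)
  note B = bessel_components[OF *(1)] bessel_components[OF *(2)]
  have conj: "cmod (cinner (\<kappa> a) b) = cmod (cinner a (\<kappa> b))" for a b by (simp add: cinner_conj_left)
  have "(\<Sum>i<n. cmod (cinner (conj_block C G (e i)) (f i)))
    \<le> (\<Sum>i<n. (cmod (cinner (C (?x i)) (?u i)) + cmod (cinner (G (?y i)) (\<kappa> (?u i))))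
        + (cmod (cinner (G (?x i)) (?v i)) + cmod (cinner (C (?y i)) (\<kappa> (?v i)))))"
    by (intro sum_mono)
      (auto simp: conj_block_def cinner_prod_def cinner_add_left conj[symmetric]
        intro!: order_trans[OF norm_triangle_ineq] add_mono)
  also have "\<dots> \<le> (c + d) + (d + c)"
    unfolding sum.distrib by (intro add_mono bd C G B bessel_conj)
  finally show "(\<Sum>i<n. cmod (cinner (conj_block C G (e i)) (f i))) \<le> 2 * (c + d)" by simp
qed

lemma compact_operator_conj_block:
  assumes C: "compact_operator C" and G: "compact_operator G"
  shows "compact_operator (conj_block C G)"
proof (rule compact_operatorI)
  let ?X = "closure (C ` cball 0 1)" and ?Y = "closure (G ` cball 0 1)"
  let ?S = "{a + b |a b. a \<in> ?X \<and> b \<in> \<kappa> ` ?Y} \<times> {a + b |a b. a \<in> ?Y \<and> b \<in> \<kappa> ` ?X}"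
  have "compact (\<kappa> ` ?X)" "compact (\<kappa> ` ?Y)"
    using compact_operatorD[OF C] compact_operatorD[OF G]
    by (auto intro!: compact_continuous_image linear_continuous_on bounded_linear_conj)
  then show "compact ?S"
    using compact_operatorD[OF C] compact_operatorD[OF G]
    by (intro compact_Times compact_sums)
  show "conj_block C G ` cball 0 1 \<subseteq> ?S"
  proof (rule image_subsetI)
    fix z :: "'a \<times> 'a" assume "z \<in> cball 0 1"
    then have "norm (fst z, snd z) \<le> 1" by simp
    then have "norm (fst z) \<le> 1" "norm (\<kappa> (snd z)) \<le> 1"
      using norm_fst_le[of "fst z" "snd z"] norm_snd_le[of "snd z" "fst z"] by auto
    then have "C (fst z) \<in> ?X" "G (fst z) \<in> ?Y" "C (\<kappa> (snd z)) \<in> ?X" "G (\<kappa> (snd z)) \<in> ?Y"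
      by (auto intro: image_unit_ball_closure)
    then show "conj_block C G z \<in> ?S" unfolding conj_block_def by auto
  qed
qed

lemma nuclear_conj_block:
  assumes "nuclear C c" "nuclear G d"
  shows "nuclear (conj_block C G) (2 * (c + d))"
  using assms complex_linear_conj_block compact_operator_conj_block nuclear_bound_conj_block
  unfolding nuclear_def by blast

lemma conj_block_diff:
  "conj_block C G z - conj_block C' G' z = conj_block (\<lambda>x. C x - C' x) (\<lambda>x. G x - G' x) z"
  by (simp add: conj_block_def conj_diff)

lemma complexification_eq:
  assumes C: "complex_linear C" and A: "antilinear A" and S: "\<And>x. S x = x + (C x + A x)"
  shows "complexification \<kappa> S = (\<lambda>z. z + conj_block C (\<lambda>x. \<kappa> (A x)) z)"
proof -
  have C': "complex_linear (\<lambda>x. x + C x)" using C by (simp add: complex_linear_def scaleC_add_right)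
  note parts = linear_part_eqI[OF C' A, of S]
  show ?thesis
    by (rule ext)
      (auto simp: complexification_def parts S conj_block_def conj_add split: prod.split)
qed

text \<open>A kernel vector \<open>(x, \<kappa> w)\<close> of the complexification of \<open>S\<close> yields the kernel vectors
  \<open>x + w\<close> and \<open>\<i> (x - w)\<close> of \<open>S\<close>, which do not both vanish.\<close>

lemma conj_block_kernel_iff:
  assumes C: "complex_linear C" and A: "antilinear A"
  shows "(\<exists>z. z \<noteq> 0 \<and> z + conj_block C (\<lambda>x. \<kappa> (A x)) z = 0)
    \<longleftrightarrow> (\<exists>x. x \<noteq> 0 \<and> x + (C x + A x) = 0)"
proof
  assume "\<exists>x. x \<noteq> 0 \<and> x + (C x + A x) = 0"
  then obtain x where x: "x \<noteq> 0" "x + (C x + A x) = 0" by blast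
  have "\<kappa> (x + (C x + A x)) = 0" using x(2) by simp
  then have "(x, \<kappa> x) + conj_block C (\<lambda>x. \<kappa> (A x)) (x, \<kappa> x) = 0"
    using x(2) by (simp add: conj_block_def conj_add zero_prod_def add_ac)
  moreover have "(x, \<kappa> x) \<noteq> 0" using x(1) by (simp add: zero_prod_def)
  ultimately show "\<exists>z. z \<noteq> 0 \<and> z + conj_block C (\<lambda>x. \<kappa> (A x)) z = 0" by blast
next
  assume "\<exists>z. z \<noteq> 0 \<and> z + conj_block C (\<lambda>x. \<kappa> (A x)) z = 0"
  then obtain x y where z: "(x, y) \<noteq> 0" "(x, y) + conj_block C (\<lambda>x. \<kappa> (A x)) (x, y) = 0" by auto
  define w where "w = \<kappa> y"
  have y: "y = \<kappa> w" by (simp add: w_def)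
  note lin = complex_linearD[OF C]
  have A': "A (u + v) = A u + A v" "A (c *\<^sub>C u) = cnj c *\<^sub>C A u" for u v c
    using A by (simp_all add: antilinear_def)
  have Am: "A (- u) = - A u" for u
    using A'(2)[of "-1" u] by (simp add: complex_vector.scale_minus_left scaleC_one)
  have 1: "x + C x + A w = 0" using z(2) by (simp add: conj_block_def zero_prod_def y add_ac)
  have "\<kappa> (w + C w + A x) = 0"
    using z(2) by (simp add: conj_block_def zero_prod_def y conj_add add_ac)
  then have "\<kappa> (\<kappa> (w + C w + A x)) = \<kappa> 0" by simp
  then have 2: "w + C w + A x = 0" by simp
  have "(x + w) + (C (x + w) + A (x + w)) = (x + C x + A w) + (w + C w + A x)"
    by (simp add: lin A' add_ac)
  then have s: "(x + w) + (C (x + w) + A (x + w)) = 0" using 1 2 by simp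
  have "A (x - w) = A x - A w" using A'(1)[of x "- w"] by (simp add: Am)
  then have "A (\<i> *\<^sub>C (x - w)) = \<i> *\<^sub>C (A w - A x)"
    unfolding A'(2) by (simp add: complex_vector.scale_minus_left complex_vector.scale_right_diff_distrib)
  then have "\<i> *\<^sub>C (x - w) + (C (\<i> *\<^sub>C (x - w)) + A (\<i> *\<^sub>C (x - w)))
      = \<i> *\<^sub>C ((x + C x + A w) - (w + C w + A x))"
    unfolding lin(2) lin(5)
    by (simp add: scaleC_add_right complex_vector.scale_right_diff_distrib algebra_simps)
  then have d: "\<i> *\<^sub>C (x - w) + (C (\<i> *\<^sub>C (x - w)) + A (\<i> *\<^sub>C (x - w))) = 0"
    using 1 2 by (simp add: complex_vector.scale_zero_right)
  show "\<exists>x. x \<noteq> 0 \<and> x + (C x + A x) = 0"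
  proof (rule ccontr)
    assume "\<nexists>x. x \<noteq> 0 \<and> x + (C x + A x) = 0"
    then have "x + w = 0" "\<i> *\<^sub>C (x - w) = 0" using s d by blast+
    then have "x + w = 0" "x = w" by (auto simp: complex_vector.scale_eq_0_iff)
    then have "2 *\<^sub>R x = 0" by (simp add: scaleR_2)
    then have "x = 0" by simp
    then show False using z(1) \<open>x = w\<close> y by (simp add: zero_prod_def)
  qed
qed

end

section \<open>Characteristic polynomials\<close>

text \<open>Multiply from the left by \<open>diag (a, b)\<close> and from the right by \<open>diag (1, c)\<close> with the phase
  \<open>c = l / \<bar>l\<bar>\<close>, chosen such that \<open>a * c = b\<close> and \<open>b * c = cnj a\<close>.  Altogether this
  contributes the factor \<open>(a * b * c)^n = \<bar>l\<bar>^(- 2 * n)\<close>.\<close>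

lemma det_four_block_scaled:
  fixes l :: complex
  assumes carr: "D \<in> carrier_mat n n" "B \<in> carrier_mat n n" "B' \<in> carrier_mat n n" "D' \<in> carrier_mat n n"
    and l: "l \<noteq> 0"
  defines "a \<equiv> - 1 / l" and "b \<equiv> - 1 / complex_of_real (cmod l)"
  shows "det (four_block_mat (a \<cdot>\<^sub>m D) (b \<cdot>\<^sub>m B) (b \<cdot>\<^sub>m B') (cnj a \<cdot>\<^sub>m D'))
    = det (four_block_mat D B B' D') / complex_of_real (cmod l ^ (2 * n))"
proof -
  define c where "c = l / complex_of_real (cmod l)"
  have "l * cnj l = complex_of_real (cmod l) * complex_of_real (cmod l)"
    using complex_norm_square[of l] by (simp add: power2_eq_square)
  then have scal: "a * c = b" "b * c = cnj a" "a * b * c = 1 / (complex_of_real (cmod l))\<^sup>2"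
    using l by (auto simp: a_def b_def c_def field_simps power2_eq_square)
  have smult_smult: "x \<cdot>\<^sub>m (y \<cdot>\<^sub>m A) = (x * y) \<cdot>\<^sub>m A" for x y and A :: "complex mat"
    by (rule eq_matI) auto
  define M where "M = four_block_mat D B B' D'"
  define P where "P = four_block_mat (a \<cdot>\<^sub>m 1\<^sub>m n) (0\<^sub>m n n) (0\<^sub>m n n) (b \<cdot>\<^sub>m 1\<^sub>m n)"
  define Q where "Q = four_block_mat (1\<^sub>m n) (0\<^sub>m n n) (0\<^sub>m n n) (c \<cdot>\<^sub>m 1\<^sub>m n)"
  have PQ: "P \<in> carrier_mat (n + n) (n + n)" "Q \<in> carrier_mat (n + n) (n + n)"
    "M \<in> carrier_mat (n + n) (n + n)"
    using carr by (auto simp: P_def Q_def M_def)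
  have "P * M = four_block_mat (a \<cdot>\<^sub>m D) (a \<cdot>\<^sub>m B) (b \<cdot>\<^sub>m B') (b \<cdot>\<^sub>m D')"
    unfolding P_def M_def using carr
    by (subst mult_four_block_mat[of _ n n _ n _ n _ _ n _ n])
       (auto simp: mult_smult_assoc_mat[of _ n n _ n])
  moreover have "\<dots> * Q = four_block_mat (a \<cdot>\<^sub>m D) (b \<cdot>\<^sub>m B) (b \<cdot>\<^sub>m B') (cnj a \<cdot>\<^sub>m D')"
    unfolding Q_def using carr
    by (subst mult_four_block_mat[of _ n n _ n _ n _ _ n _ n])
       (auto simp: mult_smult_distrib[of _ n n _ n] smult_smult mult.commute[of c] scal)
  ultimately have "four_block_mat (a \<cdot>\<^sub>m D) (b \<cdot>\<^sub>m B) (b \<cdot>\<^sub>m B') (cnj a \<cdot>\<^sub>m D') = P * M * Q"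
    by simp
  then have "det (four_block_mat (a \<cdot>\<^sub>m D) (b \<cdot>\<^sub>m B) (b \<cdot>\<^sub>m B') (cnj a \<cdot>\<^sub>m D')) = det P * det M * det Q"
    using PQ by (simp add: det_mult[of _ "n + n"])
  also have "det P = a ^ n * b ^ n"
    unfolding P_def by (subst det_four_block_mat_upper_right_zero[of _ n _ n]) auto
  also have "det Q = c ^ n"
    unfolding Q_def by (subst det_four_block_mat_upper_right_zero[of _ n _ n]) auto
  also have "a ^ n * b ^ n * det M * c ^ n = (a * b * c) ^ n * det M"
    by (simp add: power_mult_distrib)
  finally show ?thesis
    by (simp add: scal(3) M_def power_divide power_mult)
qed

context unitary_conj
begin

definition double_basis :: "'a list \<Rightarrow> ('a \<times> 'a) list" where
  "double_basis es = map (\<lambda>e. (e, 0)) es @ map (\<lambda>e. (0, \<kappa> e)) es"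

lemma double_basis_nth:
  "i < length es \<Longrightarrow> double_basis es ! i = (es ! i, 0)"
  "i < length es \<Longrightarrow> double_basis es ! (length es + i) = (0, \<kappa> (es ! i))"
  by (simp_all add: double_basis_def nth_append)

lemma length_double_basis: "length (double_basis es) = length es + length es"
  by (simp add: double_basis_def)

lemma orthonormal_double_basis:
  assumes "orthonormal_basis es V"
  shows "orthonormal_basis (double_basis es) (cspan (set (double_basis es)))"
  unfolding orthonormal_basis_def length_double_basis
proof (intro conjI allI impI refl)
  let ?n = "length es"
  fix i j assume ij: "i < ?n + ?n" "j < ?n + ?n"
  have es: "cinner (es ! i) (es ! j) = (if i = j then 1 else 0)" if "i < ?n" "j < ?n" for i j
    using assms that by (simp add: orthonormal_basis_def)
  have split: "k < ?n \<or> (\<exists>k'<?n. k = ?n + k')" if "k < ?n + ?n" for k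
    using that by (metis add_less_cancel_left le_add_diff_inverse not_le)
  show "cinner (double_basis es ! i) (double_basis es ! j) = (if i = j then 1 else 0)"
    using split[OF ij(1)] split[OF ij(2)]
    by (auto simp: double_basis_nth cinner_prod_def cinner_zero cinner_conj es)
qed

lemma span_double_basis:
  assumes "u \<in> cspan (set es)" "w \<in> cspan (set es)"
  shows "(u, \<kappa> w) \<in> cspan (set (double_basis es))"
proof -
  let ?W = "cspan (set (double_basis es))"
  have mem: "(e, 0) \<in> ?W" "(0, \<kappa> e) \<in> ?W" if "e \<in> set es" for e
    using that by (auto simp: double_basis_def intro!: complex_vector.span_base)
  have "(u, 0) \<in> ?W" using assms(1)
  proof (induction rule: complex_vector.span_induct_alt)
    case base
    show ?case using complex_vector.span_zero[of "set (double_basis es)"] by (simp add: zero_prod_def)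
  next
    case (step c x y)
    have "(c *\<^sub>C x + y, 0::'a) = c *\<^sub>C (x, 0) + (y, 0)"
      by (simp add: scaleC_prod_def complex_vector.scale_zero_right)
    moreover have "c *\<^sub>C (x, 0) + (y, 0) \<in> ?W"
      by (intro complex_vector.span_add complex_vector.span_scale mem step)
    ultimately show ?case by (simp only:)
  qed
  moreover have "(0, \<kappa> w) \<in> ?W" using assms(2)
  proof (induction rule: complex_vector.span_induct_alt)
    case base
    show ?case using complex_vector.span_zero[of "set (double_basis es)"] by (simp add: zero_prod_def)
  next
    case (step c x y)
    have "(0::'a, \<kappa> (c *\<^sub>C x + y)) = cnj c *\<^sub>C (0, \<kappa> x) + (0, \<kappa> y)"
      by (simp add: scaleC_prod_def complex_vector.scale_zero_right conj_add conj_scaleC)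
    moreover have "cnj c *\<^sub>C (0, \<kappa> x) + (0, \<kappa> y) \<in> ?W"
      by (intro complex_vector.span_add complex_vector.span_scale mem step)
    ultimately show ?case by (simp only:)
  qed
  ultimately have "(u, 0) + (0, \<kappa> w) \<in> ?W" by (rule complex_vector.span_add)
  then show ?thesis by simp
qed

text \<open>The operator \<open>K\<^sub>l\<close> for which the characteristic function at \<open>l\<close> is \<open>det (I + K\<^sub>l)\<close>; the phase
  of \<open>l\<close> enters only through \<open>e^(-i\<theta>) / r = 1 / l\<close>.\<close>

definition char_block :: "complex \<Rightarrow> ('a \<Rightarrow> 'a) \<Rightarrow> 'a \<times> 'a \<Rightarrow> 'a \<times> 'a" where
  "char_block l S = conj_block (\<lambda>x. (- 1 / l) *\<^sub>C linear_part S x)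
     (\<lambda>x. \<kappa> ((- 1 / complex_of_real (cmod l)) *\<^sub>C antilinear_part S x))"

lemma scaled_parts:
  assumes "real_linear S"
  shows "complex_linear (\<lambda>x. c *\<^sub>C linear_part S x)" "antilinear (\<lambda>x. c *\<^sub>C antilinear_part S x)"
  using real_linear_parts(1,2)[OF assms]
  by (auto simp: complex_linear_def antilinear_def scaleC_add_right complex_vector.scale_left_commute)

lemma complex_linear_char_block:
  assumes "real_linear S"
  shows "complex_linear (char_block l S)"
  unfolding char_block_def
  by (intro complex_linear_conj_block complex_linear_conj_antilinear scaled_parts assms)

text \<open>In the orthonormal vectors \<open>(e, 0)\<close> and \<open>(0, \<kappa> e)\<close>, where \<open>e\<close> runs through the basis of the range of \<open>S\<close>,
  the operator \<open>I + char_block l S\<close> has the rescaled block matrix of the characteristic polynomial.\<close>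

lemma characteristic_polynomial_eq:
  assumes S: "finite_rank S" and l: "l \<noteq> 0"
  shows "finite_rank_linear (char_block l S)"
    and "characteristic_polynomial S l / complex_of_real (cmod l ^ (2 * operator_rank S))
      = finite_rank_det (char_block l S)"
proof -
  have Sl: "real_linear S" using S by (simp add: finite_rank_def)
  obtain B where B: "finite B" "range_span S = cspan B"
    using S by (auto simp: finite_rank_def)
  define es where "es = range_basis S"
  define a where "a = - 1 / l"
  define b where "b = - 1 / complex_of_real (cmod l)"
  have b_real: "cnj b = b" by (simp add: b_def)
  have "range S \<subseteq> cspan B"
    using B(2) range_span_subset_iff[of S B] by simp
  then have es: "orthonormal_basis es (range_span S)" using range_basis[OF B(1)] by (simp add: es_def)
  then have span: "range_span S = cspan (set es)" "distinct es" "orthonormal (set es)"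
    by (simp_all add: orthonormal_basis_iff)
  let ?n = "length es" and ?fs = "double_basis es" and ?K = "char_block l S"
  let ?W = "cspan (set ?fs)"
  have "operator_rank S = card (set es)"
    unfolding operator_rank_def span(1) by (rule dim_span_orthonormal[OF span(3)])
  then have rank: "operator_rank S = ?n" by (simp add: distinct_card[OF span(2)])
  have Sx: "S x \<in> cspan (set es)" for x
    unfolding span(1)[symmetric] range_span_def by (rule complex_vector.span_base) simp
  have parts: "linear_part S x \<in> cspan (set es)"
    "antilinear_part S x \<in> cspan (set es)" for x
    unfolding linear_part_def antilinear_part_def
    by (intro complex_vector.span_scale complex_vector.span_diff complex_vector.span_add Sx)+
  have K: "?K (x, y) = (a *\<^sub>C linear_part S x + b *\<^sub>C antilinear_part S (\<kappa> y),
      \<kappa> (b *\<^sub>C antilinear_part S x + a *\<^sub>C linear_part S (\<kappa> y)))" for x y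
    by (simp only: char_block_def conj_block_def conj_add a_def b_def fst_conv snd_conv conj_conj)
  have range: "range ?K \<subseteq> ?W"
  proof (rule image_subsetI)
    fix z
    have "?K (fst z, snd z) \<in> ?W"
      unfolding K by (intro span_double_basis complex_vector.span_add complex_vector.span_scale parts)
    then show "?K z \<in> ?W" by simp
  qed
  note lin = complex_linear_char_block[OF Sl, of l]
  show "finite_rank_linear ?K"
    unfolding finite_rank_linear_def using lin range by blast
  define C0 where "C0 = compression_matrix es (linear_part S)"
  define B0 where "B0 = compression_matrix es (antilinear_part S)"
  define D where "D = C0 - l \<cdot>\<^sub>m 1\<^sub>m ?n"
  have carr: "C0 \<in> carrier_mat ?n ?n" "B0 \<in> carrier_mat ?n ?n" "D \<in> carrier_mat ?n ?n"
    by (auto simp: C0_def B0_def D_def)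
  have D_nth: "a * D $$ (i, j) = cinner (es ! j + a *\<^sub>C linear_part S (es ! j)) (es ! i)"
    if "i < ?n" "j < ?n" for i j
  proof -
    have "D $$ (i, j) = cinner (linear_part S (es ! j)) (es ! i) - l * (if i = j then 1 else 0)"
      using that by (simp add: D_def C0_def compression_matrix_def)
    moreover have "cinner (es ! j) (es ! i) = (if i = j then 1 else 0)"
      using that es by (auto simp: orthonormal_basis_def)
    moreover have "a * l = - 1" using l by (simp add: a_def)
    ultimately show ?thesis
      unfolding cinner_add_left cinner_scaleC_left by (simp add: right_diff_distrib)
  qed
  have B_nth: "b * B0 $$ (i, j) = cinner (b *\<^sub>C antilinear_part S (es ! j)) (es ! i)"
    if "i < ?n" "j < ?n" for i j
    using that by (simp add: B0_def compression_matrix_def cinner_scaleC_left)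
  have lin0: "linear_part S 0 = 0" "antilinear_part S 0 = 0"
    using complex_linearD(3)[OF real_linear_parts(1)[OF Sl]] real_linear_parts(2)[OF Sl]
    by (auto simp: antilinear_def) (metis add_cancel_right_right add.right_neutral)
  have "compression_matrix ?fs (\<lambda>z. z + ?K z)
      = four_block_mat (a \<cdot>\<^sub>m D) (b \<cdot>\<^sub>m B0) (b \<cdot>\<^sub>m map_mat cnj B0) (cnj a \<cdot>\<^sub>m map_mat cnj D)"
    (is "?L = ?R")
  proof (rule eq_matI)
    fix i j assume "i < dim_row ?R" "j < dim_col ?R"
    then have ij: "i < ?n + ?n" "j < ?n + ?n" using carr by auto
    have split: "k < ?n \<or> (\<exists>k'<?n. k = ?n + k')" if "k < ?n + ?n" for k
      using that by (metis add_less_cancel_left le_add_diff_inverse not_le)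
    have L: "?L $$ (i, j) = cinner (?fs ! j + ?K (?fs ! j)) (?fs ! i)"
      using ij by (simp add: compression_matrix_nth length_double_basis)
    have bc: "b * cnj (B0 $$ (p, q)) = cnj (b * B0 $$ (p, q))" for p q by (simp add: b_real)
    have ac: "cnj a * cnj (D $$ (p, q)) = cnj (a * D $$ (p, q))" for p q by simp
    show "?L $$ (i, j) = ?R $$ (i, j)"
      using split[OF ij(1)] split[OF ij(2)] carr unfolding L
      by (auto simp: double_basis_nth K lin0 cinner_prod_def cinner_zero bc ac B_nth D_nth
          complex_vector.scale_zero_right cinner_conj simp flip: conj_add
          simp del: complex_cnj_mult complex_cnj_add)
  qed (use carr in \<open>auto simp: compression_matrix_def length_double_basis\<close>)
  moreover have "finite_rank_det ?K = det (compression_matrix ?fs (\<lambda>z. z + ?K z))"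
    by (rule finite_rank_det_eq[OF lin orthonormal_double_basis[OF es] range])
  moreover have "characteristic_polynomial S l
      = det (four_block_mat D B0 (map_mat cnj B0) (map_mat cnj D))"
    by (simp add: characteristic_polynomial_def Let_def D_def C0_def B0_def es_def)
  ultimately show "characteristic_polynomial S l / complex_of_real (cmod l ^ (2 * operator_rank S))
      = finite_rank_det ?K"
    using det_four_block_scaled[OF carr(3,2) _ _ l, of "map_mat cnj B0" "map_mat cnj D"] carr
    by (simp add: a_def b_def rank)
qed

section \<open>The characteristic function\<close>

lemma nuclear_char_block:
  assumes C: "nuclear (linear_part S) t" and G: "nuclear (\<lambda>x. \<kappa> (antilinear_part S x)) t"
  shows "nuclear (char_block l S) (2 * (t / cmod l + t / cmod l))"
  unfolding char_block_def conj_scaleC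
  using nuclear_conj_block[OF nuclear_scaleC[OF C] nuclear_scaleC[OF G],
    of "- 1 / l" "cnj (- 1 / complex_of_real (cmod l))"]
  by (simp add: norm_divide)

lemma nuclear_char_block_diff_point:
  assumes C: "nuclear (linear_part S) t" and G: "nuclear (\<lambda>x. \<kappa> (antilinear_part S x)) t"
  shows "nuclear (\<lambda>z. char_block l S z - char_block m S z)
    (2 * (cmod (1 / m - 1 / l) * t + cmod (1 / complex_of_real (cmod m) - 1 / complex_of_real (cmod l)) * t))"
  unfolding char_block_def conj_scaleC conj_block_diff complex_vector.scale_left_diff_distrib[symmetric]
  using nuclear_conj_block[OF nuclear_scaleC[OF C] nuclear_scaleC[OF G],
    of "1 / m - 1 / l" "1 / complex_of_real (cmod m) - 1 / complex_of_real (cmod l)"]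
  by simp

lemma nuclear_char_block_diff:
  assumes "trace_class (\<lambda>x. S x - R x)"
  shows "nuclear (\<lambda>z. char_block l S z - char_block l R z)
    (4 / cmod l * trace_norm (\<lambda>x. S x - R x))"
proof -
  have L: "linear_part (\<lambda>x. S x - R x) = (\<lambda>x. linear_part S x - linear_part R x)"
    by (simp add: fun_eq_iff linear_part_def complex_vector.scale_right_diff_distrib algebra_simps)
  have A: "antilinear_part (\<lambda>x. S x - R x) = (\<lambda>x. antilinear_part S x - antilinear_part R x)"
    by (simp add: fun_eq_iff antilinear_part_def complex_vector.scale_right_diff_distrib
        scaleC_add_right algebra_simps)
  have "(\<lambda>z. char_block l S z - char_block l R z) = char_block l (\<lambda>x. S x - R x)"
    unfolding char_block_def conj_block_diff L A
    by (simp only: complex_vector.scale_right_diff_distrib conj_diff)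
  then show ?thesis using nuclear_char_block[OF trace_class_nuclear[OF assms], of l] by simp
qed

lemma characteristic_function_eq:
  assumes R: "real_linear R" and l: "l \<noteq> 0"
  shows "characteristic_function \<kappa> R l = fredholm_det (\<lambda>z. z + char_block l R z)"
proof -
  have "cis (- Arg l) / complex_of_real (cmod l) = 1 / l"
  proof -
    have "l * cis (- Arg l) = complex_of_real (cmod l)"
      by (subst (1) rcis_cmod_Arg[symmetric]) (simp add: rcis_def cis_mult)
    then show ?thesis using l by (simp add: field_simps)
  qed
  then have s1: "(1 / cmod l) *\<^sub>R (cis (- Arg l) *\<^sub>C x) = (1 / l) *\<^sub>C x" for x :: 'a
    by (simp add: scaleC_scaleC flip: scaleC_complex_of_real)
  have s2: "(1 / cmod l) *\<^sub>R x = (1 / complex_of_real (cmod l)) *\<^sub>C x" for x :: 'a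
    using scaleC_complex_of_real[of "1 / cmod l" x] by simp
  have S: "x - (1 / cmod l) *\<^sub>R (cis (- Arg l) *\<^sub>C linear_part R x + antilinear_part R x)
      = x + ((- 1 / l) *\<^sub>C linear_part R x + (- 1 / complex_of_real (cmod l)) *\<^sub>C antilinear_part R x)" for x
    unfolding scaleR_add_right s1 unfolding s2 by (simp add: complex_vector.scale_minus_left)
  have "complexification \<kappa>
      (\<lambda>x. x - (1 / cmod l) *\<^sub>R (cis (- Arg l) *\<^sub>C linear_part R x + antilinear_part R x))
      = (\<lambda>z. z + char_block l R z)"
    unfolding char_block_def by (rule complexification_eq[OF scaled_parts[OF R]]) (rule S)
  then show ?thesis by (simp only: characteristic_function_def)
qed

text \<open>The square root \<open>w\<close> of the phase of \<open>l\<close> converts kernel vectors into eigenvectors: the linear part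
  multiplies \<open>w\<close> and the antilinear part its conjugate, and for this \<open>w\<close> both resulting coefficients
  coincide (the step named \<open>twist\<close>).\<close>

lemma characteristic_function_eq_0_iff:
  assumes R: "trace_class R" and l: "l \<noteq> 0"
  shows "characteristic_function \<kappa> R l = 0 \<longleftrightarrow> is_eigenvalue R l"
proof -
  have Rl: "real_linear R" using R by (simp add: trace_class_def)
  define a where "a = - 1 / l"
  define r where "r = complex_of_real (cmod l)"
  define b where "b = - 1 / r"
  define S where "S x = x + (a *\<^sub>C linear_part R x + b *\<^sub>C antilinear_part R x)" for x
  define w where "w = cis (Arg l / 2)"
  have lw: "l = r * (w * w)"
    by (subst (1) rcis_cmod_Arg[symmetric]) (simp add: rcis_def w_def r_def cis_mult)
  have ww: "w * cnj w = 1" "cnj w * w = 1" by (simp_all add: w_def cis_cnj cis_mult)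
  then have w0: "w \<noteq> 0" by auto
  then have cw: "cnj w = 1 / w" using ww by (simp add: field_simps)
  have r0: "r \<noteq> 0" using l by (simp add: r_def)
  have coeff: "a * w = - (cnj w / r)" "w = cnj w / r * l"
    unfolding a_def cw using w0 r0 lw by (simp_all add: field_simps)
  have twist: "S (w *\<^sub>C x) = (cnj w / r) *\<^sub>C (l *\<^sub>C x - R x)" for x
  proof -
    have S: "S (w *\<^sub>C x)
        = w *\<^sub>C x + ((a * w) *\<^sub>C linear_part R x + (b * cnj w) *\<^sub>C antilinear_part R x)"
      using real_linear_parts(1,2)[OF Rl]
      by (simp add: S_def complex_linear_def antilinear_def scaleC_scaleC)
    have b: "b * cnj w = - (cnj w / r)" by (simp add: b_def)
    have w: "w *\<^sub>C x = (cnj w / r) *\<^sub>C l *\<^sub>C x"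
      unfolding scaleC_scaleC by (simp only: coeff(2)[symmetric])
    show ?thesis
      unfolding S unfolding w coeff(1) b real_linear_parts(3)[OF Rl, of x]
      by (simp only: scaleC_add_right complex_vector.scale_right_diff_distrib
          complex_vector.scale_minus_left) (simp add: algebra_simps)
  qed
  have "characteristic_function \<kappa> R l = 0 \<longleftrightarrow> (\<exists>z. z \<noteq> 0 \<and> z + char_block l R z = 0)"
    unfolding characteristic_function_eq[OF Rl l]
    by (rule fredholm_det_eq_0_iff[OF nuclear_char_block[OF trace_class_nuclear[OF R]]])
  also have "\<dots> \<longleftrightarrow> (\<exists>x. x \<noteq> 0 \<and> S x = 0)"
    unfolding char_block_def S_def a_def b_def r_def
    by (rule conj_block_kernel_iff[OF scaled_parts[OF Rl]])
  also have "\<dots> \<longleftrightarrow> (\<exists>x. x \<noteq> 0 \<and> S (w *\<^sub>C x) = 0)"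
  proof -
    have "w *\<^sub>C cnj w *\<^sub>C x = x" for x :: 'a by (simp add: scaleC_scaleC ww scaleC_one)
    moreover have "cnj w *\<^sub>C x \<noteq> 0" if "x \<noteq> 0" for x :: 'a
      using that w0 by (simp add: complex_vector.scale_eq_0_iff)
    moreover have "w *\<^sub>C x \<noteq> 0" if "x \<noteq> 0" for x :: 'a
      using that w0 by (simp add: complex_vector.scale_eq_0_iff)
    ultimately show ?thesis by metis
  qed
  also have "\<dots> \<longleftrightarrow> is_eigenvalue R l"
    using w0 r0 unfolding twist is_eigenvalue_def
    by (simp add: complex_vector.scale_eq_0_iff) metis
  finally show ?thesis .
qed

lemma continuous_on_characteristic_function:
  assumes R: "trace_class R"
  shows "continuous_on (- {0}) (characteristic_function \<kappa> R)"
  unfolding continuous_on_sequentially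
proof (intro allI ballI impI)
  fix X :: "nat \<Rightarrow> complex" and l
  assume l: "l \<in> - {0}" and X: "(\<forall>n. X n \<in> - {0}) \<and> X \<longlonglongrightarrow> l"
  have Rl: "real_linear R" using R by (simp add: trace_class_def)
  note N = trace_class_nuclear[OF R]
  let ?t = "trace_norm R"
  let ?\<delta> = "\<lambda>n. 2 * (cmod (1 / l - 1 / X n) * ?t
    + cmod (1 / complex_of_real (cmod l) - 1 / complex_of_real (cmod (X n))) * ?t)"
  have "?\<delta> \<longlonglongrightarrow> 2 * (cmod (1 / l - 1 / l) * ?t
    + cmod (1 / complex_of_real (cmod l) - 1 / complex_of_real (cmod l)) * ?t)"
    using l X by (intro tendsto_intros) auto
  then have "?\<delta> \<longlonglongrightarrow> 0" by simp
  then have "(\<lambda>n. fredholm_det (\<lambda>z. z + char_block (X n) R z)) \<longlonglongrightarrow> fredholm_det (\<lambda>z. z + char_block l R z)"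
    by (rule fredholm_det_tendsto[OF nuclear_char_block[OF N] nuclear_char_block_diff_point[OF N]])
  then show "(characteristic_function \<kappa> R \<circ> X) \<longlonglongrightarrow> characteristic_function \<kappa> R l"
    using l X by (simp add: o_def characteristic_function_eq[OF Rl])
qed

lemma characteristic_function_limit:
  assumes R: "trace_class R" and Rs: "\<forall>n\<ge>1. finite_rank (Rs n) \<and> operator_rank (Rs n) = n"
    and conv: "trace_norm_convergent Rs R" and l: "l \<noteq> 0"
  shows "(\<lambda>n. characteristic_polynomial (Rs n) l / complex_of_real (cmod l ^ (2 * n)))
    \<longlonglongrightarrow> characteristic_function \<kappa> R l"
proof -
  have Rl: "real_linear R" using R by (simp add: trace_class_def)
  let ?\<delta> = "\<lambda>n. 4 / cmod l * trace_norm (\<lambda>x. Rs (Suc n) x - R x)"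
  have "?\<delta> \<longlonglongrightarrow> 0"
    using conv by (intro tendsto_mult_right_zero LIMSEQ_Suc) (simp add: trace_norm_convergent_def)
  moreover have "nuclear (\<lambda>z. char_block l (Rs (Suc n)) z - char_block l R z) (?\<delta> n)" for n
    using conv by (intro nuclear_char_block_diff) (simp add: trace_norm_convergent_def)
  moreover have "finite_rank_linear (char_block l (Rs (Suc n)))" for n
    using Rs l by (intro characteristic_polynomial_eq(1)) auto
  ultimately have "(\<lambda>n. finite_rank_det (char_block l (Rs (Suc n)))) \<longlonglongrightarrow> fredholm_det (\<lambda>z. z + char_block l R z)"
    by (intro fredholm_det_limit[OF nuclear_char_block[OF trace_class_nuclear[OF R]], where \<delta>="?\<delta>"])
  moreover have "finite_rank_det (char_block l (Rs (Suc n)))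
      = characteristic_polynomial (Rs (Suc n)) l / complex_of_real (cmod l ^ (2 * Suc n))" for n
    using Rs characteristic_polynomial_eq(2)[of "Rs (Suc n)", OF _ l] by simp
  ultimately show ?thesis
    unfolding characteristic_function_eq[OF Rl l] by (simp only: LIMSEQ_imp_Suc)
qed

end

theorem proposition4p7:
  fixes R \<kappa> :: "'a::complex_hilbert \<Rightarrow> 'a"
  assumes "separable_space (euclidean :: 'a topology)"
    and "unitary_conjugation \<kappa>"
    and "trace_class R"
  shows "continuous_on (- {0}) (characteristic_function \<kappa> R) \<and>
    (\<forall>l. l \<noteq> 0 \<longrightarrow> (characteristic_function \<kappa> R l = 0 \<longleftrightarrow> is_eigenvalue R l)) \<and>
    (\<forall>Rs. (\<forall>n\<ge>1. finite_rank (Rs n) \<and> operator_rank (Rs n) = n) \<and> trace_norm_convergent Rs R \<longrightarrow>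
      (\<forall>l. l \<noteq> 0 \<longrightarrow>
        (\<lambda>n. characteristic_polynomial (Rs n) l / complex_of_real (cmod l ^ (2 * n)))
          \<longlonglongrightarrow> characteristic_function \<kappa> R l))"
proof -
  interpret unitary_conj \<kappa> using assms(2) by unfold_locales
  show ?thesis
    using continuous_on_characteristic_function characteristic_function_eq_0_iff
      characteristic_function_limit assms(3) by blast
qed

end
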